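(* Let $\kappa\in\mathbb{R}$, let $(X,d_X)$ be a compact geodesic space with curvature $\leq\kappa$, and let $\xi\in\left(0,\tfrac1{14}\right]$ be a fixed number. For any $\beta$ satisfying $0<\beta<\frac{\Delta(X)}{1+2\xi}$, if a compact metric space $(S,d_S)$ is $(\xi\beta,\beta)$-Gromov–Hausdorff close to $X$, then $\mathcal{R}_\beta(S)\simeq X$ (homotopy equivalence). In particular, $$d_{GH}(X,S)<\xi\beta\quad\Longrightarrow\quad \mathcal{R}_\beta(S)\simeq X.$$
   Context: **Geodesic spaces.** For a metric space $(X,d)$ the length of a continuous path $\gamma:[a,b]\to X$ is $L(\gamma)=\sup\sum_i d(\gamma(t_i),\gamma(t_{i+1}))$ over all partitions. $(X,d)$ is a length space if $d(x_1,x_2)$ is the infimum of lengths of paths joining $x_1,x_2$ for all $x_1,x_2$; it is a geodesic space (called a complete length space in the paper) if moreover any two points are joined by a shortest path, i.e. a path of length $d(x_1,x_2)$. **Convexity radius.** A subset $A$ of a length space is convex if any two points of $A$ are joined by a unique shortest path and this path lies in $A$. The convexity radius is $\rho(X)=\inf_{x\in X}\sup\{r\ge 0\mid \mathbb{B}_X(x,s)\text{ is convex for all }0<s<r\}$, where $\mathbb{B}_X(x,s)$ is the open metric ball. **Curvature $\leq\kappa$.** A geodesic space $(X,d)$ has curvature $\leq\kappa$ if for any $x_1,x_2,x_3$ in a convex ball of $X$ (and, if $\kappa>0$, with $d(x_1,x_2)+d(x_2,x_3)+d(x_3,x_1)<2\pi/\sqrt{\kappa}$) and any $y$ on a shortest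 path joining $x_1$ and $x_3$, we have $d(y,x_2)\le d(\overline y,\overline x_2)$, where $\overline x_1,\overline x_2,\overline x_3$ are points of the model surface of constant curvature $\kappa$ with $d(\overline x_i,\overline x_j)=d(x_i,x_j)$ and $\overline y$ is the point on the shortest path joining $\overline x_1$ and $\overline x_3$ with $d(\overline x_1,\overline y)=d(x_1,y)$. **$\Delta(X)$.** $\Delta(X)=\min\{\frac{\pi}{4\sqrt{\kappa}},\rho(X)\}$ if $\kappa>0$, and $\Delta(X)=\rho(X)$ if $\kappa\le0$. **Gromov–Hausdorff notions.** A correspondence between $X$ and $Y$ is a subset $\mathscr{C}\subset X\times Y$ projecting onto both factors. $d_{GH}(X,Y)=\frac12\inf_{\mathscr{C}}\sup_{(x_1,y_1),(x_2,y_2)\in\mathscr{C}}|d_X(x_1,x_2)-d_Y(y_1,y_2)|$ over all correspondences. For $\varepsilon,R>0$, $X$ and $Y$ are $(\varepsilon,R)$-Gromov–Hausdorff close if there is a correspondence $\mathscr{C}\subset X\times Y$ such that for any $(x_1,y_1),(x_2,y_2)\in\mathscr{C}$ with $\min\{d_X(x_1,x_2),d_Y(y_1,y_2)\}\le R$ we have $|d_X(x_1,x_2)-d_Y(y_1,y_2)|\le2\varepsilon$. **Vietoris–Rips complex.** $\mathcal{R}_\beta(S)$ is (the geometric realization of) the abstract simplicial complex whose simplices are the non-empty finite subsets of $S$ with all pairwise distances $d_S$ strictly less than $\beta$. *)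

theory Defs
  imports "HOL-Analysis.Analysis"
begin

section \<open>Paths, geodesic spaces and convexity\<close>

definition mpath :: "'a metric \<Rightarrow> real \<Rightarrow> real \<Rightarrow> (real \<Rightarrow> 'a) \<Rightarrow> bool" where
  "mpath X a b \<gamma> \<longleftrightarrow> a \<le> b \<and> continuous_map (top_of_set {a..b}) (mtopology_of X) \<gamma>"

definition interval_partition :: "real \<Rightarrow> real \<Rightarrow> nat \<Rightarrow> (nat \<Rightarrow> real) \<Rightarrow> bool" where
  "interval_partition a b n t \<longleftrightarrow> t 0 = a \<and> t n = b \<and> mono_on {..n} t"

definition mlength :: "'a metric \<Rightarrow> real \<Rightarrow> real \<Rightarrow> (real \<Rightarrow> 'a) \<Rightarrow> ennreal" where
  "mlength X a b \<gamma> =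
     (SUP (n, t) \<in> {(n, t). interval_partition a b n t}.
        ennreal (\<Sum>i<n. mdist X (\<gamma> (t i)) (\<gamma> (t (Suc i)))))"

definition length_space :: "'a metric \<Rightarrow> bool" where
  "length_space X \<longleftrightarrow>
     (\<forall>x \<in> mspace X. \<forall>y \<in> mspace X.
        ennreal (mdist X x y) = Inf {mlength X a b \<gamma> | a b \<gamma>. mpath X a b \<gamma> \<and> \<gamma> a = x \<and> \<gamma> b = y})"

definition shortest_path ::
    "'a metric \<Rightarrow> 'a \<Rightarrow> 'a \<Rightarrow> real \<Rightarrow> real \<Rightarrow> (real \<Rightarrow> 'a) \<Rightarrow> bool" where
  "shortest_path X x y a b \<gamma> \<longleftrightarrow>
     mpath X a b \<gamma> \<and> \<gamma> a = x \<and> \<gamma> b = y \<and> mlength X a b \<gamma> = ennreal (mdist X x y)"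

definition geodesic_space :: "'a metric \<Rightarrow> bool" where
  "geodesic_space X \<longleftrightarrow>
     length_space X \<and>
     (\<forall>x \<in> mspace X. \<forall>y \<in> mspace X. \<exists>a b \<gamma>. shortest_path X x y a b \<gamma>)"

text \<open>Shortest paths are unique only up to reparametrization. Two paths are identified if they
  become equal after nondecreasing continuous changes of parameter from a common interval; these
  may be constant on subintervals, since a shortest path may pause.\<close>

definition same_curve ::
    "real \<Rightarrow> real \<Rightarrow> (real \<Rightarrow> 'a) \<Rightarrow> real \<Rightarrow> real \<Rightarrow> (real \<Rightarrow> 'a) \<Rightarrow> bool" where
  "same_curve a b \<gamma> a' b' \<gamma>' \<longleftrightarrow>
     (\<exists>\<phi> \<phi>'. continuous_on {0..1} \<phi> \<and> mono_on {0..1} \<phi> \<and> \<phi> ` {0..1} = {a..b} \<and>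
             continuous_on {0..1} \<phi>' \<and> mono_on {0..1} \<phi>' \<and> \<phi>' ` {0..1} = {a'..b'} \<and>
             (\<forall>t \<in> {0..1::real}. \<gamma> (\<phi> t) = \<gamma>' (\<phi>' t)))"

definition geodesically_convex :: "'a metric \<Rightarrow> 'a set \<Rightarrow> bool" where
  "geodesically_convex X A \<longleftrightarrow>
     A \<subseteq> mspace X \<and>
     (\<forall>x \<in> A. \<forall>y \<in> A.
        (\<exists>a b \<gamma>. shortest_path X x y a b \<gamma>) \<and>
        (\<forall>a b \<gamma> a' b' \<gamma>'. shortest_path X x y a b \<gamma> \<and> shortest_path X x y a' b' \<gamma>'
            \<longrightarrow> same_curve a b \<gamma> a' b' \<gamma>') \<and>
        (\<forall>a b \<gamma>. shortest_path X x y a b \<gamma> \<longrightarrow> \<gamma> ` {a..b} \<subseteq> A))"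

definition convexity_radius :: "'a metric \<Rightarrow> ennreal" where
  "convexity_radius X =
     (INF x \<in> mspace X.
        Sup {ennreal r | r. 0 \<le> r \<and> (\<forall>s. 0 < s \<and> s < r \<longrightarrow> geodesically_convex X (mball_of X x s))})"

section \<open>The model surfaces of constant curvature\<close>

definition lorentz :: "real^3 \<Rightarrow> real^3 \<Rightarrow> real" where
  "lorentz x y = x$3 * y$3 - x$1 * y$1 - x$2 * y$2"

text \<open>For \<open>\<kappa> > 0\<close> the unit sphere with its angular distance rescaled by \<open>1 / sqrt \<kappa>\<close>, for
  \<open>\<kappa> = 0\<close> the Euclidean plane, for \<open>\<kappa> < 0\<close> the hyperboloid model of the hyperbolic plane rescaled
  by \<open>1 / sqrt (-\<kappa>)\<close>. The value \<open>0\<close> of the distance off the carrier only serves the library's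
  convention that distance functions are nonnegative everywhere.\<close>

definition model_carrier :: "real \<Rightarrow> (real^3) set" where
  "model_carrier \<kappa> =
     (if \<kappa> > 0 then sphere 0 1
      else if \<kappa> = 0 then {x. x$3 = 0}
      else {x. lorentz x x = 1 \<and> x$3 > 0})"

definition model_dist :: "real \<Rightarrow> real^3 \<Rightarrow> real^3 \<Rightarrow> real" where
  "model_dist \<kappa> x y =
     (if x \<notin> model_carrier \<kappa> \<or> y \<notin> model_carrier \<kappa> then 0
      else if \<kappa> > 0 then arccos (x \<bullet> y) / sqrt \<kappa>
      else if \<kappa> = 0 then dist x y
      else arcosh (lorentz x y) / sqrt (- \<kappa>))"

definition model_surface :: "real \<Rightarrow> (real^3) metric" where
  "model_surface \<kappa> = metric (model_carrier \<kappa>, model_dist \<kappa>)"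

lemma arccos_triangle:
  fixes x y z :: "'a::real_inner"
  assumes "norm x = 1" "norm y = 1" "norm z = 1"
  shows "arccos (x \<bullet> z) \<le> arccos (x \<bullet> y) + arccos (y \<bullet> z)"
proof -
  have b: "-1 \<le> u \<bullet> v \<and> u \<bullet> v \<le> 1" if "norm u = 1" "norm v = 1" for u v :: 'a
    using Cauchy_Schwarz_ineq2[of u v] that by auto
  define p q where "p = x \<bullet> y" and "q = y \<bullet> z"
  have p: "-1 \<le> p" "p \<le> 1" and q: "-1 \<le> q" "q \<le> 1" and r: "-1 \<le> x \<bullet> z" "x \<bullet> z \<le> 1"
    using b assms by (auto simp: p_def q_def)
  have 1: "x \<bullet> x = 1" "y \<bullet> y = 1" "z \<bullet> z = 1"
    using assms by (auto simp: norm_eq_1)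
  show ?thesis
  proof (cases "arccos p + arccos q \<le> pi")
    case True
    let ?u = "x - p *\<^sub>R y" and ?w = "z - q *\<^sub>R y"
    have u: "?u \<bullet> ?u = 1 - p\<^sup>2" and w: "?w \<bullet> ?w = 1 - q\<^sup>2" and uw: "?u \<bullet> ?w = x \<bullet> z - p * q"
      using 1 by (simp_all add: p_def q_def algebra_simps inner_commute power2_eq_square)
    have "\<bar>?u \<bullet> ?w\<bar> \<le> sqrt (1 - p\<^sup>2) * sqrt (1 - q\<^sup>2)"
      using Cauchy_Schwarz_ineq2[of ?u ?w] by (simp only: norm_eq_sqrt_inner u w)
    then have "cos (arccos p + arccos q) \<le> x \<bullet> z"
      using p q by (simp add: cos_add sin_arccos_abs uw abs_le_iff)
    moreover have "0 \<le> arccos p + arccos q"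
      using p q by (simp add: arccos_lbound)
    ultimately have "arccos (x \<bullet> z) \<le> arccos (cos (arccos p + arccos q))"
      using r by (intro arccos_le_mono[THEN iffD2]) auto
    then show ?thesis
      using True \<open>0 \<le> _\<close> by (simp add: arccos_cos p_def q_def)
  next
    case False
    then show ?thesis
      using arccos_ubound[OF r] by (simp add: p_def q_def)
  qed
qed

lemma lorentz_ge_1:
  assumes "lorentz x x = 1" "x$3 > 0" "lorentz y y = 1" "y$3 > 0"
  shows "lorentz x y \<ge> 1" and "lorentz x y = 1 \<Longrightarrow> x = y"
proof -
  let ?s = "x$1 * y$1 + x$2 * y$2"
  let ?e = "(x$1 - y$1)\<^sup>2 + (x$2 - y$2)\<^sup>2 + (x$1 * y$2 - x$2 * y$1)\<^sup>2"
  have x3: "(x$3)\<^sup>2 = 1 + (x$1)\<^sup>2 + (x$2)\<^sup>2" and y3: "(y$3)\<^sup>2 = 1 + (y$1)\<^sup>2 + (y$2)\<^sup>2"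
    using assms by (auto simp: lorentz_def power2_eq_square)
  have "(x$3 * y$3)\<^sup>2 = (1 + (x$1)\<^sup>2 + (x$2)\<^sup>2) * (1 + (y$1)\<^sup>2 + (y$2)\<^sup>2)"
    by (simp add: power_mult_distrib x3 y3)
  also have "\<dots> = (1 + ?s)\<^sup>2 + ?e"
    by (simp add: power2_eq_square algebra_simps)
  finally have eq: "(x$3 * y$3)\<^sup>2 = (1 + ?s)\<^sup>2 + ?e" .
  moreover have pos: "x$3 * y$3 > 0" using assms by simp
  ultimately have "(1 + ?s)\<^sup>2 \<le> (x$3 * y$3)\<^sup>2" by simp
  then have "1 + ?s \<le> x$3 * y$3"
    by (rule power2_le_imp_le) (use pos in simp)
  then show "lorentz x y \<ge> 1" by (simp add: lorentz_def)
  assume "lorentz x y = 1"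
  then have "x$3 * y$3 = 1 + ?s" by (simp add: lorentz_def)
  then have "?e = 0" using eq by simp
  then have "(x$1 - y$1)\<^sup>2 = 0" "(x$2 - y$2)\<^sup>2 = 0"
    by (smt (verit) zero_le_power2)+
  then have e: "x$1 = y$1" "x$2 = y$2" by auto
  then have "(x$3)\<^sup>2 = (y$3)\<^sup>2" by (simp add: x3 y3)
  then have "x$3 = y$3" using assms by (simp add: power2_eq_iff)
  with e show "x = y" by (simp add: vec_eq_iff forall_3)
qed

lemma arcosh_lorentz_triangle:
  assumes x: "lorentz x x = 1" "x$3 > 0" and y: "lorentz y y = 1" "y$3 > 0"
    and z: "lorentz z z = 1" "z$3 > 0"
  shows "arcosh (lorentz x z) \<le> arcosh (lorentz x y) + arcosh (lorentz y z)"
proof -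
  define p q r where "p = lorentz x y" and "q = lorentz y z" and "r = lorentz x z"
  have p: "p \<ge> 1" and q: "q \<ge> 1" and r: "r \<ge> 1"
    using lorentz_ge_1 x y z by (auto simp: p_def q_def r_def)
  have "lorentz x x * lorentz y y * lorentz z z + 2 * p * q * r
          - lorentz x x * q\<^sup>2 - lorentz y y * r\<^sup>2 - lorentz z z * p\<^sup>2
        = (x$1 * (y$2 * z$3 - y$3 * z$2) - x$2 * (y$1 * z$3 - y$3 * z$1)
            + x$3 * (y$1 * z$2 - y$2 * z$1))\<^sup>2"
    unfolding p_def q_def r_def lorentz_def by algebra
  then have "0 \<le> 1 + 2 * p * q * r - q\<^sup>2 - r\<^sup>2 - p\<^sup>2"
    using x y z by simp
  then have "(r - p * q)\<^sup>2 \<le> (p\<^sup>2 - 1) * (q\<^sup>2 - 1)"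
    by (simp add: power2_eq_square algebra_simps)
  then have "r - p * q \<le> sqrt (p\<^sup>2 - 1) * sqrt (q\<^sup>2 - 1)"
    by (metis real_le_rsqrt real_sqrt_mult)
  then have "r \<le> cosh (arcosh p + arcosh q)"
    using p q by (simp add: cosh_add cosh_arcosh_real sinh_arcosh_real)
  moreover have "0 \<le> arcosh p + arcosh q"
    using p q by simp
  moreover have "cosh (arcosh r) = r" "0 \<le> arcosh r"
    using r by (simp_all add: cosh_arcosh_real)
  ultimately have "arcosh r \<le> arcosh p + arcosh q"
    by (metis cosh_real_nonneg_le_iff)
  then show ?thesis
    by (simp add: p_def q_def r_def)
qed

lemma Metric_space_model: "Metric_space (model_carrier \<kappa>) (model_dist \<kappa>)"
proof -
  consider "\<kappa> > 0" | "\<kappa> = 0" | "\<kappa> < 0" by linarith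
  then show ?thesis
  proof cases
    case 1
    have b: "-1 \<le> x \<bullet> y \<and> x \<bullet> y \<le> 1" if "norm x = 1" "norm y = 1" for x y :: "real^3"
      using Cauchy_Schwarz_ineq2[of x y] that by auto
    show ?thesis
    proof
      fix x y :: "real^3"
      show "0 \<le> model_dist \<kappa> x y"
        using 1 b[of x y] by (simp add: model_dist_def model_carrier_def arccos_lbound)
      show "model_dist \<kappa> x y = model_dist \<kappa> y x"
        using 1 by (simp add: model_dist_def inner_commute disj_commute)
    next
      fix x y :: "real^3"
      assume xy: "x \<in> model_carrier \<kappa>" "y \<in> model_carrier \<kappa>"
      then have n: "norm x = 1" "norm y = 1" using 1 by (auto simp: model_carrier_def)
      have "arccos (x \<bullet> y) = 0 \<longleftrightarrow> x \<bullet> y = 1"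
        using b[OF n] by (metis arccos_1 cos_arccos cos_zero)
      also have "\<dots> \<longleftrightarrow> x = y"
        using n by (metis norm_eq_1 norm_cauchy_schwarz_eq mult_1 scaleR_one)
      finally show "model_dist \<kappa> x y = 0 \<longleftrightarrow> x = y"
        using 1 xy by (simp add: model_dist_def)
    next
      fix x y z :: "real^3"
      assume "x \<in> model_carrier \<kappa>" "y \<in> model_carrier \<kappa>" "z \<in> model_carrier \<kappa>"
      then show "model_dist \<kappa> x z \<le> model_dist \<kappa> x y + model_dist \<kappa> y z"
        using 1 arccos_triangle[of x y z]
        by (simp add: model_dist_def model_carrier_def divide_right_mono flip: add_divide_distrib)
    qed
  next
    case 2
    then show ?thesis
      by unfold_locales (auto simp: model_dist_def dist_commute dist_triangle)
  next
    case 3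
    show ?thesis
    proof
      fix x y :: "real^3"
      show "0 \<le> model_dist \<kappa> x y"
        using 3 lorentz_ge_1(1)[of x y] by (simp add: model_dist_def model_carrier_def)
      show "model_dist \<kappa> x y = model_dist \<kappa> y x"
        using 3 by (simp add: model_dist_def lorentz_def mult.commute disj_commute)
    next
      fix x y :: "real^3"
      assume xy: "x \<in> model_carrier \<kappa>" "y \<in> model_carrier \<kappa>"
      then have n: "lorentz x x = 1" "x$3 > 0" "lorentz y y = 1" "y$3 > 0"
        using 3 by (auto simp: model_carrier_def)
      have "arcosh (lorentz x y) = 0 \<longleftrightarrow> lorentz x y = 1"
        using lorentz_ge_1(1)[OF n] by (metis arcosh_1 cosh_arcosh_real cosh_0)
      also have "\<dots> \<longleftrightarrow> x = y"
        using lorentz_ge_1(2)[OF n] n by auto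
      finally show "model_dist \<kappa> x y = 0 \<longleftrightarrow> x = y"
        using 3 xy by (simp add: model_dist_def)
    next
      fix x y z :: "real^3"
      assume "x \<in> model_carrier \<kappa>" "y \<in> model_carrier \<kappa>" "z \<in> model_carrier \<kappa>"
      then show "model_dist \<kappa> x z \<le> model_dist \<kappa> x y + model_dist \<kappa> y z"
        using 3 arcosh_lorentz_triangle[of x y z]
        by (simp add: model_dist_def model_carrier_def divide_right_mono flip: add_divide_distrib)
    qed
  qed
qed

lemma mspace_model_surface [simp]: "mspace (model_surface \<kappa>) = model_carrier \<kappa>"
  by (simp add: model_surface_def Metric_space_model Metric_space.mspace_metric)

lemma mdist_model_surface [simp]: "mdist (model_surface \<kappa>) = model_dist \<kappa>"
  by (simp add: model_surface_def Metric_space_model Metric_space.mdist_metric)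

section \<open>Curvature bounded above\<close>

definition curvature_le :: "real \<Rightarrow> 'a metric \<Rightarrow> bool" where
  "curvature_le \<kappa> X \<longleftrightarrow>
     (\<forall>p r x1 x2 x3 y a b \<gamma> x1' x2' x3' y' a' b' \<gamma>'.
        p \<in> mspace X \<and> 0 < r \<and> geodesically_convex X (mball_of X p r) \<and>
        x1 \<in> mball_of X p r \<and> x2 \<in> mball_of X p r \<and> x3 \<in> mball_of X p r \<and>
        (\<kappa> > 0 \<longrightarrow> mdist X x1 x2 + mdist X x2 x3 + mdist X x3 x1 < 2 * pi / sqrt \<kappa>) \<and>
        shortest_path X x1 x3 a b \<gamma> \<and> y \<in> \<gamma> ` {a..b} \<and>
        x1' \<in> mspace (model_surface \<kappa>) \<and> x2' \<in> mspace (model_surface \<kappa>) \<and>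
        x3' \<in> mspace (model_surface \<kappa>) \<and>
        mdist (model_surface \<kappa>) x1' x2' = mdist X x1 x2 \<and>
        mdist (model_surface \<kappa>) x2' x3' = mdist X x2 x3 \<and>
        mdist (model_surface \<kappa>) x1' x3' = mdist X x1 x3 \<and>
        shortest_path (model_surface \<kappa>) x1' x3' a' b' \<gamma>' \<and> y' \<in> \<gamma>' ` {a'..b'} \<and>
        mdist (model_surface \<kappa>) x1' y' = mdist X x1 y
        \<longrightarrow> mdist X y x2 \<le> mdist (model_surface \<kappa>) y' x2')"

definition Delta :: "real \<Rightarrow> 'a metric \<Rightarrow> ennreal" where
  "Delta \<kappa> X =
     (if \<kappa> > 0 then min (ennreal (pi / (4 * sqrt \<kappa>))) (convexity_radius X)
      else convexity_radius X)"

section \<open>Gromov--Hausdorff notions\<close>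

definition correspondence :: "'a metric \<Rightarrow> 'b metric \<Rightarrow> ('a \<times> 'b) set \<Rightarrow> bool" where
  "correspondence X Y C \<longleftrightarrow>
     C \<subseteq> mspace X \<times> mspace Y \<and> fst ` C = mspace X \<and> snd ` C = mspace Y"

definition gh_dist :: "'a metric \<Rightarrow> 'b metric \<Rightarrow> ennreal" where
  "gh_dist X Y =
     (INF C \<in> {C. correspondence X Y C}.
        SUP ((x1, y1), (x2, y2)) \<in> C \<times> C. ennreal \<bar>mdist X x1 x2 - mdist Y y1 y2\<bar>) / 2"

definition gh_close :: "real \<Rightarrow> real \<Rightarrow> 'a metric \<Rightarrow> 'b metric \<Rightarrow> bool" where
  "gh_close \<epsilon> R X Y \<longleftrightarrow>
     (\<exists>C. correspondence X Y C \<and>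
        (\<forall>(x1, y1) \<in> C. \<forall>(x2, y2) \<in> C.
           min (mdist X x1 x2) (mdist Y y1 y2) \<le> R
           \<longrightarrow> \<bar>mdist X x1 x2 - mdist Y y1 y2\<bar> \<le> 2 * \<epsilon>))"

section \<open>Vietoris--Rips complexes and geometric realization\<close>

definition vietoris_rips :: "real \<Rightarrow> 'a metric \<Rightarrow> 'a set set" where
  "vietoris_rips \<beta> S =
     {\<sigma>. \<sigma> \<noteq> {} \<and> finite \<sigma> \<and> \<sigma> \<subseteq> mspace S \<and> (\<forall>x \<in> \<sigma>. \<forall>y \<in> \<sigma>. mdist S x y < \<beta>)}"

text \<open>Points of the geometric realization are given by barycentric coordinates.\<close>

definition closed_face :: "'a set \<Rightarrow> ('a \<Rightarrow> real) set" where
  "closed_face \<sigma> = {f. (\<forall>v. 0 \<le> f v) \<and> (\<forall>v. v \<notin> \<sigma> \<longrightarrow> f v = 0) \<and> sum f \<sigma> = 1}"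

text \<open>The weak topology: a set is open iff it meets every closed face in a relatively open set,
  where the (finite-dimensional) faces carry the topology of coordinatewise convergence.\<close>

definition geometric_realization :: "'a set set \<Rightarrow> ('a \<Rightarrow> real) topology" where
  "geometric_realization K =
     topology (\<lambda>U. U \<subseteq> \<Union> (closed_face ` K) \<and>
                   (\<forall>\<sigma> \<in> K. openin (top_of_set (closed_face \<sigma>)) (U \<inter> closed_face \<sigma>)))"

lemma openin_geometric_realization:
  "openin (geometric_realization K) U \<longleftrightarrow>
     U \<subseteq> \<Union> (closed_face ` K) \<and>
     (\<forall>\<sigma> \<in> K. openin (top_of_set (closed_face \<sigma>)) (U \<inter> closed_face \<sigma>))"
proof -
  let ?O = "\<lambda>\<sigma> U. openin (top_of_set (closed_face \<sigma>)) (U \<inter> closed_face \<sigma>)"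
  have Int: "?O \<sigma> (S \<inter> T)" if "?O \<sigma> S" "?O \<sigma> T" for \<sigma> :: "'a set" and S T
  proof -
    have "S \<inter> T \<inter> closed_face \<sigma> = (S \<inter> closed_face \<sigma>) \<inter> (T \<inter> closed_face \<sigma>)" by blast
    then show ?thesis using openin_Int[OF that] by simp
  qed
  have Un: "?O \<sigma> (\<Union>\<U>)" if "\<And>U. U \<in> \<U> \<Longrightarrow> ?O \<sigma> U" for \<sigma> :: "'a set" and \<U>
  proof -
    have "\<Union>\<U> \<inter> closed_face \<sigma> = (\<Union>U \<in> \<U>. U \<inter> closed_face \<sigma>)" by blast
    moreover have "openin (top_of_set (closed_face \<sigma>)) (\<Union>U \<in> \<U>. U \<inter> closed_face \<sigma>)"
      by (rule openin_Union) (use that in auto)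
    ultimately show ?thesis by simp
  qed
  have "istopology (\<lambda>U. U \<subseteq> \<Union> (closed_face ` K) \<and> (\<forall>\<sigma> \<in> K. ?O \<sigma> U))"
    unfolding istopology_def
    by (intro conjI allI impI ballI Int Un Union_least le_infI1) simp_all
  then show ?thesis
    by (simp add: geometric_realization_def topology_inverse')
qed

lemma topspace_geometric_realization:
  "topspace (geometric_realization K) = \<Union> (closed_face ` K)"
proof
  show "topspace (geometric_realization K) \<subseteq> \<Union> (closed_face ` K)"
    using openin_geometric_realization openin_topspace by blast
  have "\<Union> (closed_face ` K) \<inter> closed_face \<sigma> = closed_face \<sigma>" if "\<sigma> \<in> K" for \<sigma>
    using that by auto
  then have "openin (geometric_realization K) (\<Union> (closed_face ` K))"
    by (simp add: openin_geometric_realization)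
  then show "\<Union> (closed_face ` K) \<subseteq> topspace (geometric_realization K)"
    by (rule openin_subset)
qed

end

theory Submission
  imports Defs "HOL-Probability.Discrete_Topology"
begin

text \<open>Put \<open>e = 2\<xi>\<beta>\<close>, \<open>D = \<beta> + e\<close> and choose, along the correspondence, a point of \<open>X\<close> for
  every point of \<open>S\<close> and conversely. Since \<open>D\<close> is below the convexity radius, the vertices of a
  simplex \<open>\<sigma>\<close> of the Rips complex \<open>K\<close> have images of diameter less than \<open>D\<close> in a convex ball. The
  curvature bound enters only through a form of Jung's theorem: these images lie in a ball of radius
  \<open>r = 37/50 * D\<close> about a point \<open>c \<sigma>\<close> of their hull, and \<open>r + e < \<beta>\<close> because \<open>\<xi> \<le> 1/14\<close>.

  A point of \<open>|K|\<close> determines a chain of simplices \<open>\<sigma>\<^sub>0 \<subset> \<dots> \<subset> \<sigma>\<^sub>k\<close> with weights, namely its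
  coordinates in the barycentric subdivision. The map \<open>|K| \<rightarrow> X\<close> sends it to an iterated geodesic
  combination of \<open>c \<sigma>\<^sub>0, \<dots>, c \<sigma>\<^sub>k\<close>; the map \<open>X \<rightarrow> |K|\<close> comes from a partition of unity
  subordinate to small balls. The composition on \<open>X\<close> moves points by less than the convexity
  radius, so it is contracted to the identity along geodesics. On \<open>|K|\<close> the identity is first moved
  linearly to the simplicial map that sends the barycentre of \<open>\<sigma>\<close> to a vertex of \<open>\<sigma>\<close>, then along
  the prism to the map that sends it to a partner in \<open>S\<close> of \<open>c \<sigma>\<close> (a vertex of \<open>\<sigma>\<^sub>i\<close> and the
  partner of \<open>c \<sigma>\<^sub>j\<close> are close when \<open>i \<le> j\<close>, and the prism needs no other pairs), and finally
  linearly to the composition, because the centres of a chain are within \<open>r\<close> of each other.\<close>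

section \<open>Shortest paths and betweenness\<close>

text \<open>Convexity is available only for balls below the convexity radius. Closed convex hulls
  are therefore replaced by \<open>ball_hull\<close>, the intersection of the closed balls of radius
  below \<open>\<rho>\<close> that contain a set: a distance bound from a point to the set passes at
  once to the hull, and betweenness does not leave it. Estimates on centres and on combinations of
  centres are read off in this way; triangle comparison is confined to \<open>jung_step\<close>.

  The centre of a simplex is known to be within \<open>r\<close> only of the images of its own
  vertices. A vertex of a larger set of the chain may be too far from it, so a straight-line
  homotopy from vertices to centres would leave the complex; the prism weights never charge such a
  pair.

  The other obstacle is continuity, because the chain changes with the point. A chain has at most
  one set of each cardinality, so the combination runs over cardinalities, up to a bound fixed on
  each closed face and with weights continuous there. Geodesics depend continuously on their ends
  where they are unique, that is below \<open>\<rho>\<close>; the bound \<open>r\<close> between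
  centres of nested simplices ensures this.\<close>

lemma mdist_triangle:
  assumes "x \<in> mspace X" "y \<in> mspace X" "z \<in> mspace X"
  shows "mdist X x z \<le> mdist X x y + mdist X y z"
  using Metric_space.triangle[OF Metric_space_mspace_mdist] assms by metis

lemma mdist_eq_0_iff:
  assumes "x \<in> mspace X" "y \<in> mspace X"
  shows "mdist X x y = 0 \<longleftrightarrow> x = y"
  using Metric_space.zero[OF Metric_space_mspace_mdist] assms by metis

lemma mpath_in_mspace:
  assumes "mpath X a b \<gamma>" "u \<in> {a..b}"
  shows "\<gamma> u \<in> mspace X"
proof -
  have "continuous_map (top_of_set {a..b}) (mtopology_of X) \<gamma>"
    using assms by (simp add: mpath_def)
  from continuous_map_image_subset_topspace[OF this] show ?thesis using assms(2) by auto
qed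

text \<open>The partition \<open>a\<close>, \<open>s\<close>, \<open>t\<close>, \<open>b\<close>
  bounds the sum of the three distances by the length of the path, which is the distance of its
  ends; the triangle inequality gives the reverse.\<close>

lemma shortest_path_additive:
  assumes sp: "shortest_path X x y a b \<gamma>" and st: "a \<le> s" "s \<le> t" "t \<le> b"
  shows "mdist X x (\<gamma> s) + mdist X (\<gamma> s) (\<gamma> t) + mdist X (\<gamma> t) y = mdist X x y"
proof -
  have p: "mpath X a b \<gamma>" and xy: "\<gamma> a = x" "\<gamma> b = y"
    and len: "mlength X a b \<gamma> = ennreal (mdist X x y)"
    using sp by (auto simp: shortest_path_def)
  have in_X: "x \<in> mspace X" "y \<in> mspace X" "\<gamma> s \<in> mspace X" "\<gamma> t \<in> mspace X"
    using mpath_in_mspace[OF p] st xy by auto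
  define \<tau> where "\<tau> = (\<lambda>n::nat. if n = 0 then a else if n = 1 then s else if n = 2 then t else b)"
  have "interval_partition a b 3 \<tau>"
    using st by (auto simp: interval_partition_def \<tau>_def mono_on_def)
  then have "ennreal (\<Sum>i<3. mdist X (\<gamma> (\<tau> i)) (\<gamma> (\<tau> (Suc i)))) \<le> mlength X a b \<gamma>"
    unfolding mlength_def by (intro SUP_upper2[of "(3, \<tau>)"]) auto
  then have "mdist X x (\<gamma> s) + mdist X (\<gamma> s) (\<gamma> t) + mdist X (\<gamma> t) y \<le> mdist X x y"
    using len xy by (simp add: \<tau>_def eval_nat_numeral flip: ennreal_plus)
  moreover have "mdist X x y \<le> mdist X x (\<gamma> s) + mdist X (\<gamma> s) (\<gamma> t) + mdist X (\<gamma> t) y"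
    using mdist_triangle[of x X "\<gamma> s" y] mdist_triangle[of "\<gamma> s" X "\<gamma> t" y] in_X by simp
  ultimately show ?thesis by simp
qed

lemma shortest_path_dist:
  assumes sp: "shortest_path X x y a b \<gamma>" and st: "a \<le> s" "s \<le> t" "t \<le> b"
  shows "mdist X (\<gamma> s) (\<gamma> t) = mdist X x (\<gamma> t) - mdist X x (\<gamma> s)"
    and "mdist X x (\<gamma> t) + mdist X (\<gamma> t) y = mdist X x y"
proof -
  have p: "mpath X a b \<gamma>" and xy: "\<gamma> a = x" "\<gamma> b = y"
    using sp by (auto simp: shortest_path_def)
  have "mdist X x x = 0"
    using mpath_in_mspace[OF p, of a] st xy by (simp add: mdist_eq_0_iff)
  then have e: "mdist X x (\<gamma> t) + mdist X (\<gamma> t) y = mdist X x y"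
    using shortest_path_additive[OF sp, of a t] st xy by simp
  then show "mdist X x (\<gamma> t) + mdist X (\<gamma> t) y = mdist X x y" .
  show "mdist X (\<gamma> s) (\<gamma> t) = mdist X x (\<gamma> t) - mdist X x (\<gamma> s)"
    using e shortest_path_additive[OF sp st] by simp
qed

lemma isometric_path_imp_shortest_path:
  assumes l: "0 \<le> l" and g: "\<And>s. s \<in> {0..l} \<Longrightarrow> g s \<in> mspace X"
    and d: "\<And>s t. \<lbrakk>0 \<le> s; s \<le> t; t \<le> l\<rbrakk> \<Longrightarrow> mdist X (g s) (g t) = t - s"
  shows "shortest_path X (g 0) (g l) 0 l g"
proof -
  have d': "mdist X (g s) (g t) = \<bar>s - t\<bar>" if "s \<in> {0..l}" "t \<in> {0..l}" for s t
    using d[of s t] d[of t s] that mdist_commute[of X "g s" "g t"] by (cases "s \<le> t") auto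
  have "Lipschitz_continuous_map (submetric euclidean_metric {0..l}) X g"
    unfolding Lipschitz_continuous_map_def
    by (intro conjI exI[of _ 1]) (auto simp: g d' dist_real_def)
  then have "continuous_map (mtopology_of (submetric euclidean_metric {0..l})) (mtopology_of X) g"
    by (rule Lipschitz_continuous_imp_continuous_map)
  then have "mpath X 0 l g"
    using l by (simp add: mpath_def mtopology_of_submetric)
  moreover have "mlength X 0 l g = ennreal l"
  proof -
    have "(\<Sum>i<n. mdist X (g (t i)) (g (t (Suc i)))) = l" if "interval_partition 0 l n t" for n t
    proof -
      have t: "t 0 = 0" "t n = l" "mono_on {..n} t" using that by (auto simp: interval_partition_def)
      have "mdist X (g (t i)) (g (t (Suc i))) = t (Suc i) - t i" if "i < n" for i
        using t that monotone_onD[OF t(3)] by (intro d) (auto simp flip: t(1,2))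
      then have "(\<Sum>i<n. mdist X (g (t i)) (g (t (Suc i)))) = (\<Sum>i<n. t (Suc i) - t i)"
        by simp
      also have "\<dots> = l" using t sum_lessThan_telescope[of t n] by simp
      finally show ?thesis .
    qed
    moreover have "interval_partition 0 l 1 (\<lambda>i. if i = 0 then 0 else l)"
      using l by (auto simp: interval_partition_def mono_on_def)
    ultimately have "(\<lambda>(n, t). ennreal (\<Sum>i<n. mdist X (g (t i)) (g (t (Suc i))))) `
        {(n, t). interval_partition 0 l n t} = {ennreal l}"
      by (auto simp: image_iff split: prod.splits) metis
    then show ?thesis by (simp only: mlength_def Sup_insert Sup_empty) simp
  qed
  moreover have "mdist X (g 0) (g l) = l" using d[of 0 l] l by simp
  ultimately show ?thesis by (simp add: shortest_path_def)
qed

lemma shortest_path_point_at_distance: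
  assumes sp: "shortest_path X x y a b \<gamma>" and s: "0 \<le> s" "s \<le> mdist X x y"
  obtains u where "u \<in> {a..b}" "mdist X x (\<gamma> u) = s"
proof -
  have p: "mpath X a b \<gamma>" and xy: "\<gamma> a = x" "\<gamma> b = y"
    using sp by (auto simp: shortest_path_def)
  then have ab: "a \<le> b" and c: "continuous_map (top_of_set {a..b}) (mtopology_of X) \<gamma>"
    by (auto simp: mpath_def)
  have "x \<in> mspace X" using mpath_in_mspace[OF p, of a] ab xy by simp
  then have "continuous_map (top_of_set {a..b}) euclidean (\<lambda>u. mdist X x (\<gamma> u))"
    using c by (intro continuous_map_mdist) (auto simp: continuous_map_const)
  then have "continuous_on {a..b} (\<lambda>u. mdist X x (\<gamma> u))" by simp
  moreover have "mdist X x (\<gamma> a) \<le> s"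
    using s(1) xy(1) mdist_eq_0_iff[OF \<open>x \<in> mspace X\<close> \<open>x \<in> mspace X\<close>] by metis
  ultimately obtain u where "a \<le> u" "u \<le> b" "mdist X x (\<gamma> u) = s"
    using IVT'[of "\<lambda>u. mdist X x (\<gamma> u)" a s b] ab s xy by auto
  then show ?thesis using that by auto
qed

text \<open>The unit-speed normal form. Shortest paths may pause or have any speed, so points on
  them are addressed by their distance from the start.\<close>

definition isometric_path :: "'a metric \<Rightarrow> real \<Rightarrow> (real \<Rightarrow> 'a) \<Rightarrow> bool" where
  "isometric_path X l g \<longleftrightarrow> g \<in> {0..l} \<rightarrow> mspace X \<and>
     (\<forall>s t. 0 \<le> s \<and> s \<le> t \<and> t \<le> l \<longrightarrow> mdist X (g s) (g t) = t - s)"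

text \<open>Parametrise by the distance from \<open>x\<close>: the intermediate value theorem
  supplies a parameter \<open>\<phi> s\<close> for each \<open>s\<close>, but this choice need not
  be monotone in \<open>s\<close>.\<close>

lemma geodesic_space_isometric_path:
  assumes "geodesic_space X" and xy: "x \<in> mspace X" "y \<in> mspace X"
  obtains g where "isometric_path X (mdist X x y) g" "g 0 = x" "g (mdist X x y) = y"
proof -
  obtain a b \<gamma> where sp: "shortest_path X x y a b \<gamma>"
    using assms unfolding geodesic_space_def by meson
  then have p: "mpath X a b \<gamma>" "\<gamma> a = x" "\<gamma> b = y" by (auto simp: shortest_path_def)
  have "\<exists>u. u \<in> {a..b} \<and> mdist X x (\<gamma> u) = s" if "0 \<le> s \<and> s \<le> mdist X x y" for s
    using shortest_path_point_at_distance[OF sp, of s] that by metis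
  then obtain \<phi> where \<phi>: "\<And>s. 0 \<le> s \<and> s \<le> mdist X x y \<Longrightarrow> \<phi> s \<in> {a..b} \<and> mdist X x (\<gamma> (\<phi> s)) = s"
    by metis
  define g where "g = \<gamma> \<circ> \<phi>"
  have g: "g s \<in> mspace X" "mdist X x (g s) = s" if "0 \<le> s" "s \<le> mdist X x y" for s
    using \<phi>[of s] that mpath_in_mspace[OF p(1)] by (auto simp: g_def)
  have gst: "mdist X (g s) (g t) = t - s" if st: "0 \<le> s" "s \<le> t" "t \<le> mdist X x y" for s t
  proof (cases "\<phi> s \<le> \<phi> t")
    case True
    then show ?thesis
      using shortest_path_dist(1)[OF sp, of "\<phi> s" "\<phi> t"] \<phi>[of s] \<phi>[of t] st by (auto simp: g_def)
  next
    \<comment> \<open>Reversed parameters give the distance \<open>s - t\<close>, which is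
      nonpositive, so the two points coincide.\<close>
    case False
    then have "mdist X (g t) (g s) = s - t"
      using shortest_path_dist(1)[OF sp, of "\<phi> t" "\<phi> s"] \<phi>[of s] \<phi>[of t] st by (auto simp: g_def)
    moreover have "0 \<le> mdist X (g t) (g s)" by simp
    ultimately show ?thesis using st mdist_commute[of X "g s" "g t"] by simp
  qed
  have "isometric_path X (mdist X x y) g"
    using g gst by (auto simp: isometric_path_def)
  moreover have "g 0 = x"
    using g[of 0] xy mdist_eq_0_iff[of x X "g 0"] by simp
  moreover have "g (mdist X x y) = y"
  proof -
    let ?u = "\<phi> (mdist X x y)"
    have "?u \<in> {a..b}" "mdist X x (\<gamma> ?u) = mdist X x y" using \<phi>[of "mdist X x y"] by auto
    then have "mdist X (\<gamma> ?u) y = 0"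
      using shortest_path_dist(2)[OF sp, of ?u ?u] by simp
    then show ?thesis
      using g(1)[of "mdist X x y"] xy mdist_eq_0_iff[of "\<gamma> ?u" X y] by (simp add: g_def)
  qed
  ultimately show ?thesis using that by blast
qed

lemma isometric_path_shortest:
  assumes "isometric_path X (mdist X x y) g" "g 0 = x" "g (mdist X x y) = y"
  shows "shortest_path X x y 0 (mdist X x y) g"
proof -
  have "shortest_path X (g 0) (g (mdist X x y)) 0 (mdist X x y) g"
    using assms(1) by (intro isometric_path_imp_shortest_path) (auto simp: isometric_path_def)
  then show ?thesis using assms by simp
qed

text \<open>Geodesics from \<open>x\<close> to \<open>p\<close> and from \<open>p\<close> to
  \<open>y\<close> concatenate to a geodesic because no length is lost at \<open>p\<close>. This
  turns convexity, which is defined by paths, into statements about points given by their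
  distances.\<close>

lemma isometric_path_through:
  assumes geo: "geodesic_space X" and in_X: "x \<in> mspace X" "y \<in> mspace X" "p \<in> mspace X"
    and between: "mdist X x p + mdist X p y = mdist X x y"
  obtains g where "isometric_path X (mdist X x y) g" "g 0 = x" "g (mdist X x y) = y"
    "g (mdist X x p) = p"
proof -
  define l m where "l = mdist X x y" and "m = mdist X x p"
  have m: "0 \<le> m" "m \<le> l" "mdist X p y = l - m"
    using between by (auto simp: l_def m_def, smt (verit) mdist_nonneg)
  obtain g1 where g1: "isometric_path X m g1" "g1 0 = x" "g1 m = p"
    using geodesic_space_isometric_path[OF geo in_X(1,3)] m_def by metis
  obtain g2 where g2: "isometric_path X (l - m) g2" "g2 0 = p" "g2 (l - m) = y"
    using geodesic_space_isometric_path[OF geo in_X(3,2)] m by metis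
  define g where "g = (\<lambda>s. if s \<le> m then g1 s else g2 (s - m))"
  have gX: "g s \<in> mspace X" if "0 \<le> s" "s \<le> l" for s
    using that g1(1) g2(1) by (auto simp: g_def isometric_path_def Pi_iff)
  have ends: "g 0 = x" "g l = y" "g m = p"
    using m g1 g2 by (auto simp: g_def)
  have p: "mdist X (g s) (g t) = t - s" if "0 \<le> s" "s \<le> t" "t \<le> l" "t \<le> m \<or> m \<le> s" for s t
  proof (cases "t \<le> m")
    case True
    then show ?thesis using g1(1) that by (auto simp: isometric_path_def g_def)
  next
    case False
    then have "g s = g2 (s - m)" "g t = g2 (t - m)"
      using that g1 g2 by (auto simp: g_def)
    moreover have "mdist X (g2 (s - m)) (g2 (t - m)) = (t - m) - (s - m)"
      using g2(1) that False unfolding isometric_path_def by auto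
    ultimately show ?thesis by simp
  qed
  have "mdist X (g s) (g t) = t - s" if st: "0 \<le> s" "s \<le> t" "t \<le> l" for s t
  proof (cases "t \<le> m \<or> m \<le> s")
    \<comment> \<open>For \<open>s < m < t\<close> the way through \<open>p\<close> gives the upper
      bound; a smaller distance would shorten the whole way from \<open>x\<close> to
      \<open>y\<close>.\<close>
    case False
    have "mdist X (g s) (g t) \<le> mdist X (g s) (g m) + mdist X (g m) (g t)"
      using gX st False m by (intro mdist_triangle) auto
    then have 1: "mdist X (g s) (g t) \<le> t - s" using p[of s m] p[of m t] st False m by auto
    have "l \<le> mdist X (g 0) (g s) + mdist X (g s) (g l)"
      using mdist_triangle[of "g 0" X "g s" "g l"] gX st m ends by (auto simp: l_def)
    moreover have "mdist X (g s) (g l) \<le> mdist X (g s) (g t) + mdist X (g t) (g l)"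
      using mdist_triangle[of "g s" X "g t" "g l"] gX st m by auto
    ultimately show ?thesis using 1 p[of 0 s] p[of t l] st False m by auto
  qed (use p st in auto)
  then have "isometric_path X l g" using gX by (auto simp: isometric_path_def)
  then show ?thesis using that[of g] ends by (simp add: l_def m_def)
qed

lemma geodesically_convex_shortest_path_subset:
  assumes "geodesically_convex X A" "x \<in> A" "y \<in> A" "shortest_path X x y a b \<gamma>" "u \<in> {a..b}"
  shows "\<gamma> u \<in> A"
proof -
  have "\<gamma> ` {a..b} \<subseteq> A"
    using assms(1-4) unfolding geodesically_convex_def by simp
  then show ?thesis using assms(5) by blast
qed

lemma geodesically_convex_same_curve:
  assumes "geodesically_convex X A" "x \<in> A" "y \<in> A"
    "shortest_path X x y a b \<gamma>" "shortest_path X x y a' b' \<gamma>'"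
  shows "same_curve a b \<gamma> a' b' \<gamma>'"
  using assms unfolding geodesically_convex_def by simp

lemma geodesically_convex_between:
  assumes geo: "geodesic_space X" and A: "geodesically_convex X A" and xy: "x \<in> A" "y \<in> A"
    and p: "p \<in> mspace X" "mdist X x p + mdist X p y = mdist X x y"
  shows "p \<in> A"
proof -
  have X: "x \<in> mspace X" "y \<in> mspace X" using A xy by (auto simp: geodesically_convex_def)
  obtain g where g: "isometric_path X (mdist X x y) g" "g 0 = x" "g (mdist X x y) = y"
    "g (mdist X x p) = p"
    using isometric_path_through[OF geo X p] .
  have "mdist X x p \<in> {0..mdist X x y}"
    using p mdist_nonneg[of X x p] mdist_nonneg[of X p y] unfolding atLeastAtMost_iff by linarith
  then show ?thesis
    using geodesically_convex_shortest_path_subset[OF A xy isometric_path_shortest[OF g(1-3)]] g(4)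
    by metis
qed

text \<open>\<open>same_curve\<close> permits arbitrary changes of parameter. The parameter of an
  isometric path is the distance from \<open>x\<close>, so only points at equal distance from
  \<open>x\<close> can be matched.\<close>

lemma geodesically_convex_unique_between:
  assumes geo: "geodesic_space X" and A: "geodesically_convex X A" and xy: "x \<in> A" "y \<in> A"
    and p: "p \<in> mspace X" "mdist X x p + mdist X p y = mdist X x y"
    and q: "q \<in> mspace X" "mdist X x q + mdist X q y = mdist X x y"
    and pq: "mdist X x p = mdist X x q"
  shows "p = q"
proof -
  have X: "x \<in> mspace X" "y \<in> mspace X" using A xy by (auto simp: geodesically_convex_def)
  let ?l = "mdist X x y" and ?m = "mdist X x p"
  have m: "?m \<in> {0..?l}"
    using p mdist_nonneg[of X x p] mdist_nonneg[of X p y] unfolding atLeastAtMost_iff by linarith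
  obtain g where g: "isometric_path X ?l g" "g 0 = x" "g ?l = y" "g ?m = p"
    using isometric_path_through[OF geo X p] .
  obtain h where h: "isometric_path X ?l h" "h 0 = x" "h ?l = y" "h ?m = q"
    using isometric_path_through[OF geo X q] pq by metis
  have "same_curve 0 ?l g 0 ?l h"
    by (rule geodesically_convex_same_curve[OF A xy isometric_path_shortest[OF g(1-3)]
          isometric_path_shortest[OF h(1-3)]])
  then obtain \<phi> \<phi>' where im: "\<phi> ` {0..1} = {0..?l}" "\<phi>' ` {0..1} = {0..?l}"
    and eq: "\<And>t. t \<in> {0..1::real} \<Longrightarrow> g (\<phi> t) = h (\<phi>' t)"
    unfolding same_curve_def by metis
  obtain t where t: "t \<in> {0..1}" "\<phi> t = ?m" using im m by (metis (no_types, lifting) imageE)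
  have u: "\<phi>' t \<in> {0..?l}" using im t by blast
  have hd: "mdist X x (h u) = u" if "u \<in> {0..?l}" for u
    using h(1,2) that unfolding isometric_path_def by (metis atLeastAtMost_iff diff_zero order_refl)
  have "p = h (\<phi>' t)" using eq[OF t(1)] t(2) g(4) by simp
  then have "?m = \<phi>' t" using hd[OF u] by simp
  then show ?thesis using \<open>p = h (\<phi>' t)\<close> h(4) by simp
qed

lemma geodesic_space_point:
  assumes geo: "geodesic_space X" and X: "x \<in> mspace X" "y \<in> mspace X" and t: "0 \<le> t" "t \<le> 1"
  shows "\<exists>p \<in> mspace X. mdist X x p = t * mdist X x y \<and> mdist X p y = (1 - t) * mdist X x y"
proof -
  let ?l = "mdist X x y"
  obtain g where g: "isometric_path X ?l g" "g 0 = x" "g ?l = y"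
    using geodesic_space_isometric_path[OF geo X] .
  have tl: "0 \<le> t * ?l" "t * ?l \<le> ?l" using t by (auto simp: mult_left_le_one_le)
  have "mdist X x (g (t * ?l)) = t * ?l - 0" "mdist X (g (t * ?l)) y = ?l - t * ?l"
    using g tl unfolding isometric_path_def by (metis order_refl mdist_nonneg)+
  moreover have "g (t * ?l) \<in> mspace X" using g(1) tl unfolding isometric_path_def by auto
  ultimately show ?thesis by (intro bexI[of _ "g (t * ?l)"]) (auto simp: algebra_simps)
qed

text \<open>At every centre some admissible radius exceeds \<open>\<rho>\<close>; the strict
  inequality is what lets \<open>s = \<rho>\<close> in.\<close>

lemma convexity_radius_gt:
  assumes "ennreal \<rho> < convexity_radius X" "0 \<le> \<rho>" "c \<in> mspace X" "0 < s" "s \<le> \<rho>"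
  shows "geodesically_convex X (mball_of X c s)"
proof -
  let ?R = "{ennreal r | r. 0 \<le> r \<and> (\<forall>s. 0 < s \<and> s < r \<longrightarrow> geodesically_convex X (mball_of X c s))}"
  have "convexity_radius X \<le> Sup ?R"
    unfolding convexity_radius_def using assms(3) by (rule INF_lower)
  then have "ennreal \<rho> < Sup ?R" using assms(1) by order
  then obtain r where r: "ennreal \<rho> < ennreal r"
    "\<forall>s. 0 < s \<and> s < r \<longrightarrow> geodesically_convex X (mball_of X c s)"
    unfolding less_Sup_iff by blast
  then have "\<rho> < r" using assms(2) by (simp add: ennreal_less_iff)
  then show ?thesis using r assms by simp
qed

section \<open>Comparison triangles and the Jung constant\<close>

text \<open>The apex \<open>c\<close> of the triangle is also the centre of the convex ball, so
  membership in the ball is a bound on the two sides at \<open>c\<close>. The comparison triangle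
  consists of an isometric path \<open>g\<close> for the side from \<open>c\<close> to
  \<open>z\<close> and a point \<open>w'\<close> for the third vertex.\<close>

lemma curvature_le_isometric_path:
  assumes geo: "geodesic_space X" and curv: "curvature_le \<kappa> X"
    and conv: "geodesically_convex X (mball_of X c \<rho>)" and "0 < \<rho>"
    and in_X: "c \<in> mspace X" "z \<in> mspace X" "w \<in> mspace X" "y \<in> mspace X"
    and near: "mdist X c z < \<rho>" "mdist X c w < \<rho>"
    and small: "\<kappa> > 0 \<Longrightarrow> mdist X c w + mdist X w z + mdist X z c < 2 * pi / sqrt \<kappa>"
    and between: "mdist X c y + mdist X y z = mdist X c z"
    and g: "isometric_path (model_surface \<kappa>) (mdist X c z) g" and w': "w' \<in> model_carrier \<kappa>"
    and "model_dist \<kappa> (g 0) w' = mdist X c w" "model_dist \<kappa> w' (g (mdist X c z)) = mdist X w z"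
  shows "mdist X y w \<le> model_dist \<kappa> (g (mdist X c y)) w'"
proof -
  let ?l = "mdist X c z" and ?s = "mdist X c y"
  obtain h where h: "isometric_path X ?l h" "h 0 = c" "h ?l = z" "h ?s = y"
    using isometric_path_through[OF geo in_X(1,2,4) between] .
  have s: "?s \<in> {0..?l}"
    using between mdist_nonneg[of X c y] mdist_nonneg[of X y z] unfolding atLeastAtMost_iff by linarith
  have carrier: "g u \<in> model_carrier \<kappa>" if "u \<in> {0..?l}" for u
    using g that unfolding isometric_path_def mspace_model_surface by blast
  have gd: "model_dist \<kappa> (g u) (g v) = v - u" if "0 \<le> u" "u \<le> v" "v \<le> ?l" for u v
    using g that unfolding isometric_path_def mdist_model_surface by blast
  have path': "shortest_path (model_surface \<kappa>) (g 0) (g ?l) 0 ?l g"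
    using isometric_path_imp_shortest_path[of ?l g "model_surface \<kappa>"] carrier gd by auto
  have cc: "mdist X c c = 0" using in_X by (simp add: mdist_eq_0_iff)
  have c: "c \<in> mball_of X c \<rho>" "w \<in> mball_of X c \<rho>" "z \<in> mball_of X c \<rho>"
    using in_X near \<open>0 < \<rho>\<close> cc unfolding in_mball_of by metis+
  have y: "y \<in> h ` {0..?l}" using s h(4) by (metis imageI)
  have y': "g ?s \<in> g ` {0..?l}" using s by blast
  have "mdist (model_surface \<kappa>) (g 0) (g ?s) = mdist X c y"
       "mdist (model_surface \<kappa>) (g 0) (g ?l) = mdist X c z"
    using gd[of 0 ?s] gd[of 0 ?l] s by auto
  then have "mdist X y w \<le> mdist (model_surface \<kappa>) (g ?s) w'"
    using curv[unfolded curvature_le_def, rule_format, of c \<rho> c w z 0 ?l h y "g 0" w' "g ?l" 0 ?l g "g ?s"]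
      in_X \<open>0 < \<rho>\<close> conv c small isometric_path_shortest[OF h(1-3)] y carrier[of 0] carrier[of ?l] w'
      assms(15,16) path' y' by (simp only: mspace_model_surface mdist_model_surface) auto
  then show ?thesis by simp
qed

text \<open>For \<open>q = 0\<close> the hypothesis forces \<open>p = 0\<close>, so degenerate
  comparison triangles are covered too.\<close>

lemma abs_divide_le_1:
  fixes p q :: real assumes "\<bar>p\<bar> \<le> q" shows "\<bar>p / q\<bar> \<le> 1" "p / q * q = p"
  using assms by (auto simp: divide_le_eq)

text \<open>The apex sits at the pole, the side on a great circle. The last claim is Stewart's
  theorem: \<open>g s \<bullet> w'\<close> is a combination of \<open>sin (k * s)\<close> and
  \<open>cos (k * s)\<close>, and such a function is expressed by its values at \<open>0\<close> and
  \<open>l\<close>.\<close>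

lemma spherical_comparison:
  fixes a b l :: real
  assumes k: "0 < k" and l: "0 < l" and a: "0 \<le> a" and b: "0 \<le> b"
    and tri: "\<bar>a - l\<bar> \<le> b" "b \<le> a + l" "k * (a + l) \<le> pi"
  obtains g w' where "isometric_path (model_surface (k\<^sup>2)) l g" "w' \<in> model_carrier (k\<^sup>2)"
    "model_dist (k\<^sup>2) (g 0) w' = a" "model_dist (k\<^sup>2) w' (g l) = b"
    "\<And>s. s \<in> {0..l} \<Longrightarrow> sin (k * l) * cos (k * model_dist (k\<^sup>2) (g s) w')
        = sin (k * (l - s)) * cos (k * a) + sin (k * s) * cos (k * b)"
proof -
  have kn: "0 \<le> k * a" "0 \<le> k * b" "0 < k * l" "k * a + k * l \<le> pi" "k * b \<le> k * a + k * l"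
    using k l a b tri mult_left_mono[OF tri(2), of k] by (auto simp: algebra_simps)
  have "\<bar>k * a - k * l\<bar> = k * \<bar>a - l\<bar>"
    using k by (simp add: abs_mult flip: right_diff_distrib)
  then have kd: "\<bar>k * a - k * l\<bar> \<le> k * b"
    using k tri by simp
  \<comment> \<open>The cosine of the angle at the apex, from the spherical law of cosines;
    \<open>S\<close> is the sine.\<close>
  define C where "C = (cos (k * b) - cos (k * l) * cos (k * a)) / (sin (k * l) * sin (k * a))"
  define S where "S = sqrt (1 - C\<^sup>2)"
  have "\<bar>cos (k * b) - cos (k * l) * cos (k * a)\<bar> \<le> sin (k * l) * sin (k * a)"
  proof -
    have "cos (k * b) \<le> cos \<bar>k * a - k * l\<bar>" using kn kd by (intro cos_monotone_0_pi_le) auto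
    moreover have "cos (k * a + k * l) \<le> cos (k * b)" using kn by (intro cos_monotone_0_pi_le) auto
    ultimately show ?thesis by (simp add: cos_add cos_diff abs_le_iff algebra_simps)
  qed
  note CC = abs_divide_le_1[OF this, folded C_def]
  have CS: "C\<^sup>2 + S\<^sup>2 = 1"
    using CC(1) by (simp add: S_def abs_square_le_1)
  define g :: "real \<Rightarrow> real^3" where "g = (\<lambda>s. vector [sin (k * s), 0, cos (k * s)])"
  define w' :: "real^3" where "w' = vector [sin (k * a) * C, sin (k * a) * S, cos (k * a)]"
  have ip: "x \<bullet> y = x$1 * y$1 + x$2 * y$2 + x$3 * y$3" for x y :: "real^3"
    by (simp add: inner_vec_def sum_3)
  have gc: "g s \<in> model_carrier (k\<^sup>2)" for s
    using k by (simp add: model_carrier_def norm_eq_1 ip g_def flip: power2_eq_square)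
  have "w' \<bullet> w' = (sin (k * a))\<^sup>2 * (C\<^sup>2 + S\<^sup>2) + (cos (k * a))\<^sup>2"
    by (simp add: ip w'_def power2_eq_square algebra_simps)
  then have wc: "w' \<in> model_carrier (k\<^sup>2)"
    using k by (simp add: model_carrier_def norm_eq_1 CS)
  have md: "model_dist (k\<^sup>2) x y = arccos (x \<bullet> y) / k"
    if "x \<in> model_carrier (k\<^sup>2)" "y \<in> model_carrier (k\<^sup>2)" for x y
    using k that by (simp add: model_dist_def)
  have gg: "g s \<bullet> g t = cos (k * t - k * s)" for s t
    by (simp add: ip g_def cos_diff)
  have gw: "g s \<bullet> w' = sin (k * s) * sin (k * a) * C + cos (k * s) * cos (k * a)" for s
    by (simp add: ip g_def w'_def)
  have "model_dist (k\<^sup>2) (g s) (g t) = t - s" if "0 \<le> s" "s \<le> t" "t \<le> l" for s t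
  proof -
    have "0 \<le> k * t - k * s" using that k by (simp add: mult_left_mono)
    moreover have "k * t \<le> k * l" "0 \<le> k * s" using that k by simp_all
    ultimately have "arccos (cos (k * t - k * s)) = k * t - k * s" using kn by (intro arccos_cos) auto
    then show ?thesis using k by (simp add: md gc gg field_simps)
  qed
  then have 1: "isometric_path (model_surface (k\<^sup>2)) l g"
    by (auto simp: isometric_path_def gc)
  have 2: "model_dist (k\<^sup>2) (g 0) w' = a"
    using k kn by (simp add: md gc wc gw arccos_cos)
  have "w' \<bullet> g l = cos (k * b)"
    using CC(2) by (simp add: inner_commute[of w'] gw algebra_simps)
  then have 3: "model_dist (k\<^sup>2) w' (g l) = b"
    using k kn by (simp add: md gc wc arccos_cos)
  have 4: "sin (k * l) * cos (k * model_dist (k\<^sup>2) (g s) w')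
        = sin (k * (l - s)) * cos (k * a) + sin (k * s) * cos (k * b)" for s
  proof -
    have "\<bar>g s \<bullet> w'\<bar> \<le> 1"
      using Cauchy_Schwarz_ineq2[of "g s" w'] gc[of s] wc k by (simp add: model_carrier_def)
    then have "cos (k * model_dist (k\<^sup>2) (g s) w') = g s \<bullet> w'"
      using k by (simp add: md gc wc cos_arccos_abs)
    also have "sin (k * l) * (g s \<bullet> w') = sin (k * s) * (C * (sin (k * l) * sin (k * a)))
        + sin (k * l) * cos (k * s) * cos (k * a)"
      by (simp add: gw algebra_simps)
    also have "\<dots> = sin (k * (l - s)) * cos (k * a) + sin (k * s) * cos (k * b)"
      unfolding CC(2) by (simp add: sin_diff right_diff_distrib algebra_simps)
    finally show ?thesis .
  qed
  show ?thesis using that[OF 1 wc 2 3 4] .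
qed

text \<open>As on the sphere, with \<open>lorentz\<close> in place of the inner product and the apex
  at the lowest point of the hyperboloid. The numerator of \<open>C\<close> changes its
  sign.\<close>

lemma hyperbolic_comparison:
  fixes a b l :: real
  assumes k: "0 < k" and l: "0 < l" and a: "0 \<le> a" and b: "0 \<le> b"
    and tri: "\<bar>a - l\<bar> \<le> b" "b \<le> a + l"
  obtains g w' where "isometric_path (model_surface (-k\<^sup>2)) l g" "w' \<in> model_carrier (-k\<^sup>2)"
    "model_dist (-k\<^sup>2) (g 0) w' = a" "model_dist (-k\<^sup>2) w' (g l) = b"
    "\<And>s. s \<in> {0..l} \<Longrightarrow> sinh (k * l) * cosh (k * model_dist (-k\<^sup>2) (g s) w')
        = sinh (k * (l - s)) * cosh (k * a) + sinh (k * s) * cosh (k * b)"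
proof -
  have kn: "0 \<le> k * a" "0 \<le> k * b" "0 < k * l" "k * b \<le> k * a + k * l"
    using k l a b tri mult_left_mono[OF tri(2), of k] by (auto simp: algebra_simps)
  have "\<bar>k * a - k * l\<bar> = k * \<bar>a - l\<bar>"
    using k by (simp add: abs_mult flip: right_diff_distrib)
  then have kd: "\<bar>k * a - k * l\<bar> \<le> k * b"
    using k tri by simp
  define C where "C = (cosh (k * l) * cosh (k * a) - cosh (k * b)) / (sinh (k * l) * sinh (k * a))"
  define S where "S = sqrt (1 - C\<^sup>2)"
  have "\<bar>cosh (k * l) * cosh (k * a) - cosh (k * b)\<bar> \<le> sinh (k * l) * sinh (k * a)"
  proof -
    have "cosh \<bar>k * a - k * l\<bar> \<le> cosh (k * b)" using kn kd by (subst cosh_real_nonneg_le_iff) auto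
    moreover have "cosh (k * b) \<le> cosh (k * a + k * l)" using kn by (subst cosh_real_nonneg_le_iff) auto
    ultimately show ?thesis by (simp add: cosh_add cosh_diff abs_le_iff algebra_simps)
  qed
  note CC = abs_divide_le_1[OF this, folded C_def]
  have CS: "C\<^sup>2 + S\<^sup>2 = 1"
    using CC(1) by (simp add: S_def abs_square_le_1)
  define g :: "real \<Rightarrow> real^3" where "g = (\<lambda>s. vector [sinh (k * s), 0, cosh (k * s)])"
  define w' :: "real^3" where "w' = vector [sinh (k * a) * C, sinh (k * a) * S, cosh (k * a)]"
  have gc: "g s \<in> model_carrier (-k\<^sup>2)" for s
    using k cosh_square_eq[of "k * s"]
    by (simp add: model_carrier_def lorentz_def g_def power2_eq_square)
  have "lorentz w' w' = (cosh (k * a))\<^sup>2 - (sinh (k * a))\<^sup>2 * (C\<^sup>2 + S\<^sup>2)"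
    by (simp add: lorentz_def w'_def power2_eq_square algebra_simps)
  then have wc: "w' \<in> model_carrier (-k\<^sup>2)"
    using k by (simp add: model_carrier_def CS cosh_square_eq) (simp add: w'_def)
  have md: "model_dist (-k\<^sup>2) x y = arcosh (lorentz x y) / k"
    if "x \<in> model_carrier (-k\<^sup>2)" "y \<in> model_carrier (-k\<^sup>2)" for x y
    using k that by (simp add: model_dist_def)
  have gg: "lorentz (g s) (g t) = cosh (k * t - k * s)" for s t
    by (simp add: lorentz_def g_def cosh_diff)
  have gw: "lorentz (g s) w' = cosh (k * s) * cosh (k * a) - sinh (k * s) * sinh (k * a) * C" for s
    by (simp add: lorentz_def g_def w'_def)
  have "model_dist (-k\<^sup>2) (g s) (g t) = t - s" if "0 \<le> s" "s \<le> t" "t \<le> l" for s t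
  proof -
    have "0 \<le> k * t - k * s" using that k by (simp add: mult_left_mono)
    then have "arcosh (cosh (k * t - k * s)) = k * t - k * s" by (rule arcosh_cosh_real)
    then show ?thesis using k by (simp add: md gc gg field_simps)
  qed
  then have 1: "isometric_path (model_surface (-k\<^sup>2)) l g"
    by (auto simp: isometric_path_def gc)
  have 2: "model_dist (-k\<^sup>2) (g 0) w' = a"
    using k kn by (simp add: md gc wc gw arcosh_cosh_real)
  have "lorentz w' (g l) = cosh (k * b)"
    using CC(2) gw[of l] by (simp add: lorentz_def algebra_simps)
  then have 3: "model_dist (-k\<^sup>2) w' (g l) = b"
    using k kn by (simp add: md gc wc arcosh_cosh_real)
  have 4: "sinh (k * l) * cosh (k * model_dist (-k\<^sup>2) (g s) w')
        = sinh (k * (l - s)) * cosh (k * a) + sinh (k * s) * cosh (k * b)" for s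
  proof -
    have "1 \<le> lorentz (g s) w'"
      using lorentz_ge_1(1)[of "g s" w'] gc[of s] wc k by (simp add: model_carrier_def)
    then have "cosh (k * model_dist (-k\<^sup>2) (g s) w') = lorentz (g s) w'"
      using k by (simp add: md gc wc cosh_arcosh_real)
    also have "sinh (k * l) * lorentz (g s) w' = sinh (k * l) * cosh (k * s) * cosh (k * a)
        - sinh (k * s) * (C * (sinh (k * l) * sinh (k * a)))"
      by (simp add: gw algebra_simps)
    also have "\<dots> = sinh (k * (l - s)) * cosh (k * a) + sinh (k * s) * cosh (k * b)"
      unfolding CC(2) by (simp add: sinh_diff right_diff_distrib algebra_simps)
    finally show ?thesis .
  qed
  show ?thesis using that[OF 1 wc 2 3 4] .
qed

text \<open>Stewart's theorem in the plane, with the apex at the origin and the angle there from the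
  law of cosines.\<close>

lemma euclidean_comparison:
  fixes a b l :: real
  assumes l: "0 < l" and a: "0 \<le> a" and b: "0 \<le> b"
    and tri: "\<bar>a - l\<bar> \<le> b" "b \<le> a + l"
  obtains g w' where "isometric_path (model_surface 0) l g" "w' \<in> model_carrier 0"
    "model_dist 0 (g 0) w' = a" "model_dist 0 w' (g l) = b"
    "\<And>s. s \<in> {0..l} \<Longrightarrow> l * (model_dist 0 (g s) w')\<^sup>2
        = (l - s) * a\<^sup>2 + s * b\<^sup>2 - l * s * (l - s)"
proof -
  define C where "C = (l\<^sup>2 + a\<^sup>2 - b\<^sup>2) / (2 * l * a)"
  define S where "S = sqrt (1 - C\<^sup>2)"
  have "\<bar>l\<^sup>2 + a\<^sup>2 - b\<^sup>2\<bar> \<le> 2 * l * a"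
  proof -
    have "\<bar>a - l\<bar>\<^sup>2 \<le> b\<^sup>2" "b\<^sup>2 \<le> (a + l)\<^sup>2" using tri b by (intro power_mono; simp)+
    then show ?thesis by (simp add: power2_eq_square algebra_simps abs_le_iff)
  qed
  note CC = abs_divide_le_1[OF this, folded C_def]
  have CS: "C\<^sup>2 + S\<^sup>2 = 1"
    using CC(1) by (simp add: S_def abs_square_le_1)
  define g :: "real \<Rightarrow> real^3" where "g = (\<lambda>s. vector [s, 0, 0])"
  define w' :: "real^3" where "w' = vector [a * C, a * S, 0]"
  have gc: "g s \<in> model_carrier 0" for s by (simp add: model_carrier_def g_def)
  have wc: "w' \<in> model_carrier 0" by (simp add: model_carrier_def w'_def)
  have md: "model_dist 0 x y = sqrt ((x$1 - y$1)\<^sup>2 + (x$2 - y$2)\<^sup>2 + (x$3 - y$3)\<^sup>2)"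
    if "x \<in> model_carrier 0" "y \<in> model_carrier 0" for x y
    using that by (simp add: model_dist_def dist_vec_def L2_set_def sum_3 dist_real_def)
  have 1: "isometric_path (model_surface 0) l g"
    by (auto simp: isometric_path_def gc md) (auto simp: g_def)
  have gw: "(model_dist 0 (g s) w')\<^sup>2 = s\<^sup>2 + a\<^sup>2 - 2 * s * a * C" for s
  proof -
    have "(model_dist 0 (g s) w')\<^sup>2 = (s - a * C)\<^sup>2 + (a * S)\<^sup>2"
      by (simp add: md gc wc) (simp add: g_def w'_def)
    also have "\<dots> = s\<^sup>2 + a\<^sup>2 * (C\<^sup>2 + S\<^sup>2) - 2 * s * a * C"
      by (simp add: power2_eq_square algebra_simps)
    finally show ?thesis by (simp add: CS)
  qed
  have nn: "0 \<le> model_dist 0 x y" for x y by (simp add: model_dist_def)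
  have comm: "model_dist 0 x y = model_dist 0 y x" for x y
    by (auto simp: model_dist_def dist_commute)
  have 2: "model_dist 0 (g 0) w' = a"
    using gw[of 0] a nn by (simp add: power2_eq_iff_nonneg)
  have 3: "model_dist 0 w' (g l) = b"
  proof -
    have "(model_dist 0 (g l) w')\<^sup>2 = l\<^sup>2 + a\<^sup>2 - C * (2 * l * a)" by (simp add: gw)
    also have "\<dots> = b\<^sup>2" unfolding CC(2) by simp
    finally show ?thesis using b nn comm[of w'] by (simp add: power2_eq_iff_nonneg)
  qed
  have 4: "l * (model_dist 0 (g s) w')\<^sup>2 = (l - s) * a\<^sup>2 + s * b\<^sup>2 - l * s * (l - s)" for s
  proof -
    have "l * (model_dist 0 (g s) w')\<^sup>2 = l * (s\<^sup>2 + a\<^sup>2) - s * (C * (2 * l * a))"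
      by (simp add: gw algebra_simps)
    also have "\<dots> = (l - s) * a\<^sup>2 + s * b\<^sup>2 - l * s * (l - s)"
      unfolding CC(2) by (simp add: power2_eq_square algebra_simps)
    finally show ?thesis .
  qed
  show ?thesis using that[OF 1 wc 2 3 4] .
qed

text \<open>By the double angle formula the claim is \<open>cos (2 * v) < 2 * cos u - 1\<close>, and
  \<open>2 * v\<close> exceeds \<open>37/25 * u\<close>. Taylor polynomials of degree four with
  remainder \<open>x^6 / 720\<close> reduce it to a polynomial inequality in
  \<open>q = u\<^sup>2\<close> on the range \<open>0 < q < 16/25\<close>.\<close>

lemma cos_less_cos_square_half:
  fixes u v :: real
  assumes u: "0 < u" "u < pi / 4" and v: "37/50 * u < v" "v \<le> u"
  shows "(cos v)\<^sup>2 < cos u"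
proof -
  have bound: "\<bar>cos x - (1 - x^2 / 2 + x^4 / 24)\<bar> \<le> x^6 / 720" for x :: real
  proof -
    obtain t where "cos x = (\<Sum>m<6. cos_coeff m * x ^ m) + cos (t + 1/2 * real 6 * pi) / fact 6 * x^6"
      using Maclaurin_cos_expansion[of x 6] by blast
    moreover have "(\<Sum>m<6. cos_coeff m * x ^ m) = 1 - x^2 / 2 + x^4 / 24"
    proof -
      have "{..<6::nat} = {0, 1, 2, 3, 4, 5}" by auto
      then show ?thesis by (simp add: cos_coeff_def fact_numeral)
    qed
    moreover have "\<bar>cos (t + 1/2 * real 6 * pi) / fact 6 * x^6\<bar> = \<bar>cos (t + 1/2 * real 6 * pi)\<bar> * (x^6 / 720)"
      by (simp add: abs_mult fact_numeral)
    moreover have "\<bar>cos (t + 1/2 * real 6 * pi)\<bar> * (x^6 / 720) \<le> 1 * (x^6 / 720)"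
      by (intro mult_right_mono abs_cos_le_one) simp
    ultimately show ?thesis by linarith
  qed
  let ?y = "37/25 * u"
  \<comment> \<open>A rational bound for \<open>pi / 4\<close>, because
    \<open>cos (4/5) \<le> 7/10 < sqrt 2 / 2\<close>.\<close>
  have "u < 4/5"
  proof (rule ccontr)
    assume "\<not> ?thesis"
    then have "cos u \<le> cos (4/5)" using u by (intro cos_monotone_0_pi_le) auto
    also have "\<dots> \<le> 1 - (4/5)^2 / 2 + (4/5)^4 / 24 + (4/5)^6 / 720"
      using bound[of "4/5"] by linarith
    also have "\<dots> \<le> 7/10" by (simp add: power_divide)
    finally have "cos (pi / 4) < 7/10" using u cos_monotone_0_pi[of u "pi / 4"] by auto
    then have "sqrt 2 < 7/5" by (simp add: cos_45)
    then have "(sqrt 2)\<^sup>2 < (7/5)\<^sup>2" by (intro power_strict_mono) auto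
    then show False by (simp add: power2_eq_square)
  qed
  then have "u\<^sup>2 < (4/5)\<^sup>2" using u by (intro power_strict_mono) auto
  define q where "q = u\<^sup>2"
  have q: "0 < q" "q < 16/25" using u \<open>u\<^sup>2 < _\<close> by (auto simp: q_def power2_eq_square)
  have pw: "u^4 = q^2" "u^6 = q^3" "?y^2 = (37/25)^2 * q" "?y^4 = (37/25)^4 * q^2" "?y^6 = (37/25)^6 * q^3"
    unfolding power_mult_distrib by (simp_all add: q_def flip: power_mult)
  have "cos ?y \<le> 1 - ?y^2 / 2 + ?y^4 / 24 + ?y^6 / 720"
    using bound[of ?y] by linarith
  moreover have "1 - u^2 / 2 + u^4 / 24 - u^6 / 720 \<le> cos u"
    using bound[of u] by linarith
  moreover have "q^3 \<le> (16/25) * q^2" "q^2 \<le> (16/25) * q"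
    using q by (simp_all add: power3_eq_cube power2_eq_square mult_right_mono)
  ultimately have "cos ?y < 2 * cos u - 1"
    using q unfolding pw q_def[symmetric] by (simp add: power_divide)
  moreover have "cos (2 * v) \<le> cos ?y"
    using u v by (intro cos_monotone_0_pi_le) auto
  ultimately show ?thesis by (simp add: cos_double_cos)
qed

text \<open>The difference of the two sides has derivative
  \<open>a * (cosh (a * y) - cosh y)\<close>, which is nonnegative for nonnegative
  \<open>y\<close>.\<close>

lemma mult_sinh_le_sinh_mult:
  fixes a x :: real
  assumes a: "1 \<le> a" and x: "0 \<le> x"
  shows "a * sinh x \<le> sinh (a * x)"
proof -
  have "(\<lambda>x. sinh (a * x) - a * sinh x) 0 \<le> (\<lambda>x. sinh (a * x) - a * sinh x) x"
  proof (rule DERIV_nonneg_imp_nondecreasing[OF x])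
    fix y assume y: "0 \<le> y" "y \<le> x"
    have "cosh y \<le> cosh (a * y)"
      using y a by (subst cosh_real_nonneg_le_iff) (auto simp: mult_le_cancel_right1)
    moreover have "((\<lambda>x. sinh (a * x) - a * sinh x) has_real_derivative
        cosh (a * y) * a - a * cosh y) (at y)"
      by (auto intro!: derivative_eq_intros)
    ultimately show "\<exists>D. ((\<lambda>x. sinh (a * x) - a * sinh x) has_real_derivative D) (at y) \<and> 0 \<le> D"
      using a by (intro exI conjI) (assumption, simp add: algebra_simps)
  qed
  then show ?thesis by simp
qed

text \<open>Since \<open>cosh u - 1 = 2 * (sinh (u / 2))\<^sup>2\<close> and
  \<open>(cosh v)\<^sup>2 - 1 = (sinh v)\<^sup>2\<close>, a factor above \<open>sqrt 2\<close>
  between \<open>sinh (u / 2)\<close> and \<open>sinh v\<close> is wanted; \<open>37/25\<close> will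
  do, its square \<open>1369/625\<close> being above 2.\<close>

lemma cosh_less_cosh_square_half:
  fixes u v :: real
  assumes u: "0 < u" and v: "37/50 * u < v"
  shows "cosh u < (cosh v)\<^sup>2"
proof -
  have "37/25 * sinh (u / 2) \<le> sinh (37/25 * (u / 2))"
    using u by (intro mult_sinh_le_sinh_mult) auto
  also have "\<dots> \<le> sinh v"
    using v by (subst sinh_real_le_iff) simp
  finally have "(37/25 * sinh (u / 2))\<^sup>2 \<le> (sinh v)\<^sup>2"
    using u by (intro power_mono) auto
  moreover have "0 < (sinh (u / 2))\<^sup>2" using u by simp
  moreover have "cosh u = 2 * (sinh (u / 2))\<^sup>2 + 1"
    using cosh_add[of "u / 2" "u / 2"] cosh_square_eq[of "u / 2"] by (simp add: power2_eq_square)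
  moreover have "(37/25 * sinh (u / 2))\<^sup>2 = 1369/625 * (sinh (u / 2))\<^sup>2"
    by (simp add: power_mult_distrib power_divide)
  ultimately show ?thesis unfolding cosh_square_eq by linarith
qed

text \<open>Walking a short way from \<open>c\<close> towards a farthest point \<open>z\<close> decreases the distance to every
  point within \<open>D\<close> of \<open>z\<close>, as long as the current radius \<open>l\<close> exceeds \<open>37/50 * D\<close>. The
  constant is a rational number between the optimal ratio (about \<open>0.728\<close>, attained on the sphere
  for \<open>D = pi / 4\<close>) and \<open>3/4\<close>, the largest one that \<open>\<xi> \<le> 1/14\<close> permits.\<close>

lemma jung_step:
  assumes geo: "geodesic_space X" and curv: "curvature_le \<kappa> X"
    and conv: "\<And>c. c \<in> mspace X \<Longrightarrow> geodesically_convex X (mball_of X c \<rho>)"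
    and D: "0 < D" "D < \<rho>" "\<kappa> > 0 \<Longrightarrow> D < pi / (4 * sqrt \<kappa>)"
    and l: "37/50 * D < l" "l \<le> D"
  shows "\<exists>s. 0 < s \<and> s < l \<and>
    (\<forall>c\<in>mspace X. \<forall>z\<in>mspace X. \<forall>w\<in>mspace X. \<forall>y\<in>mspace X.
      mdist X c z = l \<longrightarrow> mdist X c w \<le> l \<longrightarrow> mdist X z w \<le> D \<longrightarrow>
      mdist X c y = s \<longrightarrow> mdist X y z = l - s \<longrightarrow> mdist X y w < l)"
proof -
  have l0: "0 < l" using l D by linarith
  have tri: "\<bar>mdist X c w - mdist X c z\<bar> \<le> mdist X w z" "mdist X w z \<le> mdist X c w + mdist X c z"
    if "c \<in> mspace X" "z \<in> mspace X" "w \<in> mspace X" for c z w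
    using mdist_triangle[of c X w z] mdist_triangle[of c X z w] mdist_triangle[of w X c z] that
    by (auto simp: mdist_commute[of X z w] mdist_commute[of X w c])
  consider "\<kappa> > 0" | "\<kappa> = 0" | "\<kappa> < 0" by linarith
  then show ?thesis
  proof cases
    case 1
    define k where "k = sqrt \<kappa>"
    have k: "0 < k" "k\<^sup>2 = \<kappa>" "k * D < pi / 4"
      using 1 D(3) by (auto simp: k_def field_simps)
    have kl: "0 < k * l" "k * l \<le> k * D" "37/50 * (k * D) < k * l"
      using k l0 l mult_strict_left_mono[OF l(1) k(1)] by auto
    \<comment> \<open>The right side of Stewart's formula in the worst case
      \<open>mdist X c w = l\<close>, \<open>mdist X w z = D\<close>. It is a lower bound for all
      configurations, so one \<open>s\<close> serves them all. The value \<open>h 0\<close> belongs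
      to the distance \<open>l\<close>, and the slope at \<open>0\<close> is positive by
      \<open>cos_less_cos_square_half\<close>.\<close>
    define h where "h = (\<lambda>s. sin (k * (l - s)) * cos (k * l) + sin (k * s) * cos (k * D))"
    have "(h has_real_derivative (k * (cos (k * D) - (cos (k * l))\<^sup>2))) (at 0)"
      unfolding h_def by (auto intro!: derivative_eq_intros simp: power2_eq_square algebra_simps)
    moreover have "(cos (k * l))\<^sup>2 < cos (k * D)"
      using kl k D by (intro cos_less_cos_square_half) auto
    ultimately obtain \<delta> where \<delta>: "0 < \<delta>" "\<And>s. 0 < s \<Longrightarrow> s < \<delta> \<Longrightarrow> h 0 < h (0 + s)"
      using DERIV_pos_inc_right[of h _ 0] k by (metis diff_gt_0_iff_gt mult_pos_pos)
    define s where "s = min \<delta> l / 2"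
    have s: "0 < s" "s < l" "h 0 < h s" using \<delta>(1) \<delta>(2)[of s] l0 by (auto simp: s_def)
    have "mdist X y w < l" if in_X: "c \<in> mspace X" "z \<in> mspace X" "w \<in> mspace X" "y \<in> mspace X"
      and d: "mdist X c z = l" "mdist X c w \<le> l" "mdist X z w \<le> D" "mdist X c y = s" "mdist X y z = l - s"
    for c z w y
    proof -
      let ?a = "mdist X c w" and ?b = "mdist X w z"
      have b: "?b \<le> D" using d mdist_commute by metis
      have ka: "k * ?a \<le> k * l" "k * ?b \<le> k * D" "0 \<le> k * ?a" "0 \<le> k * ?b" using d b k by auto
      have pre: "\<bar>?a - l\<bar> \<le> ?b" "?b \<le> ?a + l" "k * (?a + l) \<le> pi"
        using tri[OF in_X(1-3)] d(1) ka kl k(3) by (auto simp: algebra_simps)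
      obtain g w' where g: "isometric_path (model_surface (k\<^sup>2)) l g" "w' \<in> model_carrier (k\<^sup>2)"
        "model_dist (k\<^sup>2) (g 0) w' = ?a" "model_dist (k\<^sup>2) w' (g l) = ?b"
        and law: "\<And>s. s \<in> {0..l} \<Longrightarrow> sin (k * l) * cos (k * model_dist (k\<^sup>2) (g s) w')
          = sin (k * (l - s)) * cos (k * ?a) + sin (k * s) * cos (k * ?b)"
        using spherical_comparison[OF k(1) l0 mdist_nonneg mdist_nonneg pre] by metis
      have "mdist X c w + mdist X w z + mdist X z c < 2 * pi / sqrt \<kappa>"
      proof -
        have "mdist X z c = l" using mdist_commute[of X c z] d(1) by simp
        then have "k * (?a + ?b + mdist X z c) < 2 * pi"
          using ka kl k(3) by (simp add: distrib_left)
        then show ?thesis using k(1) by (simp add: k_def[symmetric] pos_less_divide_eq mult.commute)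
      qed
      then have yw: "mdist X y w \<le> model_dist \<kappa> (g s) w'"
        using curvature_le_isometric_path[OF geo curv conv[OF in_X(1)] _ in_X, of g w'] d D l g k by auto
      have "sin (k * l) * cos (k * l) = h 0" by (simp add: h_def)
      also have "\<dots> < h s" by fact
      also have "\<dots> \<le> sin (k * (l - s)) * cos (k * ?a) + sin (k * s) * cos (k * ?b)"
        unfolding h_def
      proof (intro add_mono mult_left_mono)
        show "cos (k * l) \<le> cos (k * ?a)" "cos (k * D) \<le> cos (k * ?b)"
          using ka kl k(3) pi_gt_zero by (intro cos_monotone_0_pi_le; linarith)+
        have "0 \<le> k * s" "k * s \<le> k * l" using s k by auto
        then show "0 \<le> sin (k * (l - s))" "0 \<le> sin (k * s)"
          using kl k(3) pi_gt_zero unfolding right_diff_distrib by (intro sin_ge_zero; linarith)+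
      qed
      also have "\<dots> = sin (k * l) * cos (k * model_dist \<kappa> (g s) w')"
        using law[of s] s k by simp
      finally have "cos (k * l) < cos (k * model_dist \<kappa> (g s) w')"
        using sin_gt_zero[of "k * l"] kl k by (simp add: mult_less_cancel_left)
      moreover have "cos (k * model_dist \<kappa> (g s) w') \<le> cos (k * l)" if "l \<le> model_dist \<kappa> (g s) w'"
      proof (rule cos_monotone_0_pi_le)
        show "k * model_dist \<kappa> (g s) w' \<le> pi"
          using 1 Cauchy_Schwarz_ineq2[of "g s" w']
          by (auto simp: model_dist_def k_def model_carrier_def intro!: arccos_ubound)
      qed (use that k kl in auto)
      ultimately show ?thesis using yw by force
    qed
    then show ?thesis using s by blast
  next
    case 2
    \<comment> \<open>The minimiser of the quadratic function
      \<open>(l - s) * l\<^sup>2 + s * D\<^sup>2 - l * s * (l - s)\<close>; it is positive because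
      \<open>2 * (37/50)\<^sup>2 > 1\<close>.\<close>
    define s where "s = l * (1 - D\<^sup>2 / (2 * l\<^sup>2))"
    have "(37/50 * D)\<^sup>2 < l\<^sup>2" using l D by (intro power_strict_mono) auto
    moreover have "0 < D\<^sup>2" using D by simp
    moreover have "(37/50 * D)\<^sup>2 = 1369/2500 * D\<^sup>2" by (simp add: power_mult_distrib power_divide)
    ultimately have Dl: "0 < D\<^sup>2" "D\<^sup>2 < 2 * l\<^sup>2" by linarith+
    then have s: "0 < s" "s < l" using l0 by (auto simp: s_def field_simps)
    have sl: "s * l = l\<^sup>2 - D\<^sup>2 / 2"
      using l0 by (simp add: s_def power2_eq_square field_simps)
    have "mdist X y w < l" if in_X: "c \<in> mspace X" "z \<in> mspace X" "w \<in> mspace X" "y \<in> mspace X"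
      and d: "mdist X c z = l" "mdist X c w \<le> l" "mdist X z w \<le> D" "mdist X c y = s" "mdist X y z = l - s"
    for c z w y
    proof -
      let ?a = "mdist X c w" and ?b = "mdist X w z"
      have b: "?b \<le> D" using d mdist_commute by metis
      have pre: "\<bar>?a - l\<bar> \<le> ?b" "?b \<le> ?a + l"
        using tri[OF in_X(1-3)] d(1) by auto
      obtain g w' where g: "isometric_path (model_surface 0) l g" "w' \<in> model_carrier 0"
        "model_dist 0 (g 0) w' = ?a" "model_dist 0 w' (g l) = ?b"
        and law: "\<And>s. s \<in> {0..l} \<Longrightarrow> l * (model_dist 0 (g s) w')\<^sup>2
          = (l - s) * ?a\<^sup>2 + s * ?b\<^sup>2 - l * s * (l - s)"
        using euclidean_comparison[OF l0 mdist_nonneg mdist_nonneg pre] by metis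
      have yw: "mdist X y w \<le> model_dist 0 (g s) w'"
        using curvature_le_isometric_path[OF geo curv conv[OF in_X(1)] _ in_X, of g w'] d D l g 2 by auto
      have "s \<in> {0..l}" using s by simp
      have "l * (model_dist 0 (g s) w')\<^sup>2 \<le> (l - s) * l\<^sup>2 + s * D\<^sup>2 - l * s * (l - s)"
        unfolding law[OF \<open>s \<in> {0..l}\<close>]
        using s d(2) b by (intro diff_mono add_mono mult_left_mono power_mono) auto
      also have "\<dots> = l * l\<^sup>2 - s * (2 * l\<^sup>2 - D\<^sup>2) + s * (s * l)"
        by (simp add: power2_eq_square algebra_simps)
      also have "\<dots> = l * l\<^sup>2 - s * (l\<^sup>2 - D\<^sup>2 / 2)"
        unfolding sl by (simp add: field_simps)
      also have "\<dots> < l * l\<^sup>2" using s Dl by simp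
      finally have "(model_dist 0 (g s) w')\<^sup>2 < l\<^sup>2" using l0 by simp
      then have "model_dist 0 (g s) w' < l" using l0 by (intro power2_less_imp_less[of _ l]) auto
      then show ?thesis using yw by linarith
    qed
    then show ?thesis using s by blast
  next
    case 3
    define k where "k = sqrt (-\<kappa>)"
    have k: "0 < k" "-k\<^sup>2 = \<kappa>"
      using 3 by (auto simp: k_def)
    have kl: "0 < k * l" "k * l \<le> k * D" "37/50 * (k * D) < k * l"
      using k l0 l mult_strict_left_mono[OF l(1) k(1)] by auto
    \<comment> \<open>As on the sphere with inequalities reversed: \<open>cosh\<close> increases, so
      \<open>h\<close> is now an upper bound and has to decrease at \<open>0\<close>.\<close>
    define h where "h = (\<lambda>s. sinh (k * (l - s)) * cosh (k * l) + sinh (k * s) * cosh (k * D))"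
    have "(h has_real_derivative (k * (cosh (k * D) - (cosh (k * l))\<^sup>2))) (at 0)"
      unfolding h_def by (auto intro!: derivative_eq_intros simp: power2_eq_square algebra_simps)
    moreover have "cosh (k * D) < (cosh (k * l))\<^sup>2"
      using kl k D by (intro cosh_less_cosh_square_half) auto
    ultimately obtain \<delta> where \<delta>: "0 < \<delta>" "\<And>s. 0 < s \<Longrightarrow> s < \<delta> \<Longrightarrow> h (0 + s) < h 0"
      using DERIV_neg_dec_right[of h _ 0] k by (metis diff_less_0_iff_less mult_pos_neg)
    define s where "s = min \<delta> l / 2"
    have s: "0 < s" "s < l" "h s < h 0" using \<delta>(1) \<delta>(2)[of s] l0 by (auto simp: s_def)
    have "mdist X y w < l" if in_X: "c \<in> mspace X" "z \<in> mspace X" "w \<in> mspace X" "y \<in> mspace X"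
      and d: "mdist X c z = l" "mdist X c w \<le> l" "mdist X z w \<le> D" "mdist X c y = s" "mdist X y z = l - s"
    for c z w y
    proof -
      let ?a = "mdist X c w" and ?b = "mdist X w z"
      have b: "?b \<le> D" using d mdist_commute by metis
      have ka: "k * ?a \<le> k * l" "k * ?b \<le> k * D" "0 \<le> k * ?a" "0 \<le> k * ?b" using d b k by auto
      have pre: "\<bar>?a - l\<bar> \<le> ?b" "?b \<le> ?a + l"
        using tri[OF in_X(1-3)] d(1) by auto
      obtain g w' where g: "isometric_path (model_surface (-k\<^sup>2)) l g" "w' \<in> model_carrier (-k\<^sup>2)"
        "model_dist (-k\<^sup>2) (g 0) w' = ?a" "model_dist (-k\<^sup>2) w' (g l) = ?b"
        and law: "\<And>s. s \<in> {0..l} \<Longrightarrow> sinh (k * l) * cosh (k * model_dist (-k\<^sup>2) (g s) w')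
          = sinh (k * (l - s)) * cosh (k * ?a) + sinh (k * s) * cosh (k * ?b)"
        using hyperbolic_comparison[OF k(1) l0 mdist_nonneg mdist_nonneg pre] by metis
      have yw: "mdist X y w \<le> model_dist \<kappa> (g s) w'"
        using curvature_le_isometric_path[OF geo curv conv[OF in_X(1)] _ in_X, of g w'] d D l g k 3 by auto
      have "sinh (k * l) * cosh (k * model_dist \<kappa> (g s) w')
          = sinh (k * (l - s)) * cosh (k * ?a) + sinh (k * s) * cosh (k * ?b)"
        using law[of s] s k by simp
      also have "\<dots> \<le> h s"
        unfolding h_def
      proof (intro add_mono mult_left_mono)
        show "cosh (k * ?a) \<le> cosh (k * l)" "cosh (k * ?b) \<le> cosh (k * D)"
          using ka kl by (auto simp: cosh_real_nonneg_le_iff)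
        show "0 \<le> sinh (k * (l - s))" "0 \<le> sinh (k * s)" using s k by auto
      qed
      also have "\<dots> < h 0" by fact
      also have "\<dots> = sinh (k * l) * cosh (k * l)" by (simp add: h_def)
      finally have "cosh (k * model_dist \<kappa> (g s) w') < cosh (k * l)"
        using kl by (simp add: mult_less_cancel_left)
      moreover have "cosh (k * l) \<le> cosh (k * model_dist \<kappa> (g s) w')" if "l \<le> model_dist \<kappa> (g s) w'"
        using that k kl l0 by (subst cosh_real_nonneg_le_iff) auto
      ultimately show ?thesis using yw by force
    qed
    then show ?thesis using s by blast
  qed
qed

section \<open>Maps from and to a geometric realization\<close>

definition simplicial_complex :: "'a set set \<Rightarrow> bool" where
  "simplicial_complex K \<longleftrightarrow> (\<forall>\<sigma>\<in>K. finite \<sigma>) \<and> (\<forall>\<sigma>\<in>K. \<forall>\<tau>. \<tau> \<subseteq> \<sigma> \<and> \<tau> \<noteq> {} \<longrightarrow> \<tau> \<in> K)"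

lemma simplicial_complex_vietoris_rips: "simplicial_complex (vietoris_rips \<beta> S)"
  unfolding simplicial_complex_def vietoris_rips_def
  by (auto intro: finite_subset)

lemma closed_faceD:
  assumes "f \<in> closed_face \<sigma>"
  shows "\<And>v. 0 \<le> f v" "\<And>v. v \<notin> \<sigma> \<Longrightarrow> f v = 0" "sum f \<sigma> = 1"
  using assms by (auto simp: closed_face_def)

lemma closed_face_restrict:
  assumes "finite \<sigma>" "f \<in> closed_face \<sigma>" and V: "\<And>v. v \<notin> V \<Longrightarrow> f v = 0"
  shows "f \<in> closed_face (\<sigma> \<inter> V)" "\<sigma> \<inter> V \<noteq> {}"
proof -
  have "sum f (\<sigma> \<inter> V) = sum f \<sigma>"
    using assms by (intro sum.mono_neutral_left) auto
  then show "f \<in> closed_face (\<sigma> \<inter> V)" using assms by (auto simp: closed_face_def)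
  then show "\<sigma> \<inter> V \<noteq> {}" by (auto dest: closed_faceD(3))
qed

lemma continuous_on_coordinate: "continuous_on A (\<lambda>f :: 'a \<Rightarrow> real. f v)"
  by (rule continuous_on_subset[OF continuous_on_product_coordinates]) simp

lemma closed_closed_face:
  assumes "finite \<sigma>"
  shows "closed (closed_face \<sigma>)"
proof -
  have "closed_face \<sigma> = (\<Inter>v. {f. 0 \<le> f v}) \<inter> (\<Inter>v\<in>-\<sigma>. {f. f v = 0}) \<inter> {f. sum f \<sigma> = 1}"
    by (auto simp: closed_face_def)
  also have "closed \<dots>"
    by (intro closed_Int closed_INT ballI closed_Collect_le closed_Collect_eq
        continuous_on_const continuous_on_sum continuous_on_coordinate)
  finally show ?thesis .
qed

text \<open>The weak topology is in general finer than the coordinatewise one, so continuous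
  coordinates alone do not suffice. A finite \<open>V\<close> leaves only finitely many faces, each
  closed coordinatewise, and the points of these faces outside a given open set form a closed set
  \<open>C\<close>.\<close>

lemma continuous_map_into_realization:
  assumes K: "simplicial_complex K" and V: "finite V"
    and F: "\<And>z. z \<in> topspace Z \<Longrightarrow> F z \<in> topspace (geometric_realization K)"
    and supp: "\<And>z v. z \<in> topspace Z \<Longrightarrow> v \<notin> V \<Longrightarrow> F z v = 0"
    and cont: "\<And>v. continuous_map Z euclideanreal (\<lambda>z. F z v)"
  shows "continuous_map Z (geometric_realization K) F"
  unfolding continuous_map_def
proof (intro conjI allI impI)
  show "F \<in> topspace Z \<rightarrow> topspace (geometric_realization K)" using F by auto
  fix U assume U: "openin (geometric_realization K) U"
  have "continuous_map Z (product_topology (\<lambda>_. euclideanreal) UNIV) F"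
    using cont by (simp add: continuous_map_componentwise_UNIV)
  then have contF: "continuous_map Z euclidean F"
    by (simp add: euclidean_product_topology)
  define C where "C = (\<Union>\<sigma>\<in>{\<sigma>\<in>K. \<sigma> \<subseteq> V}. closed_face \<sigma> - U)"
  have "closed C"
    unfolding C_def
  proof (intro closed_UN ballI)
    show "finite {\<sigma> \<in> K. \<sigma> \<subseteq> V}" using V by (auto intro: finite_subset[of _ "Pow V"])
    fix \<sigma> assume "\<sigma> \<in> {\<sigma> \<in> K. \<sigma> \<subseteq> V}"
    then have \<sigma>: "\<sigma> \<in> K" "finite \<sigma>" using K by (auto simp: simplicial_complex_def)
    have "openin (top_of_set (closed_face \<sigma>)) (U \<inter> closed_face \<sigma>)"
      using U \<sigma> by (simp add: openin_geometric_realization)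
    then have "closedin (top_of_set (closed_face \<sigma>)) (closed_face \<sigma> - U)"
      by (simp add: closedin_def Diff_Diff_Int Int_commute)
    then show "closed (closed_face \<sigma> - U)"
      using closed_closed_face[OF \<sigma>(2)] closedin_closed_trans by blast
  qed
  have "F z \<in> U \<longleftrightarrow> F z \<in> - C" if z: "z \<in> topspace Z" for z
  proof -
    obtain \<sigma> where \<sigma>: "\<sigma> \<in> K" "F z \<in> closed_face \<sigma>"
      using F[OF z] by (auto simp: topspace_geometric_realization)
    then have "finite \<sigma>" using K by (auto simp: simplicial_complex_def)
    then have "F z \<in> closed_face (\<sigma> \<inter> V)" "\<sigma> \<inter> V \<in> K"
      using closed_face_restrict[OF _ \<sigma>(2) supp[OF z]] K \<sigma>(1) by (auto simp: simplicial_complex_def)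
    then show ?thesis by (auto simp: C_def)
  qed
  then have "{x \<in> topspace Z. F x \<in> U} = {x \<in> topspace Z. F x \<in> - C}" by blast
  also have "openin Z \<dots>"
    using contF \<open>closed C\<close> by (intro openin_continuous_map_preimage[of Z euclidean]) auto
  finally show "openin Z {x \<in> topspace Z. F x \<in> U}" .
qed

lemma continuous_map_from_realization:
  assumes "\<And>\<sigma>. \<sigma> \<in> K \<Longrightarrow> continuous_map (top_of_set (closed_face \<sigma>)) Z F"
  shows "continuous_map (geometric_realization K) Z F"
  unfolding continuous_map_def
proof (intro conjI allI impI)
  show "F \<in> topspace (geometric_realization K) \<rightarrow> topspace Z"
    using continuous_map_funspace[OF assms] by (fastforce simp: topspace_geometric_realization)
  fix U assume U: "openin Z U"
  show "openin (geometric_realization K) {x \<in> topspace (geometric_realization K). F x \<in> U}"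
    unfolding openin_geometric_realization
  proof (intro conjI ballI)
    fix \<sigma> assume \<sigma>: "\<sigma> \<in> K"
    have "{x \<in> topspace (geometric_realization K). F x \<in> U} \<inter> closed_face \<sigma>
        = {x \<in> topspace (top_of_set (closed_face \<sigma>)). F x \<in> U}"
      using \<sigma> by (auto simp: topspace_geometric_realization)
    then show "openin (top_of_set (closed_face \<sigma>))
        ({x \<in> topspace (geometric_realization K). F x \<in> U} \<inter> closed_face \<sigma>)"
      using openin_continuous_map_preimage[OF assms[OF \<sigma>] U] by simp
  qed (auto simp: topspace_geometric_realization)
qed

text \<open>A product with the weak topology need not be coherent with its cells; compactness of the
  interval is what makes the tube lemma work here.\<close>

lemma continuous_map_from_realization_Times_interval:
  assumes cont: "\<And>\<sigma>. \<sigma> \<in> K \<Longrightarrow> continuous_map (top_of_set ({0..1::real} \<times> closed_face \<sigma>)) Z H"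
  shows "continuous_map (prod_topology (top_of_set {0..1}) (geometric_realization K)) Z H"
  unfolding continuous_map_def
proof (intro conjI allI impI)
  have HZ: "H (s, x) \<in> topspace Z" if "s \<in> {0..1}" "x \<in> closed_face \<sigma>" "\<sigma> \<in> K" for s x \<sigma>
    using continuous_map_funspace[OF cont[OF that(3)]] that by auto
  then show "H \<in> topspace (prod_topology (top_of_set {0..1}) (geometric_realization K)) \<rightarrow> topspace Z"
    by (auto simp: topspace_geometric_realization)
  fix U assume U: "openin Z U"
  let ?O = "{p \<in> topspace (prod_topology (top_of_set {0..1}) (geometric_realization K)). H p \<in> U}"
  have pre: "openin (top_of_set ({0..1} \<times> closed_face \<sigma>)) {p \<in> {0..1} \<times> closed_face \<sigma>. H p \<in> U}"
    if "\<sigma> \<in> K" for \<sigma>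
    using openin_continuous_map_preimage[OF cont[OF that] U] by simp
  show "openin (prod_topology (top_of_set {0..1}) (geometric_realization K)) ?O"
    unfolding openin_prod_topology_alt
  proof (intro allI impI)
    fix s0 x0 assume "(s0, x0) \<in> ?O"
    then obtain \<sigma>0 where s0: "s0 \<in> {0..1}" "H (s0, x0) \<in> U" and \<sigma>0: "\<sigma>0 \<in> K" "x0 \<in> closed_face \<sigma>0"
      by (auto simp: topspace_geometric_realization)
    obtain T where T: "open T" "{p \<in> {0..1} \<times> closed_face \<sigma>0. H p \<in> U} = {0..1} \<times> closed_face \<sigma>0 \<inter> T"
      using pre[OF \<sigma>0(1)] by (auto simp: openin_open)
    have "open ((\<lambda>s. (s, x0)) -` T)"
      by (intro open_vimage T continuous_intros)
    moreover have "s0 \<in> (\<lambda>s. (s, x0)) -` T" using T(2) s0 \<sigma>0 by auto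
    ultimately obtain e where e: "0 < e" "cball s0 e \<subseteq> (\<lambda>s. (s, x0)) -` T"
      by (meson open_contains_cball)
    \<comment> \<open>A closed neighbourhood of \<open>s0\<close>, so that \<open>I\<close> is
      compact and the projection along it is a closed map.\<close>
    define I where "I = {0..1} \<inter> cball s0 e"
    have I: "compact I" "I \<subseteq> {0..1}" by (auto simp: I_def compact_Int)
    define W where "W = {x \<in> topspace (geometric_realization K). \<forall>s\<in>I. H (s, x) \<in> U}"
    have "openin (geometric_realization K) W"
      unfolding openin_geometric_realization
    proof (intro conjI ballI)
      fix \<sigma> assume \<sigma>: "\<sigma> \<in> K"
      let ?P = "prod_topology (top_of_set I) (top_of_set (closed_face \<sigma>))"
      have P: "?P = top_of_set (I \<times> closed_face \<sigma>)"
        by simp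
      have c: "continuous_map ?P Z H"
        unfolding P using I by (intro continuous_map_from_subtopology_mono[OF cont[OF \<sigma>]]) auto
      let ?C = "{p \<in> I \<times> closed_face \<sigma>. H p \<notin> U}"
      have "closedin ?P (topspace ?P - {p \<in> topspace ?P. H p \<in> U})"
        by (intro closedin_diff closedin_topspace openin_continuous_map_preimage[OF c U])
      moreover have "topspace ?P - {p \<in> topspace ?P. H p \<in> U} = ?C" by auto
      ultimately have "closedin ?P ?C" by argo
      moreover have "closed_map ?P (top_of_set (closed_face \<sigma>)) snd"
        using I by (intro closed_map_snd) (simp add: compact_space_subtopology)
      ultimately have "closedin (top_of_set (closed_face \<sigma>)) (snd ` ?C)"
        unfolding closed_map_def by blast
      then have "openin (top_of_set (closed_face \<sigma>)) (closed_face \<sigma> - snd ` ?C)"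
        by (simp add: openin_diff)
      moreover have "snd ` ?C = {x \<in> closed_face \<sigma>. \<exists>s\<in>I. H (s, x) \<notin> U}"
        by (auto simp: image_iff)
      moreover have "closed_face \<sigma> - {x \<in> closed_face \<sigma>. \<exists>s\<in>I. H (s, x) \<notin> U} = W \<inter> closed_face \<sigma>"
        using \<sigma> by (auto simp: W_def topspace_geometric_realization)
      ultimately show "openin (top_of_set (closed_face \<sigma>)) (W \<inter> closed_face \<sigma>)" by simp
    qed (auto simp: W_def topspace_geometric_realization)
    moreover have "openin (top_of_set {0..1}) ({0..1} \<inter> ball s0 e)" by (rule openin_open_Int) simp
    moreover have "s0 \<in> {0..1} \<inter> ball s0 e" using s0 e by simp
    moreover have "x0 \<in> W"
    proof -
      have "H (s, x0) \<in> U" if "s \<in> I" for s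
      proof -
        have "(s, x0) \<in> {0..1} \<times> closed_face \<sigma>0 \<inter> T" using that e \<sigma>0 by (auto simp: I_def)
        then show ?thesis using T(2) by blast
      qed
      then show ?thesis using \<sigma>0 by (auto simp: W_def topspace_geometric_realization)
    qed
    moreover have "({0..1} \<inter> ball s0 e) \<times> W \<subseteq> ?O"
      by (auto simp: W_def I_def)
    ultimately show "\<exists>V W. openin (top_of_set {0..1}) V \<and> openin (geometric_realization K) W \<and>
        s0 \<in> V \<and> x0 \<in> W \<and> V \<times> W \<subseteq> ?O"
      by blast
  qed
qed

text \<open>The finite vertex set may depend on the face: continuity is checked on the cylinder over
  one closed face at a time, where \<open>continuous_map_into_realization\<close> applies.\<close>

lemma homotopic_realization_maps:
  assumes K: "simplicial_complex K"
    and H: "\<And>s \<mu>. s \<in> {0..1} \<Longrightarrow> \<mu> \<in> topspace (geometric_realization K)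
              \<Longrightarrow> H (s, \<mu>) \<in> topspace (geometric_realization K)"
    and cont: "\<And>\<tau> v. \<tau> \<in> K \<Longrightarrow> continuous_on ({0..1::real} \<times> closed_face \<tau>) (\<lambda>p. H p v)"
    and fin: "\<And>\<tau>. \<tau> \<in> K \<Longrightarrow> finite (V \<tau>)"
    and supp: "\<And>\<tau> \<mu> s v. \<lbrakk>\<tau> \<in> K; \<mu> \<in> closed_face \<tau>; s \<in> {0..1}; v \<notin> V \<tau>\<rbrakk> \<Longrightarrow> H (s, \<mu>) v = 0"
  shows "homotopic_with (\<lambda>_. True) (geometric_realization K) (geometric_realization K)
           (\<lambda>\<mu>. H (0, \<mu>)) (\<lambda>\<mu>. H (1, \<mu>))"
proof -
  have "continuous_map (top_of_set ({0..1} \<times> closed_face \<tau>)) (geometric_realization K) H"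
    if \<tau>: "\<tau> \<in> K" for \<tau>
  proof (rule continuous_map_into_realization[OF K fin[OF \<tau>]])
    fix p assume "p \<in> topspace (top_of_set ({0..1::real} \<times> closed_face \<tau>))"
    then obtain s \<mu> where p: "p = (s, \<mu>)" "s \<in> {0..1}" "\<mu> \<in> closed_face \<tau>" by auto
    then have "\<mu> \<in> topspace (geometric_realization K)"
      using \<tau> by (auto simp: topspace_geometric_realization)
    with p show "H p \<in> topspace (geometric_realization K)" using H by simp
    show "H p v = 0" if "v \<notin> V \<tau>" for v using supp[OF \<tau>] p that by simp
  qed (use cont[OF \<tau>] in simp)
  then have "continuous_map (prod_topology (top_of_set {0..1}) (geometric_realization K))
      (geometric_realization K) H"
    by (rule continuous_map_from_realization_Times_interval)
  then show ?thesis unfolding homotopic_with_def by (intro exI[of _ H]) auto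
qed

text \<open>The simplex containing both \<open>F \<mu>\<close> and \<open>G \<mu>\<close>, and with
  them the segment, may vary with the point; only the vertices that occur over one face are confined
  to the finite set \<open>V \<tau>\<close>.\<close>

lemma homotopic_realization_maps_linear:
  assumes K: "simplicial_complex K"
    and F: "\<And>\<mu>. \<mu> \<in> topspace (geometric_realization K)
              \<Longrightarrow> \<exists>\<sigma>\<in>K. F \<mu> \<in> closed_face \<sigma> \<and> G \<mu> \<in> closed_face \<sigma>"
    and cont: "\<And>\<tau> v. \<tau> \<in> K \<Longrightarrow> continuous_on (closed_face \<tau>) (\<lambda>\<mu>. F \<mu> v)"
              "\<And>\<tau> v. \<tau> \<in> K \<Longrightarrow> continuous_on (closed_face \<tau>) (\<lambda>\<mu>. G \<mu> v)"
    and fin: "\<And>\<tau>. \<tau> \<in> K \<Longrightarrow> finite (V \<tau>)"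
    and supp: "\<And>\<tau> \<mu> v. \<lbrakk>\<tau> \<in> K; \<mu> \<in> closed_face \<tau>; v \<notin> V \<tau>\<rbrakk> \<Longrightarrow> F \<mu> v = 0 \<and> G \<mu> v = 0"
  shows "homotopic_with (\<lambda>_. True) (geometric_realization K) (geometric_realization K) F G"
proof -
  define H where "H = (\<lambda>(s::real, \<mu>) v. (1 - s) * F \<mu> v + s * G \<mu> v)"
  have "homotopic_with (\<lambda>_. True) (geometric_realization K) (geometric_realization K)
           (\<lambda>\<mu>. H (0, \<mu>)) (\<lambda>\<mu>. H (1, \<mu>))"
  proof (rule homotopic_realization_maps[OF K, where V = V])
    fix s :: real and \<mu> assume s: "s \<in> {0..1}" and "\<mu> \<in> topspace (geometric_realization K)"
    then obtain \<sigma> where \<sigma>: "\<sigma> \<in> K" "F \<mu> \<in> closed_face \<sigma>" "G \<mu> \<in> closed_face \<sigma>"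
      using F by blast
    have "H (s, \<mu>) \<in> closed_face \<sigma>"
      using s \<sigma>(2,3) by (auto simp: H_def closed_face_def sum.distrib simp flip: sum_distrib_left)
    then show "H (s, \<mu>) \<in> topspace (geometric_realization K)"
      using \<sigma>(1) by (auto simp: topspace_geometric_realization)
  next
    fix \<tau> v assume \<tau>: "\<tau> \<in> K"
    have "continuous_on ({0..1::real} \<times> closed_face \<tau>) (\<lambda>p. F (snd p) v)"
      by (rule continuous_on_compose2[OF cont(1)[OF \<tau>] continuous_on_snd]) auto
    moreover have "continuous_on ({0..1::real} \<times> closed_face \<tau>) (\<lambda>p. G (snd p) v)"
      by (rule continuous_on_compose2[OF cont(2)[OF \<tau>] continuous_on_snd]) auto
    ultimately show "continuous_on ({0..1} \<times> closed_face \<tau>) (\<lambda>p. H p v)"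
      unfolding H_def case_prod_beta by (intro continuous_intros)
  qed (use fin supp in \<open>auto simp: H_def\<close>)
  then show ?thesis by (simp add: H_def)
qed

section \<open>Barycentric coordinates of the subdivision\<close>

lemma continuous_on_Max_image:
  fixes f :: "'i \<Rightarrow> 'a::topological_space \<Rightarrow> real"
  assumes "finite I" "I \<noteq> {}" "\<And>i. i \<in> I \<Longrightarrow> continuous_on A (f i)"
  shows "continuous_on A (\<lambda>z. Max ((\<lambda>i. f i z) ` I))"
  using assms
proof (induction I rule: finite_ne_induct)
  case (insert i I)
  then show ?case by (auto intro!: continuous_on_max)
qed simp

lemma continuous_on_Min_image:
  fixes f :: "'i \<Rightarrow> 'a::topological_space \<Rightarrow> real"
  assumes "finite I" "I \<noteq> {}" "\<And>i. i \<in> I \<Longrightarrow> continuous_on A (f i)"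
  shows "continuous_on A (\<lambda>z. Min ((\<lambda>i. f i z) ` I))"
  using assms
proof (induction I rule: finite_ne_induct)
  case (insert i I)
  then show ?case by (auto intro!: continuous_on_min)
qed simp

text \<open>The simplicial map induced by \<open>\<theta>\<close>, in barycentric coordinates: each
  index hands its mass to its image. The indices will be points of a net or vertices of a
  prism.\<close>

definition pushforward :: "'i set \<Rightarrow> ('i \<Rightarrow> real) \<Rightarrow> ('i \<Rightarrow> 'v) \<Rightarrow> 'v \<Rightarrow> real" where
  "pushforward I a \<theta> v = (\<Sum>i | i \<in> I \<and> \<theta> i = v. a i)"

lemma pushforward_eq_0:
  assumes "\<And>i. i \<in> I \<Longrightarrow> \<theta> i = v \<Longrightarrow> a i = 0"
  shows "pushforward I a \<theta> v = 0"
  using assms by (auto simp: pushforward_def intro!: sum.neutral)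

lemma pushforward_mono_neutral:
  assumes "finite J" "I \<subseteq> J" "\<And>i. i \<in> J - I \<Longrightarrow> a i = 0"
  shows "pushforward I a \<theta> = pushforward J a \<theta>"
  using assms by (auto simp: pushforward_def fun_eq_iff intro!: sum.mono_neutral_left)

text \<open>Only indices of positive mass have to land in \<open>\<rho>\<close>. The prism relies on
  this, as the images of all its vertices together need not span a simplex.\<close>

lemma pushforward_in_closed_face:
  assumes I: "finite I" and a: "\<And>i. i \<in> I \<Longrightarrow> 0 \<le> a i" "sum a I = 1"
    and \<rho>: "finite \<rho>" "\<And>i. i \<in> I \<Longrightarrow> a i > 0 \<Longrightarrow> \<theta> i \<in> \<rho>"
  shows "pushforward I a \<theta> \<in> closed_face \<rho>"
proof -
  define J where "J = {i \<in> I. a i > 0}"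
  have J: "finite J" "J \<subseteq> I" "\<theta> ` J \<subseteq> \<rho>" using I \<rho> by (auto simp: J_def)
  have zero: "a i = 0" if "i \<in> I - J" for i using a(1) that by (force simp: J_def)
  have eq: "pushforward I a \<theta> = pushforward J a \<theta>"
    by (rule pushforward_mono_neutral[OF I J(2) zero, symmetric])
  have "sum (pushforward J a \<theta>) \<rho> = sum a J"
    using sum.group[OF J(1) \<rho>(1) J(3), of a] by (simp add: pushforward_def)
  also have "\<dots> = sum a I" using I J(2) zero by (intro sum.mono_neutral_left) auto
  also have "\<dots> = 1" by fact
  finally have 1: "sum (pushforward J a \<theta>) \<rho> = 1" .
  have "0 \<le> pushforward J a \<theta> v" for v
    by (auto simp: pushforward_def J_def intro!: sum_nonneg)
  moreover have "pushforward J a \<theta> v = 0" if "v \<notin> \<rho>" for v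
    using that J(3) by (intro pushforward_eq_0) auto
  ultimately show ?thesis using 1 by (auto simp: closed_face_def eq)
qed

lemma continuous_on_pushforward:
  assumes "\<And>i. i \<in> I \<Longrightarrow> continuous_on A (\<lambda>z. a z i)"
  shows "continuous_on A (\<lambda>z. pushforward I (a z) \<theta> v)"
  unfolding pushforward_def using assms by (intro continuous_on_sum) auto

definition support :: "('v \<Rightarrow> real) \<Rightarrow> 'v set" where
  "support \<mu> = {v. \<mu> v \<noteq> 0}"

definition faces :: "'v set \<Rightarrow> 'v set set" where
  "faces \<tau> = Pow \<tau> - {{}}"

lemma finite_faces [simp]: "finite \<tau> \<Longrightarrow> finite (faces \<tau>)"
  by (simp add: faces_def)

text \<open>The superlevel sets of \<open>\<mu>\<close> are the sets \<open>\<sigma>\<close> with \<open>level_gap \<mu> \<sigma> > 0\<close>. Up to a factor,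
  \<open>level_gap \<mu> \<sigma>\<close> is the coordinate of \<open>\<mu>\<close> at the barycentre of \<open>\<sigma>\<close> in the barycentric
  subdivision.\<close>

definition level_gap :: "('v \<Rightarrow> real) \<Rightarrow> 'v set \<Rightarrow> real" where
  "level_gap \<mu> \<sigma> = max 0 (Min (\<mu> ` \<sigma>) - Max (insert 0 (\<mu> ` (support \<mu> - \<sigma>))))"

text \<open>The exact subdivision coordinate would be
  \<open>card \<sigma> * level_gap \<mu> \<sigma>\<close>. Dividing by the total instead keeps the
  carrying chain, the sum 1 and the continuity.\<close>

definition sd_coord :: "('v \<Rightarrow> real) \<Rightarrow> 'v set \<Rightarrow> real" where
  "sd_coord \<mu> \<sigma> = level_gap \<mu> \<sigma> / sum (level_gap \<mu>) (faces (support \<mu>))"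

context
  fixes \<tau> :: "'v set" and \<mu> :: "'v \<Rightarrow> real"
  assumes \<tau>: "finite \<tau>" and \<mu>: "\<mu> \<in> closed_face \<tau>"
begin

lemma support_subset: "support \<mu> \<subseteq> \<tau>"
  using closed_faceD(2)[OF \<mu>] by (auto simp: support_def)

lemma finite_support: "finite (support \<mu>)"
  using support_subset \<tau> by (rule finite_subset)

lemma support_pos: "v \<in> support \<mu> \<longleftrightarrow> 0 < \<mu> v"
  using closed_faceD(1)[OF \<mu>, of v] by (auto simp: support_def)

lemma level_gap_nonneg: "0 \<le> level_gap \<mu> \<sigma>"
  by (simp add: level_gap_def)

text \<open>The inserted \<open>0\<close> absorbs the vertices of \<open>\<tau>\<close> off the
  support. The formula then refers to the fixed set \<open>\<tau>\<close>, which gives continuity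
  although the support jumps within a closed face.\<close>

lemma level_gap_face: "level_gap \<mu> \<sigma> = max 0 (Min (\<mu> ` \<sigma>) - Max (insert 0 (\<mu> ` (\<tau> - \<sigma>))))"
proof -
  have "insert 0 (\<mu> ` (\<tau> - \<sigma>)) = insert 0 (\<mu> ` (support \<mu> - \<sigma>))"
    using support_subset by (auto simp: support_def)
  then show ?thesis by (simp add: level_gap_def)
qed

lemma level_gap_posD:
  assumes \<sigma>: "finite \<sigma>" "\<sigma> \<noteq> {}" and pos: "0 < level_gap \<mu> \<sigma>" and v: "v \<in> \<sigma>"
  shows "v \<in> support \<mu>" "\<And>u. u \<notin> \<sigma> \<Longrightarrow> \<mu> u < \<mu> v"
proof -
  let ?M = "insert 0 (\<mu> ` (support \<mu> - \<sigma>))"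
  have fin: "finite ?M" using finite_support by simp
  have "Max ?M < Min (\<mu> ` \<sigma>)" using pos by (simp add: level_gap_def max_def split: if_splits)
  also have "\<dots> \<le> \<mu> v" using \<sigma> v by (intro Min_le) auto
  finally have *: "x < \<mu> v" if "x \<in> ?M" for x using Max_ge[OF fin that] by simp
  show "v \<in> support \<mu>" using *[of 0] by (simp add: support_pos)
  show "\<mu> u < \<mu> v" if "u \<notin> \<sigma>" for u
    using *[of "\<mu> u"] *[of 0] that by (cases "u \<in> support \<mu>") (auto simp: support_def)
qed

text \<open>The set where \<open>\<mu>\<close> is largest has a positive gap.\<close>

lemma sum_level_gap_pos: "0 < sum (level_gap \<mu>) (faces (support \<mu>))"
proof -
  have ne: "support \<mu> \<noteq> {}"
  proof
    assume "support \<mu> = {}"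
    then have "sum \<mu> \<tau> = 0" by (intro sum.neutral) (auto simp: support_def)
    then show False using closed_faceD(3)[OF \<mu>] by simp
  qed
  define m where "m = Max (\<mu> ` support \<mu>)"
  define \<sigma> where "\<sigma> = {v \<in> support \<mu>. \<mu> v = m}"
  have "m \<in> \<mu> ` support \<mu>" unfolding m_def using ne finite_support by (intro Max_in) auto
  then have \<sigma>: "\<sigma> \<noteq> {}" "\<sigma> \<subseteq> support \<mu>" and "0 < m"
    by (auto simp: \<sigma>_def support_pos)
  have "\<mu> ` \<sigma> = {m}" using \<sigma>(1) by (auto simp: \<sigma>_def)
  moreover have "Max (insert 0 (\<mu> ` (support \<mu> - \<sigma>))) < m"
  proof (subst Max_less_iff)
    show "\<forall>a\<in>insert 0 (\<mu> ` (support \<mu> - \<sigma>)). a < m"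
    proof
      fix a assume "a \<in> insert 0 (\<mu> ` (support \<mu> - \<sigma>))"
      then consider "a = 0" | v where "v \<in> support \<mu>" "\<mu> v \<noteq> m" "a = \<mu> v" by (auto simp: \<sigma>_def)
      then show "a < m"
      proof cases
        case 2
        then have "\<mu> v \<le> m" unfolding m_def using finite_support by (intro Max_ge) auto
        then show ?thesis using 2 by simp
      qed (use \<open>0 < m\<close> in simp)
    qed
  qed (use finite_support in auto)
  ultimately have "0 < level_gap \<mu> \<sigma>" by (simp add: level_gap_def)
  moreover have "\<sigma> \<in> faces (support \<mu>)" using \<sigma> by (auto simp: faces_def)
  ultimately show ?thesis
    using finite_support level_gap_nonneg by (intro sum_pos2[of _ \<sigma>]) auto
qed

lemma sd_coord_nonneg: "0 \<le> sd_coord \<mu> \<sigma>"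
  using sum_level_gap_pos level_gap_nonneg by (simp add: sd_coord_def)

lemma sd_coord_posD:
  assumes \<sigma>: "finite \<sigma>" "\<sigma> \<noteq> {}" and pos: "0 < sd_coord \<mu> \<sigma>" and v: "v \<in> \<sigma>"
  shows "v \<in> support \<mu>" "\<And>u. u \<notin> \<sigma> \<Longrightarrow> \<mu> u < \<mu> v"
  using level_gap_posD[OF \<sigma> _ v] pos sum_level_gap_pos
  by (auto simp: sd_coord_def zero_less_divide_iff)

text \<open>Incomparable sets would contain \<open>v\<close> and \<open>v'\<close> with both
  \<open>\<mu> v' < \<mu> v\<close> and \<open>\<mu> v < \<mu> v'\<close>.\<close>

lemma sd_coord_pos_chain:
  assumes "finite \<sigma>" "\<sigma> \<noteq> {}" "0 < sd_coord \<mu> \<sigma>" "finite \<sigma>'" "\<sigma>' \<noteq> {}" "0 < sd_coord \<mu> \<sigma>'"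
  shows "\<sigma> \<subseteq> \<sigma>' \<or> \<sigma>' \<subseteq> \<sigma>"
proof (rule ccontr)
  assume "\<not> ?thesis"
  then obtain v v' where "v \<in> \<sigma>" "v \<notin> \<sigma>'" "v' \<in> \<sigma>'" "v' \<notin> \<sigma>" by blast
  then show False
    using sd_coord_posD(2)[OF assms(1-3), of v v'] sd_coord_posD(2)[OF assms(4-6), of v' v] by force
qed

lemma sd_coord_eq_0:
  assumes "\<sigma> \<in> faces \<tau> - faces (support \<mu>)"
  shows "sd_coord \<mu> \<sigma> = 0"
proof -
  have "finite \<sigma>" "\<sigma> \<noteq> {}" using assms \<tau> by (auto simp: faces_def intro: finite_subset)
  then have "\<not> 0 < sd_coord \<mu> \<sigma>"
    using sd_coord_posD(1)[of \<sigma>] assms by (auto simp: faces_def)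
  then show ?thesis using sd_coord_nonneg[of \<sigma>] by simp
qed

text \<open>Again the jumping support is replaced by \<open>\<tau>\<close>, an index set that is
  constant on the closed face, so that continuity can be read off term by term.\<close>

lemma sum_faces_support:
  assumes "\<And>\<sigma>. sd_coord \<mu> \<sigma> = 0 \<Longrightarrow> h \<sigma> = 0"
  shows "sum h {\<sigma> \<in> faces (support \<mu>). P \<sigma>} = (sum h {\<sigma> \<in> faces \<tau>. P \<sigma>} :: real)"
proof (rule sum.mono_neutral_left)
  show "finite {\<sigma> \<in> faces \<tau>. P \<sigma>}" using \<tau> by simp
  show "{\<sigma> \<in> faces (support \<mu>). P \<sigma>} \<subseteq> {\<sigma> \<in> faces \<tau>. P \<sigma>}"
    using support_subset by (auto simp: faces_def)
  show "\<forall>\<sigma>\<in>{\<sigma> \<in> faces \<tau>. P \<sigma>} - {\<sigma> \<in> faces (support \<mu>). P \<sigma>}. h \<sigma> = 0"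
    using sd_coord_eq_0 assms by auto
qed

lemma sum_sd_coord_support: "sum (sd_coord \<mu>) (faces (support \<mu>)) = 1"
  using sum_level_gap_pos by (simp add: sd_coord_def flip: sum_divide_distrib)

end

lemma continuous_on_level_gap:
  assumes \<tau>: "finite \<tau>" and \<sigma>: "finite \<sigma>" "\<sigma> \<noteq> {}"
  shows "continuous_on (closed_face \<tau>) (\<lambda>\<mu>. level_gap \<mu> \<sigma>)"
proof -
  \<comment> \<open>The index \<open>None\<close> stands for the inserted \<open>0\<close>, which
    makes the maximum one over a finite family of continuous functions.\<close>
  have eq: "level_gap \<mu> \<sigma> = max 0 (Min ((\<lambda>v. \<mu> v) ` \<sigma>) -
      Max ((\<lambda>i. case i of None \<Rightarrow> 0 | Some v \<Rightarrow> \<mu> v) ` (insert None (Some ` (\<tau> - \<sigma>)))))"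
    if "\<mu> \<in> closed_face \<tau>" for \<mu>
    using level_gap_face[OF \<tau> that] by (simp add: image_image)
  have "continuous_on (closed_face \<tau>) (\<lambda>\<mu>. max 0 (Min ((\<lambda>v. \<mu> v) ` \<sigma>) -
      Max ((\<lambda>i. case i of None \<Rightarrow> 0 | Some v \<Rightarrow> \<mu> v) ` (insert None (Some ` (\<tau> - \<sigma>))))))"
  proof (intro continuous_on_max continuous_on_diff continuous_on_const
      continuous_on_Max_image continuous_on_Min_image \<sigma> continuous_on_coordinate)
    show "continuous_on (closed_face \<tau>) (\<lambda>\<mu>. case i of None \<Rightarrow> 0 | Some v \<Rightarrow> \<mu> v)" for i
      by (cases i) (auto simp: continuous_on_coordinate)
  qed (use \<tau> in auto)
  then show ?thesis using eq by (simp cong: continuous_on_cong)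
qed

lemma continuous_on_sd_coord:
  assumes \<tau>: "finite \<tau>" and \<sigma>: "finite \<sigma>" "\<sigma> \<noteq> {}"
  shows "continuous_on (closed_face \<tau>) (\<lambda>\<mu>. sd_coord \<mu> \<sigma>)"
proof -
  have gap0: "level_gap \<mu> \<sigma> = 0" if "\<mu> \<in> closed_face \<tau>" "sd_coord \<mu> \<sigma> = 0" for \<mu> \<sigma>
    using that sum_level_gap_pos[OF \<tau> that(1)] by (simp add: sd_coord_def)
  have eq: "sd_coord \<mu> \<sigma> = level_gap \<mu> \<sigma> / sum (level_gap \<mu>) (faces \<tau>)"
    and pos: "sum (level_gap \<mu>) (faces \<tau>) > 0" if \<mu>: "\<mu> \<in> closed_face \<tau>" for \<mu>
  proof -
    have "sum (level_gap \<mu>) (faces (support \<mu>)) = sum (level_gap \<mu>) (faces \<tau>)"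
      using sum_faces_support[OF \<tau> \<mu>, of "level_gap \<mu>" "\<lambda>_. True"] gap0[OF \<mu>] by simp
    then show "sd_coord \<mu> \<sigma> = level_gap \<mu> \<sigma> / sum (level_gap \<mu>) (faces \<tau>)"
      "sum (level_gap \<mu>) (faces \<tau>) > 0"
      using sum_level_gap_pos[OF \<tau> \<mu>] by (simp_all add: sd_coord_def)
  qed
  have "continuous_on (closed_face \<tau>) (\<lambda>\<mu>. level_gap \<mu> \<sigma> / sum (level_gap \<mu>) (faces \<tau>))"
  proof (intro continuous_on_divide continuous_on_sum continuous_on_level_gap \<tau> \<sigma>)
    show "\<forall>\<mu>\<in>closed_face \<tau>. sum (level_gap \<mu>) (faces \<tau>) \<noteq> 0" using pos by force
  qed (auto simp: faces_def dest: finite_subset[OF _ \<tau>])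
  then show ?thesis using eq by (simp cong: continuous_on_cong)
qed

section \<open>Geodesic combinations along a chain\<close>

text \<open>The preimage of a closed \<open>C\<close> is the projection of the graph intersected
  with \<open>S \<times> C\<close>, and projecting along a compact factor is a closed map.\<close>

lemma continuous_on_closed_graph:
  fixes f :: "'a::topological_space \<Rightarrow> 'b::topological_space"
  assumes T: "compact T" and f: "f \<in> S \<rightarrow> T"
    and graph: "closedin (top_of_set (S \<times> T)) {p \<in> S \<times> T. snd p = f (fst p)}"
  shows "continuous_on S f"
proof (subst continuous_on_closed_gen[OF f], intro allI impI)
  fix C assume "closedin (top_of_set T) C"
  then have "closedin (top_of_set (S \<times> T)) (S \<times> C)"
    by (intro closedin_Times) auto
  with graph have "closedin (prod_topology (top_of_set S) (top_of_set T))
      ({p \<in> S \<times> T. snd p = f (fst p)} \<inter> (S \<times> C))"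
    by (simp add: closedin_Int)
  moreover have "closed_map (prod_topology (top_of_set S) (top_of_set T)) (top_of_set S) fst"
    using T by (intro closed_map_fst) (simp add: compact_space_subtopology)
  ultimately have "closedin (top_of_set S) (fst ` ({p \<in> S \<times> T. snd p = f (fst p)} \<inter> (S \<times> C)))"
    unfolding closed_map_def by blast
  moreover have "fst ` ({p \<in> S \<times> T. snd p = f (fst p)} \<inter> (S \<times> C)) = S \<inter> f -` C"
    using f by (force simp: image_iff)
  ultimately show "closedin (top_of_set S) (S \<inter> f -` C)" by simp
qed

section \<open>Unique geodesics, ball hulls and centres\<close>

definition geod :: "'m::metric_space set \<Rightarrow> 'm \<Rightarrow> 'm \<Rightarrow> real \<Rightarrow> 'm" where
  "geod Y x y t = (SOME p. p \<in> Y \<and> dist x p = t * dist x y \<and> dist p y = (1 - t) * dist x y)"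

text \<open>Stands in for the closed convex hull.\<close>

definition ball_hull :: "'m::metric_space set \<Rightarrow> real \<Rightarrow> 'm set \<Rightarrow> 'm set" where
  "ball_hull Y \<rho> F = {p \<in> Y. \<forall>c\<in>Y. \<forall>s<\<rho>. (\<forall>x\<in>F. dist c x \<le> s) \<longrightarrow> dist c p \<le> s}"

lemma ball_hullD:
  "\<lbrakk>p \<in> ball_hull Y \<rho> F; c \<in> Y; s < \<rho>; \<And>x. x \<in> F \<Longrightarrow> dist c x \<le> s\<rbrakk> \<Longrightarrow> dist c p \<le> s"
  by (auto simp: ball_hull_def)

lemma ball_hull_subset: "ball_hull Y \<rho> F \<subseteq> Y"
  by (auto simp: ball_hull_def)

lemma ball_hull_superset: "F \<subseteq> Y \<Longrightarrow> F \<subseteq> ball_hull Y \<rho> F"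
  by (auto simp: ball_hull_def)

lemma ball_hull_mono: "F \<subseteq> G \<Longrightarrow> ball_hull Y \<rho> F \<subseteq> ball_hull Y \<rho> G"
  unfolding ball_hull_def by blast

lemma compact_ball_hull:
  assumes "compact Y" shows "compact (ball_hull Y \<rho> F)"
proof -
  have "ball_hull Y \<rho> F = Y \<inter> (\<Inter>(c, s)\<in>{(c, s). c \<in> Y \<and> s < \<rho> \<and> (\<forall>x\<in>F. dist c x \<le> s)}. cball c s)"
    by (auto simp: ball_hull_def)
  moreover have "closed (\<Inter>(c, s)\<in>{(c, s). c \<in> Y \<and> s < \<rho> \<and> (\<forall>x\<in>F. dist c x \<le> s)}. cball c s)"
    by (intro closed_INT ballI) auto
  ultimately show ?thesis using assms by (simp add: compact_Int_closed)
qed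

text \<open>Convexity and uniqueness are expressed by distances alone, without paths, so that they
  pass to an isometric copy of the space.\<close>

locale locally_convex_geodesic =
  fixes Y :: "'m::metric_space set" and \<rho> :: real
  assumes compact: "compact Y"
    and geo: "\<lbrakk>x \<in> Y; y \<in> Y; 0 \<le> t; t \<le> 1\<rbrakk>
          \<Longrightarrow> \<exists>p\<in>Y. dist x p = t * dist x y \<and> dist p y = (1 - t) * dist x y"
    and conv: "\<lbrakk>c \<in> Y; x \<in> Y; y \<in> Y; p \<in> Y; 0 < s; s \<le> \<rho>; dist c x < s; dist c y < s;
          dist x p + dist p y = dist x y\<rbrakk> \<Longrightarrow> dist c p < s"
    and uniq: "\<lbrakk>x \<in> Y; y \<in> Y; p \<in> Y; q \<in> Y; dist x y < \<rho>; dist x p + dist p y = dist x y;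
          dist x q + dist q y = dist x y; dist x p = dist x q\<rbrakk> \<Longrightarrow> p = q"
begin

lemma geod:
  assumes "x \<in> Y" "y \<in> Y" "0 \<le> t" "t \<le> 1"
  shows "geod Y x y t \<in> Y" "dist x (geod Y x y t) = t * dist x y"
    "dist (geod Y x y t) y = (1 - t) * dist x y"
proof -
  have "\<exists>p. p \<in> Y \<and> dist x p = t * dist x y \<and> dist p y = (1 - t) * dist x y"
    using geo[OF assms] by blast
  from someI_ex[OF this] show "geod Y x y t \<in> Y" "dist x (geod Y x y t) = t * dist x y"
    "dist (geod Y x y t) y = (1 - t) * dist x y"
    by (auto simp: geod_def)
qed

lemma geod_0: "x \<in> Y \<Longrightarrow> y \<in> Y \<Longrightarrow> geod Y x y 0 = x"
  using geod(2)[of x y 0] by simp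

lemma geod_1: "x \<in> Y \<Longrightarrow> y \<in> Y \<Longrightarrow> geod Y x y 1 = y"
  using geod(3)[of x y 1] by simp

lemma geod_unique:
  assumes "x \<in> Y" "y \<in> Y" "0 \<le> t" "t \<le> 1" "dist x y < \<rho>" "p \<in> Y"
    "dist x p = t * dist x y" "dist p y = (1 - t) * dist x y"
  shows "p = geod Y x y t"
  using assms geod[OF assms(1-4)] by (intro uniq[of x y]) (auto simp: algebra_simps)

text \<open>Below distance \<open>\<rho>\<close>, uniqueness makes the graph the solution set of two
  equations between continuous functions. It is therefore closed, and the target \<open>Y\<close> is
  compact; the choice made by \<open>SOME\<close> in \<open>geod\<close> does no harm there.\<close>

lemma continuous_on_geod:
  "continuous_on {(x, y, t). x \<in> Y \<and> y \<in> Y \<and> dist x y < \<rho> \<and> 0 \<le> t \<and> t \<le> 1} (\<lambda>(x, y, t). geod Y x y t)"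
  (is "continuous_on ?S ?f")
proof (rule continuous_on_closed_graph[OF compact])
  show "?f \<in> ?S \<rightarrow> Y" using geod(1) by auto
  let ?eq = "\<lambda>((x, y, t), p). dist x p = t * dist x y \<and> dist p y = (1 - t) * dist x y"
  have eq: "{p \<in> ?S \<times> Y. snd p = ?f (fst p)} = (?S \<times> Y) \<inter> Collect ?eq"
    using geod geod_unique by auto
  have "closed (Collect ?eq)"
    unfolding case_prod_beta
    by (intro closed_Collect_conj closed_Collect_eq continuous_intros)
  then show "closedin (top_of_set (?S \<times> Y)) {p \<in> ?S \<times> Y. snd p = ?f (fst p)}"
    unfolding eq by (rule closedin_closed_Int)
qed

lemma ball_hull_between:
  assumes "p \<in> ball_hull Y \<rho> F" "q \<in> ball_hull Y \<rho> F" "w \<in> Y" "dist p w + dist w q = dist p q"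
  shows "w \<in> ball_hull Y \<rho> F"
  unfolding ball_hull_def
proof (intro CollectI conjI ballI allI impI)
  fix c s assume c: "c \<in> Y" "s < \<rho>" "\<forall>x\<in>F. dist c x \<le> s"
  have pq: "p \<in> Y" "q \<in> Y" "dist c p \<le> s" "dist c q \<le> s"
    using assms(1,2) c by (auto simp: ball_hull_def)
  show "dist c w \<le> s"
  proof (rule ccontr)
    assume "\<not> dist c w \<le> s"
    moreover have "0 \<le> s" using pq(3) zero_le_dist order_trans by blast
    \<comment> \<open>\<open>conv\<close> concerns open balls: the one of radius
      \<open>min \<rho> (dist c w)\<close> contains \<open>p\<close> and \<open>q\<close>, hence
      would contain \<open>w\<close>.\<close>
    ultimately have "dist c w < min \<rho> (dist c w)"
      using c(1,2) pq by (intro conv[OF c(1) pq(1,2) assms(3) _ _ _ _ assms(4)]) linarith+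
    then show False by simp
  qed
qed (use assms in auto)

lemma ball_hull_geod:
  assumes "p \<in> ball_hull Y \<rho> F" "q \<in> ball_hull Y \<rho> F" "0 \<le> t" "t \<le> 1"
  shows "geod Y p q t \<in> ball_hull Y \<rho> F"
proof -
  have "p \<in> Y" "q \<in> Y" using assms ball_hull_subset by blast+
  with geod[OF this assms(3,4)] show ?thesis
    by (intro ball_hull_between[OF assms(1,2)]) (auto simp: algebra_simps)
qed

text \<open>The centre minimises the largest distance to \<open>F\<close> over the compact hull. If
  the minimum exceeded \<open>r\<close>, then \<open>step\<close> would move the point towards a
  farthest one, inside the hull, and bring all distances below the minimum.\<close>

lemma exists_center:
  assumes D: "D < \<rho>" and F: "finite F" "F \<noteq> {}" "F \<subseteq> Y" "\<And>x y. x \<in> F \<Longrightarrow> y \<in> F \<Longrightarrow> dist x y \<le> D"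
    and step: "\<And>l. r < l \<Longrightarrow> l \<le> D \<Longrightarrow> \<exists>s. 0 < s \<and> s < l \<and>
      (\<forall>c\<in>Y. \<forall>z\<in>Y. \<forall>w\<in>Y. \<forall>y\<in>Y. dist c z = l \<longrightarrow> dist c w \<le> l \<longrightarrow> dist z w \<le> D \<longrightarrow>
        dist c y = s \<longrightarrow> dist y z = l - s \<longrightarrow> dist y w < l)"
  shows "\<exists>c\<in>ball_hull Y \<rho> F. \<forall>x\<in>F. dist c x \<le> r"
proof -
  let ?H = "ball_hull Y \<rho> F"
  define R where "R = (\<lambda>c. Max ((\<lambda>x. dist c x) ` F))"
  have R_ge: "dist c x \<le> R c" if "x \<in> F" for c x
    unfolding R_def using F that by (intro Max_ge) auto
  have R_in: "\<exists>x\<in>F. dist c x = R c" for c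
  proof -
    have "R c \<in> (\<lambda>x. dist c x) ` F" unfolding R_def using F(1,2) by (intro Max_in) auto
    then show ?thesis by auto
  qed
  have FH: "F \<subseteq> ?H" using F(3) by (rule ball_hull_superset)
  have "continuous_on ?H R"
    unfolding R_def using F(1,2) by (intro continuous_on_Max_image continuous_intros)
  then obtain c where c: "c \<in> ?H" "\<And>y. y \<in> ?H \<Longrightarrow> R c \<le> R y"
    using continuous_attains_inf[OF compact_ball_hull[OF compact, of \<rho> F], of R] F(2) FH by blast
  then have cY: "c \<in> Y" using ball_hull_subset by blast
  have RD: "R c \<le> D"
  proof -
    obtain x where "x \<in> F" using F(2) by blast
    then have "R c \<le> R x" using c(2) FH by blast
    also have "\<dots> \<le> D" using R_in[of x] F(4) \<open>x \<in> F\<close> by force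
    finally show ?thesis .
  qed
  have "R c \<le> r"
  proof (rule ccontr)
    assume "\<not> R c \<le> r"
    then obtain s where s: "0 < s" "s < R c" and
      closer: "\<And>c' z w y. \<lbrakk>c' \<in> Y; z \<in> Y; w \<in> Y; y \<in> Y; dist c' z = R c; dist c' w \<le> R c; dist z w \<le> D;
        dist c' y = s; dist y z = R c - s\<rbrakk> \<Longrightarrow> dist y w < R c"
      using step[of "R c"] RD by auto
    obtain z where z: "z \<in> F" "dist c z = R c" using R_in by blast
    have zY: "z \<in> Y" "z \<in> ?H" using z F(3) FH by auto
    define y where "y = geod Y c z (s / R c)"
    have t: "0 \<le> s / R c" "s / R c \<le> 1" using s by auto
    have "(1 - s / R c) * R c = R c - s" using s by (simp add: field_simps)
    then have y: "y \<in> Y" "dist c y = s" "dist y z = R c - s"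
      using geod[OF cY zY(1) t] s z(2) by (auto simp: y_def)
    have "y \<in> ?H" unfolding y_def using c(1) zY(2) t by (rule ball_hull_geod)
    obtain w where w: "w \<in> F" "dist y w = R y" using R_in by blast
    have "dist y w < R c"
      using closer[OF cY zY(1) _ y(1) z(2)] w(1) R_ge F(3,4) z(1) y by blast
    then show False using w(2) c(2)[OF \<open>y \<in> ?H\<close>] by simp
  qed
  then show ?thesis using c(1) R_ge by (meson order_trans)
qed

end

section \<open>The chain of a point, ordered by cardinality\<close>

definition layer :: "('v \<Rightarrow> real) \<Rightarrow> nat \<Rightarrow> real" where
  "layer \<mu> n = sum (sd_coord \<mu>) {\<sigma> \<in> faces (support \<mu>). card \<sigma> = n}"

definition layers_upto :: "('v \<Rightarrow> real) \<Rightarrow> nat \<Rightarrow> real" where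
  "layers_upto \<mu> n = sum (sd_coord \<mu>) {\<sigma> \<in> faces (support \<mu>). card \<sigma> \<le> n}"

text \<open>On a nonzero layer this is the only set of the chain with \<open>n\<close> elements,
  because nested finite sets of equal size agree. Numbering by cardinality lets one recursion serve
  all chains.\<close>

definition layer_face :: "('v \<Rightarrow> real) \<Rightarrow> nat \<Rightarrow> 'v set" where
  "layer_face \<mu> n = (SOME \<sigma>. \<sigma> \<in> faces (support \<mu>) \<and> card \<sigma> = n \<and> 0 < sd_coord \<mu> \<sigma>)"

definition chain_of :: "('v \<Rightarrow> real) \<Rightarrow> nat \<Rightarrow> 'v set set" where
  "chain_of \<mu> n = {\<sigma> \<in> faces (support \<mu>). card \<sigma> \<le> n \<and> 0 < sd_coord \<mu> \<sigma>}"

text \<open>The starting point \<open>y0\<close> is irrelevant: the first nonzero layer has ratio \<open>1\<close>, hence moves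
  the point all the way to its centre.\<close>

primrec chain_point :: "'m::metric_space set \<Rightarrow> ('v set \<Rightarrow> 'm) \<Rightarrow> 'm \<Rightarrow> ('v \<Rightarrow> real) \<Rightarrow> nat \<Rightarrow> 'm" where
  "chain_point Y c y0 \<mu> 0 = y0"
| "chain_point Y c y0 \<mu> (Suc n) =
    (if layer \<mu> (Suc n) = 0 then chain_point Y c y0 \<mu> n
     else geod Y (chain_point Y c y0 \<mu> n) (c (layer_face \<mu> (Suc n)))
            (layer \<mu> (Suc n) / layers_upto \<mu> (Suc n)))"

context
  fixes \<tau> :: "'v set" and \<mu> :: "'v \<Rightarrow> real"
  assumes \<tau>: "finite \<tau>" and \<mu>: "\<mu> \<in> closed_face \<tau>"
begin

lemma faces_support_subset: "faces (support \<mu>) \<subseteq> faces \<tau>"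
  using support_subset[OF \<tau> \<mu>] by (auto simp: faces_def)

lemma finite_faces_support: "finite (faces (support \<mu>))"
  using finite_support[OF \<tau> \<mu>] by simp

lemma layer_nonneg: "0 \<le> layer \<mu> n"
  unfolding layer_def using sd_coord_nonneg[OF \<tau> \<mu>] by (intro sum_nonneg)

lemma layers_upto_nonneg: "0 \<le> layers_upto \<mu> n"
  unfolding layers_upto_def using sd_coord_nonneg[OF \<tau> \<mu>] by (intro sum_nonneg)

lemma layers_upto_Suc: "layers_upto \<mu> (Suc n) = layers_upto \<mu> n + layer \<mu> (Suc n)"
proof -
  have "{\<sigma> \<in> faces (support \<mu>). card \<sigma> \<le> Suc n} =
      {\<sigma> \<in> faces (support \<mu>). card \<sigma> \<le> n} \<union> {\<sigma> \<in> faces (support \<mu>). card \<sigma> = Suc n}" by auto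
  then show ?thesis
    unfolding layers_upto_def layer_def using finite_faces_support
    by (simp add: sum.union_disjoint[symmetric] disjoint_iff)
qed

lemma layers_upto_0: "layers_upto \<mu> 0 = 0"
proof -
  have "card \<sigma> \<noteq> 0" if "\<sigma> \<in> faces (support \<mu>)" for \<sigma>
    using that finite_support[OF \<tau> \<mu>] by (auto simp: faces_def dest: finite_subset)
  then have "{\<sigma> \<in> faces (support \<mu>). card \<sigma> \<le> 0} = {}" by auto
  then show ?thesis unfolding layers_upto_def by (simp only: sum.empty)
qed

lemma layer_face:
  assumes "layer \<mu> n \<noteq> 0"
  shows "layer_face \<mu> n \<in> faces (support \<mu>)" "card (layer_face \<mu> n) = n" "0 < sd_coord \<mu> (layer_face \<mu> n)"
proof -
  obtain \<sigma> where "\<sigma> \<in> faces (support \<mu>)" "card \<sigma> = n" "sd_coord \<mu> \<sigma> \<noteq> 0"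
    using assms unfolding layer_def by (rule sum.not_neutral_contains_not_neutral) blast
  then have "\<exists>\<sigma>. \<sigma> \<in> faces (support \<mu>) \<and> card \<sigma> = n \<and> 0 < sd_coord \<mu> \<sigma>"
    using sd_coord_nonneg[OF \<tau> \<mu>, of \<sigma>] by (intro exI[of _ \<sigma>]) auto
  from someI_ex[OF this] show "layer_face \<mu> n \<in> faces (support \<mu>)" "card (layer_face \<mu> n) = n"
    "0 < sd_coord \<mu> (layer_face \<mu> n)" by (auto simp: layer_face_def)
qed

lemma chain_of_chain:
  assumes "\<sigma> \<in> chain_of \<mu> n" "\<sigma>' \<in> chain_of \<mu> m"
  shows "\<sigma> \<subseteq> \<sigma>' \<or> \<sigma>' \<subseteq> \<sigma>"
  using assms finite_support[OF \<tau> \<mu>]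
  by (intro sd_coord_pos_chain[OF \<tau> \<mu>]) (auto simp: chain_of_def faces_def dest: finite_subset)

lemma layer_face_unique:
  assumes "\<sigma> \<in> faces \<tau>" "0 < sd_coord \<mu> \<sigma>"
  shows "layer \<mu> (card \<sigma>) \<noteq> 0" "layer_face \<mu> (card \<sigma>) = \<sigma>"
proof -
  have \<sigma>: "\<sigma> \<in> faces (support \<mu>)" using sd_coord_eq_0[OF \<tau> \<mu>, of \<sigma>] assms by auto
  have "0 < layer \<mu> (card \<sigma>)"
    unfolding layer_def using \<sigma> assms(2) finite_faces_support sd_coord_nonneg[OF \<tau> \<mu>]
    by (intro sum_pos2[of _ \<sigma>]) auto
  then show l: "layer \<mu> (card \<sigma>) \<noteq> 0" by simp
  note lf = layer_face[OF l]
  have fin: "finite \<sigma>" "finite (layer_face \<mu> (card \<sigma>))"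
    using \<sigma> lf(1) finite_support[OF \<tau> \<mu>] by (auto simp: faces_def dest: finite_subset)
  have "\<sigma> \<in> chain_of \<mu> (card \<sigma>)" "layer_face \<mu> (card \<sigma>) \<in> chain_of \<mu> (card \<sigma>)"
    using \<sigma> assms lf by (auto simp: chain_of_def)
  then show "layer_face \<mu> (card \<sigma>) = \<sigma>"
    using chain_of_chain fin lf(2) by (metis card_subset_eq)
qed

lemma layers_upto_pos_iff: "0 < layers_upto \<mu> n \<longleftrightarrow> chain_of \<mu> n \<noteq> {}"
proof
  assume "0 < layers_upto \<mu> n"
  then have "layers_upto \<mu> n \<noteq> 0" by simp
  then obtain \<sigma> where "\<sigma> \<in> faces (support \<mu>)" "card \<sigma> \<le> n" "sd_coord \<mu> \<sigma> \<noteq> 0"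
    unfolding layers_upto_def by (rule sum.not_neutral_contains_not_neutral) blast
  then show "chain_of \<mu> n \<noteq> {}"
    using sd_coord_nonneg[OF \<tau> \<mu>, of \<sigma>] by (auto simp: chain_of_def)
next
  assume "chain_of \<mu> n \<noteq> {}"
  then obtain \<sigma> where "\<sigma> \<in> faces (support \<mu>)" "card \<sigma> \<le> n" "0 < sd_coord \<mu> \<sigma>"
    by (auto simp: chain_of_def)
  then show "0 < layers_upto \<mu> n"
    unfolding layers_upto_def using finite_faces_support sd_coord_nonneg[OF \<tau> \<mu>]
    by (intro sum_pos2[of _ \<sigma>]) auto
qed

lemma layer_zero: "card \<tau> < n \<Longrightarrow> layer \<mu> n = 0"
  using layer_face[of n] faces_support_subset \<tau>
  by (metis Diff_iff PowD card_mono faces_def leD subsetD)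

lemma layers_upto_card: "layers_upto \<mu> (card \<tau>) = 1"
proof -
  have "{\<sigma> \<in> faces (support \<mu>). card \<sigma> \<le> card \<tau>} = faces (support \<mu>)"
    using support_subset[OF \<tau> \<mu>] \<tau> by (auto simp: faces_def intro!: card_mono)
  then show ?thesis using sum_sd_coord_support[OF \<tau> \<mu>] by (simp add: layers_upto_def)
qed

text \<open>Sizes above \<open>card \<tau>\<close> carry no mass, so all points of a closed face can
  be treated with the same number of steps.\<close>

lemma chain_point_card:
  assumes "card \<tau> \<le> n"
  shows "chain_point Y c y0 \<mu> n = chain_point Y c y0 \<mu> (card \<tau>)"
  using assms by (induction n rule: dec_induct) (auto simp: layer_zero)

end

lemma continuous_on_layer:
  assumes \<tau>: "finite \<tau>"
  shows "continuous_on (closed_face \<tau>) (\<lambda>\<mu>. layer \<mu> n)"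
    and "continuous_on (closed_face \<tau>) (\<lambda>\<mu>. layers_upto \<mu> n)"
proof -
  have c: "continuous_on (closed_face \<tau>) (\<lambda>\<mu>. sum (sd_coord \<mu>) {\<sigma> \<in> faces \<tau>. P \<sigma>})" for P
    by (intro continuous_on_sum continuous_on_sd_coord \<tau>) (auto simp: faces_def dest: finite_subset[OF _ \<tau>])
  have e: "sum (sd_coord \<mu>) {\<sigma> \<in> faces (support \<mu>). P \<sigma>} = sum (sd_coord \<mu>) {\<sigma> \<in> faces \<tau>. P \<sigma>}"
    if "\<mu> \<in> closed_face \<tau>" for \<mu> P
    using sum_faces_support[OF \<tau> that, of "sd_coord \<mu>"] by simp
  show "continuous_on (closed_face \<tau>) (\<lambda>\<mu>. layer \<mu> n)"
    unfolding layer_def using c[of "\<lambda>\<sigma>. card \<sigma> = n"] e by (simp cong: continuous_on_cong)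
  show "continuous_on (closed_face \<tau>) (\<lambda>\<mu>. layers_upto \<mu> n)"
    unfolding layers_upto_def using c[of "\<lambda>\<sigma>. card \<sigma> \<le> n"] e by (simp cong: continuous_on_cong)
qed


text \<open>The bound \<open>cr\<close> is asked of nested simplices only; the sets of a chain are
  nested.\<close>

locale geodesic_chain = locally_convex_geodesic Y \<rho> for Y :: "'m::metric_space set" and \<rho> +
  fixes K :: "'v set set" and c :: "'v set \<Rightarrow> 'm" and y0 :: 'm and r :: real
  assumes K: "simplicial_complex K"
    and cY: "\<And>\<sigma>. \<sigma> \<in> K \<Longrightarrow> c \<sigma> \<in> Y"
    and cr: "\<And>\<sigma> \<tau>. \<lbrakk>\<sigma> \<in> K; \<tau> \<in> K; \<sigma> \<subseteq> \<tau>\<rbrakk> \<Longrightarrow> dist (c \<sigma>) (c \<tau>) \<le> r"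
    and r: "r < \<rho>" and y0: "y0 \<in> Y"
begin

lemma faces_in_complex: "\<tau> \<in> K \<Longrightarrow> faces \<tau> \<subseteq> K" "\<tau> \<in> K \<Longrightarrow> finite \<tau>"
  using K by (auto simp: simplicial_complex_def faces_def)

lemma layer_ratio:
  assumes "\<tau> \<in> K" "\<mu> \<in> closed_face \<tau>"
  shows "0 \<le> layer \<mu> (Suc n) / layers_upto \<mu> (Suc n)" "layer \<mu> (Suc n) / layers_upto \<mu> (Suc n) \<le> 1"
  using layer_nonneg[OF faces_in_complex(2)[OF assms(1)] assms(2), of "Suc n"]
    layers_upto_nonneg[OF faces_in_complex(2)[OF assms(1)] assms(2), of n]
    layers_upto_Suc[OF faces_in_complex(2)[OF assms(1)] assms(2), of n]
  by (auto simp: divide_le_eq_1)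

lemma layer_face_in_complex:
  assumes "\<tau> \<in> K" "\<mu> \<in> closed_face \<tau>" "layer \<mu> n \<noteq> 0"
  shows "layer_face \<mu> n \<in> K"
  using layer_face(1)[OF faces_in_complex(2)[OF assms(1)] assms(2,3)]
    faces_support_subset[OF faces_in_complex(2)[OF assms(1)] assms(2)] faces_in_complex(1)[OF assms(1)]
  by blast

lemma chain_point_in:
  assumes "\<tau> \<in> K" "\<mu> \<in> closed_face \<tau>"
  shows "chain_point Y c y0 \<mu> n \<in> Y"
proof (induction n)
  case (Suc n)
  then show ?case
    using geod(1) layer_ratio[OF assms] cY layer_face_in_complex[OF assms] by auto
qed (simp add: y0)

lemma chain_of_subset_complex:
  assumes "\<tau> \<in> K" "\<mu> \<in> closed_face \<tau>"
  shows "chain_of \<mu> n \<subseteq> K"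
  using faces_support_subset[OF faces_in_complex(2)[OF assms(1)] assms(2)] faces_in_complex(1)[OF assms(1)]
  by (auto simp: chain_of_def)

lemma chain_point_in_ball_hull:
  assumes \<tau>: "\<tau> \<in> K" and \<mu>: "\<mu> \<in> closed_face \<tau>" and "0 < layers_upto \<mu> n"
  shows "chain_point Y c y0 \<mu> n \<in> ball_hull Y \<rho> (c ` chain_of \<mu> n)"
  using assms(3)
proof (induction n)
  case 0
  then show ?case using layers_upto_0[OF faces_in_complex(2)[OF \<tau>] \<mu>] by simp
next
  case (Suc n)
  note fin = faces_in_complex(2)[OF \<tau>]
  let ?F = "c ` chain_of \<mu> (Suc n)"
  have "chain_of \<mu> n \<subseteq> chain_of \<mu> (Suc n)" by (auto simp: chain_of_def)
  then have mono: "ball_hull Y \<rho> (c ` chain_of \<mu> n) \<subseteq> ball_hull Y \<rho> ?F"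
    by (intro ball_hull_mono image_mono)
  have FY: "?F \<subseteq> Y" using cY chain_of_subset_complex[OF \<tau> \<mu>] by blast
  show ?case
  proof (cases "layer \<mu> (Suc n) = 0")
    case True
    then show ?thesis using Suc layers_upto_Suc[OF fin \<mu>, of n] mono by auto
  next
    case False
    have "layer_face \<mu> (Suc n) \<in> chain_of \<mu> (Suc n)"
      using layer_face[OF fin \<mu> False] by (simp add: chain_of_def)
    then have c: "c (layer_face \<mu> (Suc n)) \<in> ball_hull Y \<rho> ?F"
      using ball_hull_superset[OF FY] by blast
    show ?thesis
    proof (cases "0 < layers_upto \<mu> n")
      case True
      then show ?thesis
        using ball_hull_geod[OF _ c layer_ratio[OF \<tau> \<mu>]] Suc.IH mono False by auto
    next
      \<comment> \<open>The first nonzero layer: the ratio is \<open>1\<close>, so the new point is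
        the centre, wherever the old one was.\<close>
      case no: False
      then have "layer \<mu> (Suc n) / layers_upto \<mu> (Suc n) = 1"
        using layers_upto_Suc[OF fin \<mu>, of n] layers_upto_nonneg[OF fin \<mu>, of n] False by simp
      then show ?thesis
        using False c geod_1[OF chain_point_in[OF \<tau> \<mu>] cY[OF layer_face_in_complex[OF \<tau> \<mu> False]]] by simp
    qed
  qed
qed

text \<open>A centre of the chain is within \<open>r < \<rho>\<close> of all the others, hence of
  their ball hull. As \<open>m\<close> and \<open>n\<close> are independent, this bounds the
  distance from a partial combination to the next centre, where continuity of \<open>geod\<close> is
  wanted.\<close>

lemma chain_point_dist:
  assumes \<tau>: "\<tau> \<in> K" and \<mu>: "\<mu> \<in> closed_face \<tau>" and pos: "0 < layers_upto \<mu> n"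
    and \<sigma>: "\<sigma> \<in> chain_of \<mu> m"
  shows "dist (c \<sigma>) (chain_point Y c y0 \<mu> n) \<le> r"
proof (rule ball_hullD[OF chain_point_in_ball_hull[OF \<tau> \<mu> pos] _ r])
  have \<sigma>K: "\<sigma> \<in> K" using \<sigma> chain_of_subset_complex[OF \<tau> \<mu>] by blast
  then show "c \<sigma> \<in> Y" by (rule cY)
  fix x assume "x \<in> c ` chain_of \<mu> n"
  then obtain \<sigma>' where \<sigma>': "\<sigma>' \<in> chain_of \<mu> n" "x = c \<sigma>'" by blast
  then have "\<sigma>' \<in> K" using chain_of_subset_complex[OF \<tau> \<mu>] by blast
  then show "dist (c \<sigma>) x \<le> r"
    using chain_of_chain[OF faces_in_complex(2)[OF \<tau>] \<mu> \<sigma> \<sigma>'(1)] cr \<sigma>K \<sigma>'(2)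
    by (metis dist_commute)
qed

text \<open>Three cases at \<open>\<mu>0\<close>. If the new layer vanishes, nearby points may use
  varying centres, but they move by at most the ratio times the diameter bound \<open>B\<close>. If
  it does not vanish and earlier mass is present, the centre is locally constant and
  \<open>geod\<close> is continuous. Without earlier mass the previous points need not converge, but
  the ratio tends to \<open>1\<close> and pulls the result to the centre.\<close>

lemma tendsto_chain_point:
  assumes \<tau>: "\<tau> \<in> K" and \<mu>0: "\<mu>0 \<in> closed_face \<tau>" and "0 < layers_upto \<mu>0 n"
  shows "((\<lambda>\<mu>. chain_point Y c y0 \<mu> n) \<longlongrightarrow> chain_point Y c y0 \<mu>0 n) (at \<mu>0 within closed_face \<tau>)"
  using assms(3)
proof (induction n)
  case 0
  then show ?case using layers_upto_0[OF faces_in_complex(2)[OF \<tau>] \<mu>0] by simp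
next
  case (Suc n)
  note fin = faces_in_complex(2)[OF \<tau>]
  let ?at = "at \<mu>0 within closed_face \<tau>"
  let ?P = "\<lambda>\<mu> n. chain_point Y c y0 \<mu> n" and ?t = "\<lambda>\<mu>. layer \<mu> (Suc n) / layers_upto \<mu> (Suc n)"
  have lim_layer: "((\<lambda>\<mu>. layer \<mu> m) \<longlongrightarrow> layer \<mu>0 m) ?at"
    and lim_layers: "((\<lambda>\<mu>. layers_upto \<mu> m) \<longlongrightarrow> layers_upto \<mu>0 m) ?at" for m
    using continuous_on_layer[OF fin] \<mu>0 by (auto simp: continuous_on_def)
  have lim_t: "(?t \<longlongrightarrow> ?t \<mu>0) ?at"
    using Suc.prems by (intro tendsto_divide lim_layer lim_layers) simp
  have in_face: "\<forall>\<^sub>F \<mu> in ?at. \<mu> \<in> closed_face \<tau>"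
    by (simp add: eventually_at_filter)
  obtain B where B: "\<And>x y. x \<in> Y \<Longrightarrow> y \<in> Y \<Longrightarrow> dist x y \<le> B"
    using compact_imp_bounded[OF compact] bounded_two_points by metis
  note PY = chain_point_in[OF \<tau>]
  have PSuc: "?P \<mu> (Suc n) = geod Y (?P \<mu> n) (c (layer_face \<mu> (Suc n))) (?t \<mu>)"
    if "layer \<mu> (Suc n) \<noteq> 0" for \<mu> using that by simp
  have dP: "dist (?P \<mu> n) (?P \<mu> (Suc n)) \<le> ?t \<mu> * B" if \<mu>: "\<mu> \<in> closed_face \<tau>" for \<mu>
  proof (cases "layer \<mu> (Suc n) = 0")
    case False
    have lY: "c (layer_face \<mu> (Suc n)) \<in> Y" by (intro cY layer_face_in_complex[OF \<tau> \<mu> False])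
    have "dist (?P \<mu> n) (?P \<mu> (Suc n)) = ?t \<mu> * dist (?P \<mu> n) (c (layer_face \<mu> (Suc n)))"
      unfolding PSuc[OF False] by (rule geod(2)[OF PY[OF \<mu>] lY layer_ratio[OF \<tau> \<mu>]])
    also have "\<dots> \<le> ?t \<mu> * B"
      by (rule mult_left_mono[OF B[OF PY[OF \<mu>] lY] layer_ratio(1)[OF \<tau> \<mu>]])
    finally show ?thesis .
  qed simp
  show ?case
  proof (cases "layer \<mu>0 (Suc n) = 0")
    case True
    then have P0: "?P \<mu>0 (Suc n) = ?P \<mu>0 n" by simp
    have "0 < layers_upto \<mu>0 n" using Suc.prems True layers_upto_Suc[OF fin \<mu>0, of n] by simp
    then have IH: "((\<lambda>\<mu>. ?P \<mu> n) \<longlongrightarrow> ?P \<mu>0 n) ?at" by (rule Suc.IH)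
    have "((\<lambda>\<mu>. ?t \<mu> * B) \<longlongrightarrow> ?t \<mu>0 * B) ?at" by (intro tendsto_mult_right lim_t)
    then have "((\<lambda>\<mu>. ?t \<mu> * B) \<longlongrightarrow> 0) ?at" using True by simp
    moreover have "\<forall>\<^sub>F \<mu> in ?at. norm (dist (?P \<mu> n) (?P \<mu> (Suc n))) \<le> ?t \<mu> * B"
      using in_face by eventually_elim (use dP in auto)
    ultimately have "((\<lambda>\<mu>. dist (?P \<mu> n) (?P \<mu> (Suc n))) \<longlongrightarrow> 0) ?at"
      by (rule Lim_null_comparison[rotated])
    then have "((\<lambda>\<mu>. dist (?P \<mu> n) (?P \<mu> (Suc n)) + dist (?P \<mu> n) (?P \<mu>0 n)) \<longlongrightarrow> 0 + 0) ?at"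
      using tendsto_dist_iff[THEN iffD1, OF IH] by (rule tendsto_add)
    then have "((\<lambda>\<mu>. dist (?P \<mu> n) (?P \<mu> (Suc n)) + dist (?P \<mu> n) (?P \<mu>0 n)) \<longlongrightarrow> 0) ?at"
      by (simp only: add_0)
    moreover have "\<forall>\<^sub>F \<mu> in ?at. norm (dist (?P \<mu> (Suc n)) (?P \<mu>0 n))
        \<le> dist (?P \<mu> n) (?P \<mu> (Suc n)) + dist (?P \<mu> n) (?P \<mu>0 n)"
      by (intro always_eventually allI) (simp only: real_norm_def abs_of_nonneg zero_le_dist dist_triangle3)
    ultimately have "((\<lambda>\<mu>. dist (?P \<mu> (Suc n)) (?P \<mu>0 n)) \<longlongrightarrow> 0) ?at"
      by (rule Lim_null_comparison[rotated])
    then show ?thesis unfolding P0 by (simp only: tendsto_dist_iff[symmetric])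
  next
    case False
    define \<sigma>0 where "\<sigma>0 = layer_face \<mu>0 (Suc n)"
    have \<sigma>0: "\<sigma>0 \<in> faces \<tau>" "card \<sigma>0 = Suc n" "0 < sd_coord \<mu>0 \<sigma>0"
      using layer_face[OF fin \<mu>0 False] faces_support_subset[OF fin \<mu>0] by (auto simp: \<sigma>0_def)
    have \<sigma>0K: "\<sigma>0 \<in> K" using \<sigma>0(1) faces_in_complex(1)[OF \<tau>] by blast
    have "finite \<sigma>0" "\<sigma>0 \<noteq> {}" using \<sigma>0(1) fin by (auto simp: faces_def dest: finite_subset)
    then have "((\<lambda>\<mu>. sd_coord \<mu> \<sigma>0) \<longlongrightarrow> sd_coord \<mu>0 \<sigma>0) ?at"
      using continuous_on_sd_coord[OF fin] \<mu>0 by (auto simp: continuous_on_def)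
    then have "\<forall>\<^sub>F \<mu> in ?at. 0 < sd_coord \<mu> \<sigma>0" using \<sigma>0(3) by (rule order_tendstoD(1))
    \<comment> \<open>The coordinate at \<open>\<sigma>0\<close> stays positive nearby and a chain
      has one set of each size, so \<open>layer_face\<close> is locally constant.\<close>
    then have ev: "\<forall>\<^sub>F \<mu> in ?at. \<mu> \<in> closed_face \<tau> \<and> layer \<mu> (Suc n) \<noteq> 0 \<and> layer_face \<mu> (Suc n) = \<sigma>0
        \<and> \<sigma>0 \<in> chain_of \<mu> (Suc n)"
      using in_face
    proof eventually_elim
      case (elim \<mu>)
      then show ?case
        using layer_face_unique[OF fin elim(2) \<sigma>0(1)] \<sigma>0(2) sd_coord_eq_0[OF fin elim(2), of \<sigma>0] \<sigma>0(1)
        by (auto simp: chain_of_def)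
    qed
    have P0: "?P \<mu>0 (Suc n) = geod Y (?P \<mu>0 n) (c \<sigma>0) (?t \<mu>0)" using False by (simp add: \<sigma>0_def)
    have evP: "\<forall>\<^sub>F \<mu> in ?at. geod Y (?P \<mu> n) (c \<sigma>0) (?t \<mu>) = ?P \<mu> (Suc n)"
      using ev by eventually_elim (use PSuc in auto)
    have "((\<lambda>\<mu>. geod Y (?P \<mu> n) (c \<sigma>0) (?t \<mu>)) \<longlongrightarrow> geod Y (?P \<mu>0 n) (c \<sigma>0) (?t \<mu>0)) ?at"
    proof (cases "0 < layers_upto \<mu>0 n")
      case True
      let ?E = "{(x, y, t). x \<in> Y \<and> y \<in> Y \<and> dist x y < \<rho> \<and> 0 \<le> t \<and> t \<le> 1}"
      have "\<forall>\<^sub>F \<mu> in ?at. 0 < layers_upto \<mu> n" using lim_layers True by (rule order_tendstoD(1))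
      with ev have "\<forall>\<^sub>F \<mu> in ?at. (?P \<mu> n, c \<sigma>0, ?t \<mu>) \<in> ?E"
      proof eventually_elim
        case (elim \<mu>)
        then have \<mu>: "\<mu> \<in> closed_face \<tau>" and \<sigma>: "\<sigma>0 \<in> chain_of \<mu> (Suc n)" by auto
        have "dist (?P \<mu> n) (c \<sigma>0) < \<rho>"
          using chain_point_dist[OF \<tau> \<mu> elim(2) \<sigma>] r by (simp add: dist_commute)
        then show ?case using PY[OF \<mu>] cY[OF \<sigma>0K] layer_ratio[OF \<tau> \<mu>] by simp
      qed
      moreover have "(?P \<mu>0 n, c \<sigma>0, ?t \<mu>0) \<in> ?E"
      proof -
        have "\<sigma>0 \<in> chain_of \<mu>0 (Suc n)"
          using layer_face[OF fin \<mu>0 False] by (simp add: \<sigma>0_def chain_of_def)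
        then have "dist (?P \<mu>0 n) (c \<sigma>0) < \<rho>"
          using chain_point_dist[OF \<tau> \<mu>0 True] r by (fastforce simp: dist_commute)
        then show ?thesis using PY[OF \<mu>0] cY[OF \<sigma>0K] layer_ratio[OF \<tau> \<mu>0] by simp
      qed
      moreover have "((\<lambda>\<mu>. (?P \<mu> n, c \<sigma>0, ?t \<mu>)) \<longlongrightarrow> (?P \<mu>0 n, c \<sigma>0, ?t \<mu>0)) ?at"
        by (intro tendsto_Pair tendsto_const lim_t Suc.IH True)
      ultimately show ?thesis
        using continuous_on_tendsto_compose[OF continuous_on_geod] by force
    next
      case no: False
      then have t0: "?t \<mu>0 = 1"
        using layers_upto_Suc[OF fin \<mu>0, of n] layers_upto_nonneg[OF fin \<mu>0, of n] False by simp
      have "((\<lambda>\<mu>. (1 - ?t \<mu>) * B) \<longlongrightarrow> (1 - ?t \<mu>0) * B) ?at"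
        by (intro tendsto_mult_right tendsto_diff tendsto_const lim_t)
      then have "((\<lambda>\<mu>. (1 - ?t \<mu>) * B) \<longlongrightarrow> 0) ?at" unfolding t0 by simp
      moreover have "\<forall>\<^sub>F \<mu> in ?at. norm (dist (geod Y (?P \<mu> n) (c \<sigma>0) (?t \<mu>)) (c \<sigma>0)) \<le> (1 - ?t \<mu>) * B"
        using in_face
      proof eventually_elim
        case (elim \<mu>)
        have "dist (geod Y (?P \<mu> n) (c \<sigma>0) (?t \<mu>)) (c \<sigma>0) = (1 - ?t \<mu>) * dist (?P \<mu> n) (c \<sigma>0)"
          by (rule geod(3)[OF PY[OF elim] cY[OF \<sigma>0K] layer_ratio[OF \<tau> elim]])
        also have "\<dots> \<le> (1 - ?t \<mu>) * B"
          using layer_ratio(2)[OF \<tau> elim, of n]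
          by (intro mult_left_mono B[OF PY[OF elim] cY[OF \<sigma>0K]]) simp
        finally show ?case by simp
      qed
      ultimately have "((\<lambda>\<mu>. dist (geod Y (?P \<mu> n) (c \<sigma>0) (?t \<mu>)) (c \<sigma>0)) \<longlongrightarrow> 0) ?at"
        by (rule Lim_null_comparison[rotated])
      then have "((\<lambda>\<mu>. geod Y (?P \<mu> n) (c \<sigma>0) (?t \<mu>)) \<longlongrightarrow> c \<sigma>0) ?at"
        by (simp only: tendsto_dist_iff[symmetric])
      then show ?thesis unfolding t0 using geod_1[OF PY[OF \<mu>0] cY[OF \<sigma>0K]] by simp
    qed
    then show ?thesis unfolding P0 by (rule Lim_transform_eventually[OF _ evP])
  qed
qed

end

section \<open>Maps between the space and the Rips complex\<close>

definition lower_mass :: "('v \<Rightarrow> real) \<Rightarrow> 'v set \<Rightarrow> real" where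
  "lower_mass \<mu> \<sigma> = sum (sd_coord \<mu>) {\<sigma>' \<in> faces (support \<mu>). \<sigma>' \<subset> \<sigma>}"

text \<open>The simplices of the prism over a chain: at time \<open>u\<close>, the first \<open>u\<close> units of mass of the
  chain, counted from its smallest set upwards, sit at the \<open>True\<close> end.\<close>

definition prism_weight :: "real \<Rightarrow> ('v \<Rightarrow> real) \<Rightarrow> 'v set \<times> bool \<Rightarrow> real" where
  "prism_weight u \<mu> = (\<lambda>(\<sigma>, b).
     let a = max 0 (min (lower_mass \<mu> \<sigma> + sd_coord \<mu> \<sigma>) u - lower_mass \<mu> \<sigma>)
     in if b then a else sd_coord \<mu> \<sigma> - a)"

context
  fixes \<tau> :: "'v set" and \<mu> :: "'v \<Rightarrow> real"
  assumes \<tau>: "finite \<tau>" and \<mu>: "\<mu> \<in> closed_face \<tau>"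
begin

lemma lower_mass_nonneg: "0 \<le> lower_mass \<mu> \<sigma>"
  unfolding lower_mass_def using sd_coord_nonneg[OF \<tau> \<mu>] by (intro sum_nonneg)

lemma lower_mass_face: "lower_mass \<mu> \<sigma> = sum (sd_coord \<mu>) {\<sigma>' \<in> faces \<tau>. \<sigma>' \<subset> \<sigma>}"
  unfolding lower_mass_def by (rule sum_faces_support[OF \<tau> \<mu>])

lemma lower_mass_psubset:
  assumes "\<sigma> \<in> faces (support \<mu>)" "\<sigma> \<subset> \<sigma>'"
  shows "lower_mass \<mu> \<sigma> + sd_coord \<mu> \<sigma> \<le> lower_mass \<mu> \<sigma>'"
proof -
  have "lower_mass \<mu> \<sigma> + sd_coord \<mu> \<sigma> = sum (sd_coord \<mu>) (insert \<sigma> {\<sigma>' \<in> faces (support \<mu>). \<sigma>' \<subset> \<sigma>})"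
    unfolding lower_mass_def using finite_faces_support[OF \<tau> \<mu>] by (subst sum.insert) auto
  also have "\<dots> \<le> lower_mass \<mu> \<sigma>'"
    unfolding lower_mass_def
    using finite_faces_support[OF \<tau> \<mu>] sd_coord_nonneg[OF \<tau> \<mu>] assms by (intro sum_mono2) auto
  finally show ?thesis .
qed

lemma lower_mass_le_1:
  assumes "\<sigma> \<in> faces (support \<mu>)"
  shows "lower_mass \<mu> \<sigma> + sd_coord \<mu> \<sigma> \<le> 1"
proof -
  have "lower_mass \<mu> \<sigma> + sd_coord \<mu> \<sigma> = sum (sd_coord \<mu>) (insert \<sigma> {\<sigma>' \<in> faces (support \<mu>). \<sigma>' \<subset> \<sigma>})"
    unfolding lower_mass_def using finite_faces_support[OF \<tau> \<mu>] by (subst sum.insert) auto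
  also have "\<dots> \<le> sum (sd_coord \<mu>) (faces (support \<mu>))"
    using finite_faces_support[OF \<tau> \<mu>] sd_coord_nonneg[OF \<tau> \<mu>] assms by (intro sum_mono2) auto
  finally show ?thesis using sum_sd_coord_support[OF \<tau> \<mu>] by simp
qed

lemma prism_weight_nonneg: "0 \<le> prism_weight u \<mu> p"
  using sd_coord_nonneg[OF \<tau> \<mu>] by (auto simp: prism_weight_def Let_def split: prod.splits)

lemma prism_weight_sum: "prism_weight u \<mu> (\<sigma>, True) + prism_weight u \<mu> (\<sigma>, False) = sd_coord \<mu> \<sigma>"
  by (simp add: prism_weight_def)

lemma prism_weight_eq_0: "sd_coord \<mu> \<sigma> = 0 \<Longrightarrow> prism_weight u \<mu> (\<sigma>, b) = 0"
  by (auto simp: prism_weight_def)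

lemma prism_weight_pos: "0 < prism_weight u \<mu> (\<sigma>, b) \<Longrightarrow> 0 < sd_coord \<mu> \<sigma>"
  using prism_weight_eq_0[of \<sigma> u b] sd_coord_nonneg[OF \<tau> \<mu>, of \<sigma>] by (cases "sd_coord \<mu> \<sigma> = 0") auto

lemma sum_prism_weight: "sum (prism_weight u \<mu>) (faces (support \<mu>) \<times> UNIV) = 1"
proof -
  have "sum (prism_weight u \<mu>) (faces (support \<mu>) \<times> UNIV)
      = (\<Sum>\<sigma>\<in>faces (support \<mu>). \<Sum>b\<in>UNIV. prism_weight u \<mu> (\<sigma>, b))"
    by (simp add: sum.cartesian_product)
  also have "\<dots> = sum (sd_coord \<mu>) (faces (support \<mu>))"
    using prism_weight_sum by (intro sum.cong) (auto simp: UNIV_bool add.commute)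
  finally show ?thesis using sum_sd_coord_support[OF \<tau> \<mu>] by simp
qed

lemma prism_weight_0: "prism_weight 0 \<mu> (\<sigma>, True) = 0"
  using lower_mass_nonneg[of \<sigma>] sd_coord_nonneg[OF \<tau> \<mu>, of \<sigma>] by (simp add: prism_weight_def)

lemma prism_weight_1: "\<sigma> \<in> faces (support \<mu>) \<Longrightarrow> prism_weight 1 \<mu> (\<sigma>, False) = 0"
  using lower_mass_le_1[of \<sigma>] sd_coord_nonneg[OF \<tau> \<mu>, of \<sigma>] by (simp add: prism_weight_def)

text \<open>Mass passes to the \<open>True\<close> end from small sets to large ones: for
  \<open>\<sigma>' \<subset> \<sigma>\<close> the \<open>False\<close> end of
  \<open>\<sigma>'\<close> would be empty before \<open>\<sigma>\<close> starts to move.\<close>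

lemma prism_weight_order:
  assumes \<sigma>: "\<sigma> \<in> faces (support \<mu>)" "0 < prism_weight u \<mu> (\<sigma>, True)"
    and \<sigma>': "\<sigma>' \<in> faces (support \<mu>)" "0 < prism_weight u \<mu> (\<sigma>', False)"
  shows "\<sigma> \<subseteq> \<sigma>'"
proof (rule ccontr)
  assume "\<not> ?thesis"
  moreover have "\<sigma> \<subseteq> \<sigma>' \<or> \<sigma>' \<subseteq> \<sigma>"
    using \<sigma> \<sigma>' prism_weight_pos finite_support[OF \<tau> \<mu>]
    by (intro sd_coord_pos_chain[OF \<tau> \<mu>]) (auto simp: faces_def dest: finite_subset)
  ultimately have "lower_mass \<mu> \<sigma>' + sd_coord \<mu> \<sigma>' \<le> lower_mass \<mu> \<sigma>"
    using \<sigma>'(1) by (intro lower_mass_psubset) auto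
  moreover have "lower_mass \<mu> \<sigma> < u"
    using \<sigma>(2) by (simp add: prism_weight_def max_def min_def split: if_splits)
  moreover have "u < lower_mass \<mu> \<sigma>' + sd_coord \<mu> \<sigma>'"
    using \<sigma>'(2) by (simp add: prism_weight_def max_def min_def split: if_splits)
  ultimately show False by simp
qed

end

lemma continuous_on_prism_weight:
  assumes \<tau>: "finite \<tau>" and \<sigma>: "\<sigma> \<in> faces \<tau>"
  shows "continuous_on ({0..1} \<times> closed_face \<tau>) (\<lambda>p. prism_weight (fst p) (snd p) (\<sigma>, b))"
proof -
  let ?A = "{0..1::real} \<times> closed_face \<tau>"
  have snd: "continuous_on ?A (\<lambda>p. h (snd p))" if "continuous_on (closed_face \<tau>) h" for h :: "_ \<Rightarrow> real"
    by (rule continuous_on_compose2[OF that continuous_on_snd]) auto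
  have sd: "continuous_on (closed_face \<tau>) (\<lambda>\<mu>. sd_coord \<mu> \<sigma>)" if "\<sigma> \<in> faces \<tau>" for \<sigma>
    using that by (intro continuous_on_sd_coord \<tau>) (auto simp: faces_def dest: finite_subset[OF _ \<tau>])
  have "continuous_on (closed_face \<tau>) (\<lambda>\<mu>. sum (sd_coord \<mu>) {\<sigma>' \<in> faces \<tau>. \<sigma>' \<subset> \<sigma>})"
    by (intro continuous_on_sum sd) auto
  then have "continuous_on (closed_face \<tau>) (\<lambda>\<mu>. lower_mass \<mu> \<sigma>)"
    using lower_mass_face[OF \<tau>] by (simp cong: continuous_on_cong)
  note cont = snd[OF this] snd[OF sd[OF \<sigma>]]
  show ?thesis
    unfolding prism_weight_def Let_def prod.case
    by (cases b; simp only: if_True if_False)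
      (intro continuous_on_max continuous_on_min continuous_on_diff continuous_on_add
        continuous_on_const continuous_on_fst continuous_on_id cont)+
qed

text \<open>Here \<open>e\<close> is the distortion \<open>2\<xi>\<beta>\<close> of the correspondence and \<open>r\<close> the radius \<open>37/50 * (\<beta> + e)\<close>
  from Jung's theorem.\<close>

locale rips_close = locally_convex_geodesic Y \<rho> for Y :: "'m::metric_space set" and \<rho> +
  fixes S :: "'s metric" and C :: "('m \<times> 's) set" and \<beta> e r :: real
  assumes C_subset: "C \<subseteq> Y \<times> mspace S" and C_fst: "\<And>y. y \<in> Y \<Longrightarrow> \<exists>s. (y, s) \<in> C"
    and C_snd: "\<And>s. s \<in> mspace S \<Longrightarrow> \<exists>y. (y, s) \<in> C"
    and C_close: "\<lbrakk>(y, s) \<in> C; (y', s') \<in> C; dist y y' \<le> \<beta> \<or> mdist S s s' \<le> \<beta>\<rbrakk>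
          \<Longrightarrow> \<bar>dist y y' - mdist S s s'\<bar> \<le> e"
    and small: "0 < e" "0 < r" "r + e < \<beta>" "\<beta> + e < \<rho>"
    and Y_nonempty: "Y \<noteq> {}"
    and center_step: "\<And>l. r < l \<Longrightarrow> l \<le> \<beta> + e \<Longrightarrow> \<exists>s. 0 < s \<and> s < l \<and>
      (\<forall>c\<in>Y. \<forall>z\<in>Y. \<forall>w\<in>Y. \<forall>y\<in>Y. dist c z = l \<longrightarrow> dist c w \<le> l \<longrightarrow> dist z w \<le> \<beta> + e \<longrightarrow>
        dist c y = s \<longrightarrow> dist y z = l - s \<longrightarrow> dist y w < l)"
begin

abbreviation "K \<equiv> vietoris_rips \<beta> S"
abbreviation "RK \<equiv> geometric_realization K"

lemmas K = simplicial_complex_vietoris_rips[of \<beta> S]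

lemma finite_simplex: "\<tau> \<in> K \<Longrightarrow> finite \<tau>"
  by (simp add: vietoris_rips_def)

section \<open>Partners under the correspondence and centres of simplices\<close>

definition to_X :: "'s \<Rightarrow> 'm" where "to_X s = (SOME y. (y, s) \<in> C)"
definition to_S :: "'m \<Rightarrow> 's" where "to_S y = (SOME s. (y, s) \<in> C)"

lemma to_X: "s \<in> mspace S \<Longrightarrow> (to_X s, s) \<in> C"
  unfolding to_X_def using C_snd someI_ex by metis

lemma to_S: "y \<in> Y \<Longrightarrow> (y, to_S y) \<in> C"
  unfolding to_S_def using C_fst someI_ex by metis

lemma to_X_in: "s \<in> mspace S \<Longrightarrow> to_X s \<in> Y"
  using to_X C_subset by blast

lemma to_S_in: "y \<in> Y \<Longrightarrow> to_S y \<in> mspace S"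
  using to_S C_subset by blast

lemma simplex_to_S:
  assumes P: "finite P" "P \<noteq> {}" "P \<subseteq> Y" "\<And>p q. p \<in> P \<Longrightarrow> q \<in> P \<Longrightarrow> dist p q < \<beta> - e"
  shows "to_S ` P \<in> K"
proof -
  have "mdist S (to_S p) (to_S q) < \<beta>" if "p \<in> P" "q \<in> P" for p q
  proof -
    have "dist p q < \<beta> - e" using P that by blast
    moreover have "\<bar>dist p q - mdist S (to_S p) (to_S q)\<bar> \<le> e"
      using that P(3) calculation small by (intro C_close to_S) auto
    ultimately show ?thesis by linarith
  qed
  then show ?thesis using P to_S_in by (auto simp: vietoris_rips_def)
qed

lemma exists_center_simplex:
  assumes \<sigma>: "\<sigma> \<in> K"
  shows "\<exists>c\<in>ball_hull Y \<rho> (to_X ` \<sigma>). \<forall>v\<in>\<sigma>. dist c (to_X v) \<le> r"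
proof -
  have v: "v \<in> mspace S" if "v \<in> \<sigma>" for v using \<sigma> that by (auto simp: vietoris_rips_def)
  have "\<exists>c\<in>ball_hull Y \<rho> (to_X ` \<sigma>). \<forall>x\<in>to_X ` \<sigma>. dist c x \<le> r"
  proof (rule exists_center[OF small(4)])
    show "finite (to_X ` \<sigma>)" "to_X ` \<sigma> \<noteq> {}" "to_X ` \<sigma> \<subseteq> Y"
      using \<sigma> v to_X_in by (auto simp: vietoris_rips_def)
    fix x y assume "x \<in> to_X ` \<sigma>" "y \<in> to_X ` \<sigma>"
    then obtain v w where vw: "v \<in> \<sigma>" "w \<in> \<sigma>" "x = to_X v" "y = to_X w" by blast
    have "mdist S v w < \<beta>" using \<sigma> vw by (auto simp: vietoris_rips_def)
    moreover have "\<bar>dist (to_X v) (to_X w) - mdist S v w\<bar> \<le> e"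
      using vw v calculation by (intro C_close to_X) auto
    ultimately show "dist x y \<le> \<beta> + e" using vw by simp
  qed (rule center_step)
  then show ?thesis by blast
qed

definition center :: "'s set \<Rightarrow> 'm" where
  "center \<sigma> = (SOME c. c \<in> ball_hull Y \<rho> (to_X ` \<sigma>) \<and> (\<forall>v\<in>\<sigma>. dist c (to_X v) \<le> r))"

lemma center:
  assumes "\<sigma> \<in> K"
  shows "center \<sigma> \<in> ball_hull Y \<rho> (to_X ` \<sigma>)" "\<And>v. v \<in> \<sigma> \<Longrightarrow> dist (center \<sigma>) (to_X v) \<le> r"
proof -
  have "\<exists>c. c \<in> ball_hull Y \<rho> (to_X ` \<sigma>) \<and> (\<forall>v\<in>\<sigma>. dist c (to_X v) \<le> r)"
    using exists_center_simplex[OF assms] by blast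
  from someI_ex[OF this, folded center_def]
  show "center \<sigma> \<in> ball_hull Y \<rho> (to_X ` \<sigma>)" "\<And>v. v \<in> \<sigma> \<Longrightarrow> dist (center \<sigma>) (to_X v) \<le> r" by auto
qed

lemma center_in: "\<sigma> \<in> K \<Longrightarrow> center \<sigma> \<in> Y"
  using center(1) ball_hull_subset by blast

lemma r_less: "r < \<rho>" using small by linarith

text \<open>The images of the vertices of \<open>\<sigma>\<close> are within \<open>r\<close> of
  \<open>center \<tau>\<close>, and \<open>center \<sigma>\<close> lies in their ball hull.\<close>

lemma center_nested:
  assumes "\<sigma> \<in> K" "\<tau> \<in> K" "\<sigma> \<subseteq> \<tau>"
  shows "dist (center \<sigma>) (center \<tau>) \<le> r"
proof -
  have "dist (center \<tau>) (center \<sigma>) \<le> r"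
    using assms center(2)[OF assms(2)]
    by (intro ball_hullD[OF center(1)[OF assms(1)] center_in[OF assms(2)] r_less]) auto
  then show ?thesis by (simp add: dist_commute)
qed

lemma in_realization: "\<mu> \<in> topspace RK \<longleftrightarrow> (\<exists>\<tau>\<in>K. \<mu> \<in> closed_face \<tau>)"
  by (auto simp: topspace_geometric_realization)

lemma support_simplex:
  assumes "\<tau> \<in> K" "\<mu> \<in> closed_face \<tau>"
  shows "support \<mu> \<in> K" "\<mu> \<in> closed_face (support \<mu>)"
proof -
  have s: "support \<mu> \<subseteq> \<tau>" by (rule support_subset[OF finite_simplex[OF assms(1)] assms(2)])
  have "\<mu> \<in> closed_face (\<tau> \<inter> support \<mu>)" "\<tau> \<inter> support \<mu> \<noteq> {}"
    by (rule closed_face_restrict[OF finite_simplex[OF assms(1)] assms(2)]; simp add: support_def)+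
  moreover have "\<tau> \<inter> support \<mu> = support \<mu>" using s by blast
  ultimately show "support \<mu> \<in> K" "\<mu> \<in> closed_face (support \<mu>)"
    using s assms(1) K unfolding simplicial_complex_def by auto
qed

section \<open>The map from the complex to the space\<close>

definition base :: 'm where "base = (SOME y. y \<in> Y)"

lemma base: "base \<in> Y" unfolding base_def using Y_nonempty some_in_eq by blast

definition proj :: "('s \<Rightarrow> real) \<Rightarrow> 'm" where
  "proj \<mu> = chain_point Y center base \<mu> (card (support \<mu>))"

definition chain :: "('s \<Rightarrow> real) \<Rightarrow> 's set set" where
  "chain \<mu> = {\<sigma> \<in> faces (support \<mu>). 0 < sd_coord \<mu> \<sigma>}"

sublocale pts: geodesic_chain Y \<rho> K center base r
  by unfold_locales (use K center_in center_nested r_less base in auto)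

lemma proj_face:
  assumes "\<tau> \<in> K" "\<mu> \<in> closed_face \<tau>"
  shows "proj \<mu> = chain_point Y center base \<mu> (card \<tau>)"
  unfolding proj_def
  using support_simplex[OF assms] finite_simplex assms card_mono[OF finite_simplex[OF assms(1)]
      support_subset[OF finite_simplex[OF assms(1)] assms(2)]]
  by (intro chain_point_card[symmetric]) auto

lemma chain_of_eq_chain:
  assumes "\<tau> \<in> K" "\<mu> \<in> closed_face \<tau>"
  shows "chain_of \<mu> (card (support \<mu>)) = chain \<mu>" "chain \<mu> \<subseteq> K" "chain \<mu> \<noteq> {}" "finite (chain \<mu>)"
    "layers_upto \<mu> (card (support \<mu>)) = 1"
proof -
  note supp = support_simplex[OF assms]
  note fin = finite_simplex[OF supp(1)]
  show *: "chain_of \<mu> (card (support \<mu>)) = chain \<mu>"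
    using fin by (auto simp: chain_of_def chain_def faces_def intro: card_mono)
  show "chain \<mu> \<subseteq> K"
    using supp(1) K by (auto simp: chain_def faces_def simplicial_complex_def)
  show "finite (chain \<mu>)" using fin by (simp add: chain_def)
  show "layers_upto \<mu> (card (support \<mu>)) = 1" by (rule layers_upto_card[OF fin supp(2)])
  then show "chain \<mu> \<noteq> {}" using layers_upto_pos_iff[OF fin supp(2), of "card (support \<mu>)"] * by simp
qed

lemma proj_in_ball_hull:
  assumes "\<tau> \<in> K" "\<mu> \<in> closed_face \<tau>"
  shows "proj \<mu> \<in> ball_hull Y \<rho> (center ` chain \<mu>)"
  using pts.chain_point_in_ball_hull[OF support_simplex[OF assms], of "card (support \<mu>)"]
    chain_of_eq_chain[OF assms] by (simp add: proj_def)

lemma proj_dist_center: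
  assumes "\<tau> \<in> K" "\<mu> \<in> closed_face \<tau>" "\<sigma> \<in> chain \<mu>"
  shows "dist (center \<sigma>) (proj \<mu>) \<le> r"
  using pts.chain_point_dist[OF support_simplex[OF assms(1,2)], of "card (support \<mu>)" \<sigma> "card (support \<mu>)"]
    chain_of_eq_chain[OF assms(1,2)] assms(3) by (simp add: proj_def)

lemma proj_in: "\<tau> \<in> K \<Longrightarrow> \<mu> \<in> closed_face \<tau> \<Longrightarrow> proj \<mu> \<in> Y"
  using proj_in_ball_hull ball_hull_subset by blast

lemma continuous_on_proj:
  assumes \<tau>: "\<tau> \<in> K"
  shows "continuous_on (closed_face \<tau>) proj"
proof -
  have "continuous_on (closed_face \<tau>) (\<lambda>\<mu>. chain_point Y center base \<mu> (card \<tau>))"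
    unfolding continuous_on_def
    using pts.tendsto_chain_point[OF \<tau>] layers_upto_card[OF finite_simplex[OF \<tau>]] by simp
  then show ?thesis using proj_face[OF \<tau>] by (simp cong: continuous_on_cong)
qed

lemma continuous_map_proj: "continuous_map RK (top_of_set Y) proj"
  using continuous_on_proj proj_in
  by (intro continuous_map_from_realization) (auto simp: continuous_map_in_subtopology)


section \<open>The partition of unity and the map to the complex\<close>

definition \<delta> :: real where "\<delta> = (\<beta> - e - r) / 2"

text \<open>Half of the slack \<open>\<beta> - e - r\<close>. Net points near
  \<open>proj \<mu>\<close> and the centres of the chain of \<open>\<mu>\<close> then have pairwise
  distances below \<open>\<beta> - e\<close>, the bound that makes partners in \<open>S\<close> span
  a simplex.\<close>

lemma \<delta>: "0 < \<delta>" "\<delta> + r < \<beta> - e" "2 * \<delta> < \<beta> - e" "\<delta> + e < \<rho>"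
proof -
  have "2 * \<delta> = \<beta> - e - r" by (simp add: \<delta>_def)
  then show "0 < \<delta>" "\<delta> + r < \<beta> - e" "2 * \<delta> < \<beta> - e" "\<delta> + e < \<rho>"
    using small by linarith+
qed

definition net :: "'m set" where
  "net = (SOME N. finite N \<and> N \<subseteq> Y \<and> Y \<subseteq> (\<Union>x\<in>N. ball x \<delta>))"

lemma net: "finite net" "net \<subseteq> Y" "Y \<subseteq> (\<Union>x\<in>net. ball x \<delta>)"
proof -
  have cover: "Y \<subseteq> (\<Union>x\<in>Y. ball x \<delta>)" using \<delta>(1) by auto
  obtain N where "N \<subseteq> Y" "finite N" "Y \<subseteq> (\<Union>x\<in>N. ball x \<delta>)"
    by (rule compactE_image[OF compact _ cover]) auto
  then have "\<exists>N. finite N \<and> N \<subseteq> Y \<and> Y \<subseteq> (\<Union>x\<in>N. ball x \<delta>)" by blast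
  from someI_ex[OF this, folded net_def]
  show "finite net" "net \<subseteq> Y" "Y \<subseteq> (\<Union>x\<in>net. ball x \<delta>)" by auto
qed

definition bump :: "'m \<Rightarrow> 'm \<Rightarrow> real" where
  "bump y x = max 0 (\<delta> - dist y x) / (\<Sum>x\<in>net. max 0 (\<delta> - dist y x))"

definition spread :: "'m \<Rightarrow> 's \<Rightarrow> real" where
  "spread y = pushforward net (bump y) to_S"

definition near :: "'m \<Rightarrow> 'm set" where "near y = {x \<in> net. dist y x < \<delta>}"

lemma bump_denom:
  assumes "y \<in> Y" shows "0 < (\<Sum>x\<in>net. max 0 (\<delta> - dist y x))"
proof -
  obtain x where "x \<in> net" "dist x y < \<delta>" using net(3) assms by auto
  then show ?thesis using net(1) by (intro sum_pos2[of _ x]) (auto simp: dist_commute)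
qed

lemma bump_nonneg: "0 \<le> bump y x"
  by (auto simp: bump_def intro!: divide_nonneg_nonneg sum_nonneg)

lemma sum_bump: "y \<in> Y \<Longrightarrow> sum (bump y) net = 1"
  using bump_denom[of y] by (simp add: bump_def flip: sum_divide_distrib)

lemma bump_pos:
  assumes "x \<in> net" "0 < bump y x" shows "x \<in> near y"
proof (rule ccontr)
  assume "x \<notin> near y"
  then have "bump y x = 0" using assms(1) by (simp add: near_def bump_def)
  then show False using assms(2) by simp
qed

lemma near: "finite (near y)" "near y \<subseteq> Y" "y \<in> Y \<Longrightarrow> near y \<noteq> {}"
proof -
  show "finite (near y)" "near y \<subseteq> Y" using net by (auto simp: near_def)
  assume "y \<in> Y"
  then obtain x where "x \<in> net" "y \<in> ball x \<delta>" using net(3) by blast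
  then have "x \<in> near y" by (simp add: near_def dist_commute)
  then show "near y \<noteq> {}" by blast
qed

lemma near_dist: "x \<in> near y \<Longrightarrow> dist y x < \<delta>"
  by (simp add: near_def)

lemma spread_in_face: 
  assumes "y \<in> Y" "finite \<zeta>" "to_S ` near y \<subseteq> \<zeta>" shows "spread y \<in> closed_face \<zeta>"
  unfolding spread_def
  using assms bump_pos net(1) bump_nonneg sum_bump by (intro pushforward_in_closed_face) auto

lemma near_simplex: 
  assumes "y \<in> Y" shows "to_S ` near y \<in> K"
proof (rule simplex_to_S)
  fix p q assume "p \<in> near y" "q \<in> near y"
  then have "dist y p < \<delta>" "dist y q < \<delta>" by (auto dest: near_dist)
  then have "dist p q < 2 * \<delta>" using dist_triangle3[of p q y] by simp
  then show "dist p q < \<beta> - e" using \<delta>(3) by simp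
qed (use near assms in auto)

lemma continuous_on_spread: "continuous_on Y (\<lambda>y. spread y v)"
  unfolding spread_def bump_def
  using bump_denom by (intro continuous_on_pushforward continuous_intros) force+

lemma spread_support: "v \<notin> to_S ` net \<Longrightarrow> spread y v = 0"
  unfolding spread_def by (intro pushforward_eq_0) auto

lemma continuous_map_spread: "continuous_map (top_of_set Y) RK spread"
proof (rule continuous_map_into_realization[OF K, of "to_S ` net"])
  fix y assume "y \<in> topspace (top_of_set Y)"
  then have y: "y \<in> Y" by simp
  then show "spread y \<in> topspace RK"
    using spread_in_face[OF y] near_simplex[OF y] finite_simplex in_realization by blast
  show "spread y v = 0" if "v \<notin> to_S ` net" for v using that by (rule spread_support)
next
  show "continuous_map (top_of_set Y) euclideanreal (\<lambda>y. spread y v)" for v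
    using continuous_on_spread by simp
qed (use net(1) in simp)

section \<open>The prism from centres to vertices\<close>

definition pick :: "'s set \<Rightarrow> 's" where "pick \<sigma> = (SOME v. v \<in> \<sigma>)"

lemma pick: "\<sigma> \<noteq> {} \<Longrightarrow> pick \<sigma> \<in> \<sigma>"
  unfolding pick_def by (simp add: some_in_eq)

text \<open>At time \<open>0\<close> all mass sits on partners of centres, at time \<open>1\<close>
  on picked vertices.\<close>

definition prism_vertex :: "'s set \<times> bool \<Rightarrow> 's" where
  "prism_vertex = (\<lambda>(\<sigma>, b). if b then pick \<sigma> else to_S (center \<sigma>))"

definition prism :: "real \<times> ('s \<Rightarrow> real) \<Rightarrow> 's \<Rightarrow> real" where
  "prism = (\<lambda>(u, \<mu>). pushforward (faces (support \<mu>) \<times> UNIV) (prism_weight u \<mu>) prism_vertex)"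

lemma prism_face:
  assumes \<tau>: "\<tau> \<in> K" and \<mu>: "\<mu> \<in> closed_face \<tau>"
  shows "prism (u, \<mu>) = pushforward (faces \<tau> \<times> UNIV) (prism_weight u \<mu>) prism_vertex"
  unfolding prism_def prod.case
proof (rule pushforward_mono_neutral)
  note fin = finite_simplex[OF \<tau>]
  show "finite (faces \<tau> \<times> (UNIV :: bool set))" using fin by simp
  show "faces (support \<mu>) \<times> UNIV \<subseteq> faces \<tau> \<times> UNIV" using faces_support_subset[OF fin \<mu>] by blast
  show "prism_weight u \<mu> p = 0" if "p \<in> faces \<tau> \<times> UNIV - faces (support \<mu>) \<times> UNIV" for p
    using that sd_coord_eq_0[OF fin \<mu>] prism_weight_eq_0[OF fin \<mu>] by (cases p) auto
qed

lemma prism_in_face: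
  assumes \<tau>: "\<tau> \<in> K" and \<mu>: "\<mu> \<in> closed_face \<tau>" and \<zeta>: "finite \<zeta>"
    "\<And>\<sigma> b. \<sigma> \<in> chain \<mu> \<Longrightarrow> 0 < prism_weight u \<mu> (\<sigma>, b) \<Longrightarrow> prism_vertex (\<sigma>, b) \<in> \<zeta>"
  shows "prism (u, \<mu>) \<in> closed_face \<zeta>"
  unfolding prism_def prod.case
proof (rule pushforward_in_closed_face)
  note fin = finite_simplex[OF \<tau>]
  show "finite (faces (support \<mu>) \<times> (UNIV :: bool set))" using finite_faces_support[OF fin \<mu>] by simp
  show "0 \<le> prism_weight u \<mu> p" for p by (rule prism_weight_nonneg[OF fin \<mu>])
  show "sum (prism_weight u \<mu>) (faces (support \<mu>) \<times> UNIV) = 1" by (rule sum_prism_weight[OF fin \<mu>])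
  show "prism_vertex p \<in> \<zeta>" if "p \<in> faces (support \<mu>) \<times> UNIV" "0 < prism_weight u \<mu> p" for p
    using that \<zeta>(2) prism_weight_pos[OF fin \<mu>] by (cases p) (auto simp: chain_def)
qed (rule \<zeta>(1))

lemma chain_simplexD:
  assumes "\<tau> \<in> K" "\<mu> \<in> closed_face \<tau>" "\<sigma> \<in> chain \<mu>"
  shows "\<sigma> \<in> K" "\<sigma> \<subseteq> \<tau>" "pick \<sigma> \<in> \<sigma>"
  using chain_of_eq_chain(2)[OF assms(1,2)] support_subset[OF finite_simplex[OF assms(1)] assms(2)] assms(3)
    pick[of \<sigma>] by (auto simp: chain_def faces_def)

lemma dist_center_chain:
  assumes "\<tau> \<in> K" "\<mu> \<in> closed_face \<tau>" "\<sigma> \<in> chain \<mu>" "\<sigma>' \<in> chain \<mu>"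
  shows "dist (center \<sigma>) (center \<sigma>') \<le> r"
proof -
  have "\<sigma> \<subseteq> \<sigma>' \<or> \<sigma>' \<subseteq> \<sigma>"
    using chain_of_chain[OF finite_simplex[OF assms(1)] assms(2)] assms(3,4)
    unfolding chain_of_eq_chain(1)[OF assms(1,2), symmetric] by blast
  then show ?thesis
    using center_nested chain_simplexD(1)[OF assms(1,2)] assms(3,4) by (metis dist_commute)
qed

text \<open>Two picked vertices lie in \<open>\<tau>\<close>. Two centres are within
  \<open>r\<close>, so their partners are closer than \<open>\<beta>\<close> by
  \<open>r + e < \<beta>\<close>. In a mixed pair, \<open>prism_weight_order\<close> puts the picked
  vertex into the simplex of the centre, and the same bound applies.\<close>

lemma prism_in_realization:
  assumes \<tau>: "\<tau> \<in> K" and \<mu>: "\<mu> \<in> closed_face \<tau>"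
  shows "prism (u, \<mu>) \<in> topspace RK"
proof -
  note fin = finite_simplex[OF \<tau>] and chainD = chain_simplexD[OF \<tau> \<mu>]
  define \<zeta> where "\<zeta> = prism_vertex ` {(\<sigma>, b). \<sigma> \<in> chain \<mu> \<and> 0 < prism_weight u \<mu> (\<sigma>, b)}"
  have "finite {(\<sigma>, b). \<sigma> \<in> chain \<mu> \<and> 0 < prism_weight u \<mu> (\<sigma>, b)}"
    by (rule finite_subset[of _ "chain \<mu> \<times> UNIV"]) (use chain_of_eq_chain(4)[OF \<tau> \<mu>] in auto)
  then have fin\<zeta>: "finite \<zeta>" by (simp add: \<zeta>_def)
  have in\<zeta>: "prism (u, \<mu>) \<in> closed_face \<zeta>"
    by (rule prism_in_face[OF \<tau> \<mu> fin\<zeta>]) (auto simp: \<zeta>_def)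
  have cen: "mdist S (to_S (center \<sigma>)) (to_S (center \<sigma>')) < \<beta>" if "\<sigma> \<in> chain \<mu>" "\<sigma>' \<in> chain \<mu>" for \<sigma> \<sigma>'
  proof -
    have "dist (center \<sigma>) (center \<sigma>') \<le> r" using dist_center_chain[OF \<tau> \<mu> that] .
    moreover have "\<bar>dist (center \<sigma>) (center \<sigma>') - mdist S (to_S (center \<sigma>)) (to_S (center \<sigma>'))\<bar> \<le> e"
      using calculation small that chainD(1) by (intro C_close to_S center_in) auto
    ultimately show ?thesis using small by linarith
  qed
  have mix: "mdist S (to_S (center \<sigma>')) (pick \<sigma>) < \<beta>"
    if "\<sigma> \<in> chain \<mu>" "0 < prism_weight u \<mu> (\<sigma>, True)" "\<sigma>' \<in> chain \<mu>" "0 < prism_weight u \<mu> (\<sigma>', False)" for \<sigma> \<sigma>'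
  proof -
    have "\<sigma> \<subseteq> \<sigma>'" using that by (intro prism_weight_order[OF fin \<mu>]) (auto simp: chain_def)
    then have p: "pick \<sigma> \<in> \<sigma>'" using chainD(3)[OF that(1)] by blast
    then have "pick \<sigma> \<in> mspace S" using chainD(1)[OF that(3)] by (auto simp: vietoris_rips_def)
    moreover have le: "dist (center \<sigma>') (to_X (pick \<sigma>)) \<le> r" using center(2)[OF chainD(1)[OF that(3)] p] .
    ultimately have "\<bar>dist (center \<sigma>') (to_X (pick \<sigma>)) - mdist S (to_S (center \<sigma>')) (pick \<sigma>)\<bar> \<le> e"
      using small that chainD(1) by (intro C_close to_S to_X center_in) auto
    then show ?thesis using le small by linarith
  qed
  have pk: "pick \<sigma> \<in> \<tau>" if "\<sigma> \<in> chain \<mu>" for \<sigma> using chainD(2,3)[OF that] by blast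
  have "mdist S v w < \<beta>" if vw: "v \<in> \<zeta>" "w \<in> \<zeta>" for v w
  proof -
    obtain \<sigma> b where v: "v = prism_vertex (\<sigma>, b)" "\<sigma> \<in> chain \<mu>" "0 < prism_weight u \<mu> (\<sigma>, b)"
      using vw(1) by (auto simp: \<zeta>_def)
    obtain \<sigma>' b' where w: "w = prism_vertex (\<sigma>', b')" "\<sigma>' \<in> chain \<mu>" "0 < prism_weight u \<mu> (\<sigma>', b')"
      using vw(2) by (auto simp: \<zeta>_def)
    have pp: "mdist S (pick \<sigma>) (pick \<sigma>') < \<beta>"
      using \<tau> pk[OF v(2)] pk[OF w(2)] unfolding vietoris_rips_def by blast
    show ?thesis
      using v w cen[OF v(2) w(2)] mix[of \<sigma> \<sigma>'] mix[of \<sigma>' \<sigma>] pp mdist_commute[of S v w]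
      by (cases b; cases b') (auto simp: prism_vertex_def)
  qed
  moreover have "\<zeta> \<subseteq> mspace S"
  proof
    fix v assume "v \<in> \<zeta>"
    then obtain \<sigma> b where v: "v = prism_vertex (\<sigma>, b)" "\<sigma> \<in> chain \<mu>" by (auto simp: \<zeta>_def)
    have "\<tau> \<subseteq> mspace S" using \<tau> by (simp add: vietoris_rips_def)
    then show "v \<in> mspace S"
      using v pk[OF v(2)] to_S_in[OF center_in[OF chainD(1)[OF v(2)]]] by (auto simp: prism_vertex_def)
  qed
  moreover have "\<zeta> \<noteq> {}" using in\<zeta> closed_faceD(3)[of _ "{}"] by auto
  ultimately have "\<zeta> \<in> K" using fin\<zeta> by (simp add: vietoris_rips_def)
  then show ?thesis using in\<zeta> in_realization by blast
qed

lemma continuous_on_prism: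
  assumes \<tau>: "\<tau> \<in> K"
  shows "continuous_on ({0..1} \<times> closed_face \<tau>) (\<lambda>p. prism p v)"
proof -
  have "continuous_on ({0..1} \<times> closed_face \<tau>)
      (\<lambda>p. pushforward (faces \<tau> \<times> UNIV) (prism_weight (fst p) (snd p)) prism_vertex v)"
    using continuous_on_prism_weight[OF finite_simplex[OF \<tau>]]
    by (intro continuous_on_pushforward) auto
  then show ?thesis
    by (rule continuous_on_eq) (auto simp: prism_face[OF \<tau>])
qed

lemma prism_support:
  assumes \<tau>: "\<tau> \<in> K" and \<mu>: "\<mu> \<in> closed_face \<tau>" and v: "v \<notin> prism_vertex ` (faces \<tau> \<times> UNIV)"
  shows "prism (u, \<mu>) v = 0"
  unfolding prism_face[OF \<tau> \<mu>] using v by (intro pushforward_eq_0) blast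

lemma continuous_on_prism_slice:
  assumes "\<tau> \<in> K" "u \<in> {0..1}"
  shows "continuous_on (closed_face \<tau>) (\<lambda>\<mu>. prism (u, \<mu>) v)"
  by (rule continuous_on_compose2[OF continuous_on_prism[OF assms(1)]])
    (use assms(2) in \<open>auto intro: continuous_intros\<close>)

section \<open>Homotopies on the complex and on the space\<close>

lemma homotopic_prism: "homotopic_with (\<lambda>_. True) RK RK (\<lambda>\<mu>. prism (0, \<mu>)) (\<lambda>\<mu>. prism (1, \<mu>))"
proof (rule homotopic_realization_maps[OF K, where V = "\<lambda>\<tau>. prism_vertex ` (faces \<tau> \<times> UNIV)"])
  show "prism (s, \<mu>) \<in> topspace RK" if "\<mu> \<in> topspace RK" for s \<mu>
    using that prism_in_realization in_realization by blast
  show "continuous_on ({0..1} \<times> closed_face \<tau>) (\<lambda>p. prism p v)" if "\<tau> \<in> K" for \<tau> v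
    using that by (rule continuous_on_prism)
  show "finite (prism_vertex ` (faces \<tau> \<times> UNIV))" if "\<tau> \<in> K" for \<tau>
    using finite_simplex[OF that] by simp
  show "prism (s, \<mu>) v = 0" if "\<tau> \<in> K" "\<mu> \<in> closed_face \<tau>" "v \<notin> prism_vertex ` (faces \<tau> \<times> UNIV)" for \<tau> \<mu> s v
    using that by (rule prism_support)
qed

text \<open>At time \<open>1\<close> only picked vertices carry mass. Each belongs to a face of
  \<open>\<tau>\<close>, so \<open>\<mu>\<close> and its image share the closed face of
  \<open>\<tau>\<close>.\<close>

lemma homotopic_id_prism: "homotopic_with (\<lambda>_. True) RK RK (\<lambda>\<mu>. prism (1, \<mu>)) id"
proof (rule homotopic_realization_maps_linear[OF K, where V = "\<lambda>\<tau>. \<tau> \<union> prism_vertex ` (faces \<tau> \<times> UNIV)"])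
  fix \<mu> assume "\<mu> \<in> topspace RK"
  then obtain \<tau> where \<tau>: "\<tau> \<in> K" "\<mu> \<in> closed_face \<tau>" using in_realization by blast
  note fin = finite_simplex[OF \<tau>(1)]
  have "prism (1, \<mu>) \<in> closed_face \<tau>"
  proof (rule prism_in_face[OF \<tau> fin])
    fix \<sigma> b assume \<sigma>: "\<sigma> \<in> chain \<mu>" "0 < prism_weight 1 \<mu> (\<sigma>, b)"
    then have b using prism_weight_1[OF fin \<tau>(2), of \<sigma>] by (cases b) (auto simp: chain_def)
    then show "prism_vertex (\<sigma>, b) \<in> \<tau>"
      using chain_simplexD(2,3)[OF \<tau> \<sigma>(1)] by (auto simp: prism_vertex_def)
  qed
  then show "\<exists>\<sigma>\<in>K. prism (1, \<mu>) \<in> closed_face \<sigma> \<and> id \<mu> \<in> closed_face \<sigma>" using \<tau> by auto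
next
  fix \<tau> v assume \<tau>: "\<tau> \<in> K"
  show "continuous_on (closed_face \<tau>) (\<lambda>\<mu>. prism (1, \<mu>) v)"
    using continuous_on_prism_slice[OF \<tau>] by simp
  show "continuous_on (closed_face \<tau>) (\<lambda>\<mu>. id \<mu> v)"
    by (simp add: continuous_on_coordinate)
  show "finite (\<tau> \<union> prism_vertex ` (faces \<tau> \<times> UNIV))"
    using finite_simplex[OF \<tau>] by simp
  show "prism (1, \<mu>) v = 0 \<and> id \<mu> v = 0"
    if "\<mu> \<in> closed_face \<tau>" "v \<notin> \<tau> \<union> prism_vertex ` (faces \<tau> \<times> UNIV)" for \<mu>
    using that prism_support[OF \<tau> that(1), of v] closed_faceD(2)[OF that(1), of v] by simp
qed

lemma homotopic_prism_spread_proj: "homotopic_with (\<lambda>_. True) RK RK (spread \<circ> proj) (\<lambda>\<mu>. prism (0, \<mu>))"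
proof (rule homotopic_realization_maps_linear[OF K, where V = "\<lambda>\<tau>. to_S ` net \<union> prism_vertex ` (faces \<tau> \<times> UNIV)"])
  fix \<mu> assume "\<mu> \<in> topspace RK"
  then obtain \<tau> where \<tau>: "\<tau> \<in> K" "\<mu> \<in> closed_face \<tau>" using in_realization by blast
  note fin = finite_simplex[OF \<tau>(1)]
  have pY: "proj \<mu> \<in> Y" using proj_in[OF \<tau>] .
  \<comment> \<open>Centres of the chain and net points near the projection: their partners span one
    simplex that carries both maps.\<close>
  define P where "P = center ` chain \<mu> \<union> near (proj \<mu>)"
  have finP: "finite P" using chain_of_eq_chain(4)[OF \<tau>] near(1) by (simp add: P_def)
  have d: "dist p q < \<beta> - e" if "p \<in> center ` chain \<mu>" "q \<in> near (proj \<mu>)" for p q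
  proof -
    have "dist p (proj \<mu>) \<le> r" using proj_dist_center[OF \<tau>] that(1) by blast
    then show ?thesis
      using near_dist[OF that(2)] dist_triangle[of p q "proj \<mu>"] \<delta>(2) by linarith
  qed
  have PK: "to_S ` P \<in> K"
  proof (rule simplex_to_S[OF finP])
    show "P \<noteq> {}" using near(3)[OF pY] by (simp add: P_def)
    show "P \<subseteq> Y" using near(2) center_in chain_simplexD(1)[OF \<tau>] by (auto simp: P_def)
    fix p q assume pq: "p \<in> P" "q \<in> P"
    consider "p \<in> center ` chain \<mu>" "q \<in> center ` chain \<mu>" | "p \<in> center ` chain \<mu>" "q \<in> near (proj \<mu>)"
      | "q \<in> center ` chain \<mu>" "p \<in> near (proj \<mu>)" | "p \<in> near (proj \<mu>)" "q \<in> near (proj \<mu>)"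
      using pq by (auto simp: P_def)
    then show "dist p q < \<beta> - e"
    proof cases
      case 1
      then have "dist p q \<le> r" using dist_center_chain[OF \<tau>] by blast
      then show ?thesis using small by linarith
    next
      case 3
      then show ?thesis using d[of q p] by (simp add: dist_commute)
    next
      case 4
      then show ?thesis
        using near_dist[OF 4(1)] near_dist[OF 4(2)] dist_triangle3[of p q "proj \<mu>"] \<delta>(3) by linarith
    qed (rule d)
  qed
  have "spread (proj \<mu>) \<in> closed_face (to_S ` P)"
    using finP by (intro spread_in_face[OF pY]) (auto simp: P_def)
  moreover have "prism (0, \<mu>) \<in> closed_face (to_S ` P)"
  proof (rule prism_in_face[OF \<tau>])
    show "finite (to_S ` P)" using finP by simp
    fix \<sigma> b assume \<sigma>: "\<sigma> \<in> chain \<mu>" "0 < prism_weight 0 \<mu> (\<sigma>, b)"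
    then have "\<not> b" using prism_weight_0[OF fin \<tau>(2), of \<sigma>] by (cases b) auto
    then show "prism_vertex (\<sigma>, b) \<in> to_S ` P" using \<sigma>(1) by (auto simp: prism_vertex_def P_def)
  qed
  ultimately show "\<exists>\<sigma>\<in>K. (spread \<circ> proj) \<mu> \<in> closed_face \<sigma> \<and> prism (0, \<mu>) \<in> closed_face \<sigma>"
    using PK by auto
next
  fix \<tau> v assume \<tau>: "\<tau> \<in> K"
  show "continuous_on (closed_face \<tau>) (\<lambda>\<mu>. (spread \<circ> proj) \<mu> v)"
    unfolding o_def
    by (rule continuous_on_compose2[OF continuous_on_spread continuous_on_proj[OF \<tau>]])
      (use proj_in[OF \<tau>] in auto)
  show "continuous_on (closed_face \<tau>) (\<lambda>\<mu>. prism (0, \<mu>) v)"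
    using continuous_on_prism_slice[OF \<tau>] by simp
  show "finite (to_S ` net \<union> prism_vertex ` (faces \<tau> \<times> UNIV))"
    using finite_simplex[OF \<tau>] net(1) by simp
  show "(spread \<circ> proj) \<mu> v = 0 \<and> prism (0, \<mu>) v = 0"
    if "\<mu> \<in> closed_face \<tau>" "v \<notin> to_S ` net \<union> prism_vertex ` (faces \<tau> \<times> UNIV)" for \<mu>
    using that prism_support[OF \<tau> that(1), of v] spread_support[of v] by simp
qed

text \<open>The closed ball of radius \<open>\<delta> + e < \<rho>\<close> about \<open>y\<close>
  contains the images of the vertices carrying \<open>spread y\<close>, hence the centres, hence the
  combination of the centres: the ball hull is used twice.\<close>

lemma proj_spread_near:
  assumes y: "y \<in> Y"
  shows "dist (proj (spread y)) y < \<rho>"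
proof -
  let ?\<tau> = "to_S ` near y"
  have \<tau>: "?\<tau> \<in> K" "spread y \<in> closed_face ?\<tau>"
    using near_simplex[OF y] spread_in_face[OF y] near(1) by auto
  have v: "dist y (to_X v) \<le> \<delta> + e" if v: "v \<in> ?\<tau>" for v
  proof -
    obtain x where x: "x \<in> near y" "v = to_S x" using v by blast
    have xY: "x \<in> Y" using x near(2) by blast
    have vS: "v \<in> mspace S" using to_S_in[OF xY] x by simp
    \<comment> \<open>Both \<open>(x, v)\<close> and \<open>(to_X v, v)\<close> belong to
      \<open>C\<close>, so the distortion bound applies with distance \<open>0\<close> in
      \<open>S\<close>.\<close>
    have "mdist S v v = 0" using vS by (simp add: Metric_space.mdist_zero)
    moreover have "\<bar>dist x (to_X v) - mdist S v v\<bar> \<le> e"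
      using to_S[OF xY] to_X[OF vS] x(2) calculation small by (intro C_close) auto
    ultimately have "dist x (to_X v) \<le> e" by simp
    then show ?thesis using near_dist[OF x(1)] dist_triangle[of y "to_X v" x] by linarith
  qed
  have "dist y (proj (spread y)) \<le> \<delta> + e"
  proof (rule ball_hullD[OF proj_in_ball_hull[OF \<tau>] y \<delta>(4)])
    fix p assume "p \<in> center ` chain (spread y)"
    then obtain \<sigma> where \<sigma>: "\<sigma> \<in> chain (spread y)" "p = center \<sigma>" by blast
    show "dist y p \<le> \<delta> + e"
      unfolding \<sigma>(2)
      by (rule ball_hullD[OF center(1)[OF chain_simplexD(1)[OF \<tau> \<sigma>(1)]] y \<delta>(4)])
        (use v chain_simplexD(2)[OF \<tau> \<sigma>(1)] in blast)
  qed
  then show ?thesis using \<delta>(4) by (simp add: dist_commute)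
qed

lemma homotopic_proj_spread: "homotopic_with (\<lambda>_. True) (top_of_set Y) (top_of_set Y) (proj \<circ> spread) id"
proof -
  let ?p = "\<lambda>y. proj (spread y)"
  have "continuous_map (top_of_set Y) (top_of_set Y) (proj \<circ> spread)"
    using continuous_map_compose continuous_map_spread continuous_map_proj by blast
  then have pc: "continuous_on Y ?p" and p: "\<And>y. y \<in> Y \<Longrightarrow> ?p y \<in> Y"
    by (auto simp: continuous_map_in_subtopology o_def)
  \<comment> \<open>The values off \<open>Y\<close> only match the end maps, which
    \<open>homotopic_with\<close> prescribes at all points of the type.\<close>
  define h where "h = (\<lambda>(t, y). if y \<in> Y then geod Y (?p y) y t else if t = 0 then ?p y else y)"
  have cp: "continuous_on ({0..1::real} \<times> Y) (\<lambda>z. ?p (snd z))"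
    by (rule continuous_on_compose2[OF pc continuous_on_snd]) (auto intro: continuous_intros)
  have "continuous_on ({0..1} \<times> Y) (\<lambda>z. case (?p (snd z), snd z, fst z) of (x, y, t) \<Rightarrow> geod Y x y t)"
  proof (rule continuous_on_compose2[OF continuous_on_geod])
    show "continuous_on ({0..1::real} \<times> Y) (\<lambda>z. (?p (snd z), snd z, fst z))"
      by (intro continuous_on_Pair continuous_on_snd continuous_on_fst continuous_on_id cp)
    show "(\<lambda>z. (?p (snd z), snd z, fst z)) ` ({0..1} \<times> Y)
        \<subseteq> {(x, y, t). x \<in> Y \<and> y \<in> Y \<and> dist x y < \<rho> \<and> 0 \<le> t \<and> t \<le> 1}"
      using p proj_spread_near by auto
  qed
  then have "continuous_on ({0..1} \<times> Y) h"
    by (rule continuous_on_eq) (auto simp: h_def)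
  moreover have "h \<in> {0..1} \<times> Y \<rightarrow> Y" using p geod(1) by (auto simp: h_def)
  ultimately have "continuous_map (prod_topology (top_of_set {0..1}) (top_of_set Y)) (top_of_set Y) h"
    by (simp add: continuous_map_in_subtopology)
  moreover have "h (0, y) = (proj \<circ> spread) y" "h (1, y) = id y" for y
    using geod_0 geod_1 p by (auto simp: h_def)
  ultimately show ?thesis unfolding homotopic_with_def by blast
qed

theorem rips_homotopy_equivalent: "RK homotopy_equivalent_space top_of_set Y"
  unfolding homotopy_equivalent_space_def
proof (intro exI conjI)
  show "continuous_map RK (top_of_set Y) proj" by (rule continuous_map_proj)
  show "continuous_map (top_of_set Y) RK spread" by (rule continuous_map_spread)
  show "homotopic_with (\<lambda>x. True) RK RK (spread \<circ> proj) id"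
    using homotopic_prism_spread_proj homotopic_prism homotopic_id_prism homotopic_with_trans by blast
  show "homotopic_with (\<lambda>x. True) (top_of_set Y) (top_of_set Y) (proj \<circ> spread) id"
    by (rule homotopic_proj_spread)
qed

end

section \<open>Embedding the abstract space\<close>

text \<open>The Kuratowski embedding moves \<open>X\<close> isometrically into a metric space in the type class sense.\<close>

definition kuratowski :: "'a metric \<Rightarrow> 'a \<Rightarrow> 'a \<Rightarrow> ('a discrete \<Rightarrow>\<^sub>C real)" where
  "kuratowski X b x = Bcontfun (\<lambda>z. if of_discrete z \<in> mspace X
     then mdist X x (of_discrete z) - mdist X b (of_discrete z) else 0)"

lemma kuratowski_apply:
  assumes "b \<in> mspace X" "x \<in> mspace X"
  shows "apply_bcontfun (kuratowski X b x) z = (if of_discrete z \<in> mspace X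
     then mdist X x (of_discrete z) - mdist X b (of_discrete z) else 0)"
proof -
  let ?f = "\<lambda>z. if of_discrete z \<in> mspace X
     then mdist X x (of_discrete z) - mdist X b (of_discrete z) else 0"
  \<comment> \<open>Subtracting the distance from the base point is what makes the function
    bounded.\<close>
  have "\<bar>mdist X x w - mdist X b w\<bar> \<le> mdist X x b" if "w \<in> mspace X" for w
    using mdist_triangle[of x X b w] mdist_triangle[of b X x w] assms that
    by (simp add: mdist_commute[of X b x] abs_le_iff)
  then have "bounded (range ?f)"
    unfolding bounded_iff by (intro exI[of _ "mdist X x b"]) auto
  \<comment> \<open>The index type carries the discrete topology, so continuity is
    automatic.\<close>
  moreover have "continuous_on UNIV ?f"
    using open_discrete by (intro continuous_on_open_vimage[THEN iffD2]) auto
  ultimately have "?f \<in> bcontfun" by (simp add: bcontfun_def)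
  then show ?thesis unfolding kuratowski_def by (simp add: Bcontfun_inverse)
qed

text \<open>The triangle inequality bounds the difference of the two distance functions, and
  evaluation at \<open>y\<close> attains the bound.\<close>

lemma dist_kuratowski:
  assumes "b \<in> mspace X" "x \<in> mspace X" "y \<in> mspace X"
  shows "dist (kuratowski X b x) (kuratowski X b y) = mdist X x y"
proof (rule antisym)
  have "\<bar>mdist X x w - mdist X y w\<bar> \<le> mdist X x y" if "w \<in> mspace X" for w
    using mdist_triangle[of x X y w] mdist_triangle[of y X x w] assms that
    by (simp add: mdist_commute[of X y x] abs_le_iff)
  then show "dist (kuratowski X b x) (kuratowski X b y) \<le> mdist X x y"
    using assms by (intro dist_bound) (auto simp: kuratowski_apply dist_real_def)
  have "mdist X y y = 0" using assms by (simp add: mdist_eq_0_iff)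
  then have "mdist X x y = \<bar>mdist X x y - mdist X y y\<bar>" by (simp only:) simp
  also have "\<dots> = dist (kuratowski X b x (discrete y)) (kuratowski X b y (discrete y))"
    using assms by (simp add: kuratowski_apply dist_real_def discrete_inverse)
  also have "\<dots> \<le> dist (kuratowski X b x) (kuratowski X b y)" by (rule dist_bounded)
  finally show "mdist X x y \<le> dist (kuratowski X b x) (kuratowski X b y)" .
qed

lemma isometric_image_homeomorphic:
  fixes \<phi> :: "'a \<Rightarrow> 'b::metric_space"
  assumes iso: "\<And>x y. x \<in> mspace X \<Longrightarrow> y \<in> mspace X \<Longrightarrow> dist (\<phi> x) (\<phi> y) = mdist X x y"
  shows "mtopology_of X homeomorphic_space top_of_set (\<phi> ` mspace X)"
proof -
  let ?Y = "\<phi> ` mspace X" and ?\<psi> = "inv_into (mspace X) \<phi>"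
  have "inj_on \<phi> (mspace X)"
  proof (rule inj_onI)
    fix x y assume xy: "x \<in> mspace X" "y \<in> mspace X" "\<phi> x = \<phi> y"
    then have "mdist X x y = 0" using iso[OF xy(1,2)] by simp
    then show "x = y" using mdist_eq_0_iff[OF xy(1,2)] by simp
  qed
  then have inv: "?\<psi> (\<phi> x) = x" if "x \<in> mspace X" for x using that by simp
  have top: "mtopology_of (submetric euclidean_metric ?Y) = top_of_set ?Y"
    by (simp add: mtopology_of_submetric)
  have "Lipschitz_continuous_map X (submetric euclidean_metric ?Y) \<phi>"
    unfolding Lipschitz_continuous_map_def by (intro conjI exI[of _ 1]) (auto simp: iso)
  then have 1: "continuous_map (mtopology_of X) (top_of_set ?Y) \<phi>"
    unfolding top[symmetric] by (rule Lipschitz_continuous_imp_continuous_map)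
  have "Lipschitz_continuous_map (submetric euclidean_metric ?Y) X ?\<psi>"
    unfolding Lipschitz_continuous_map_def by (intro conjI exI[of _ 1]) (auto simp: iso inv)
  then have 2: "continuous_map (top_of_set ?Y) (mtopology_of X) ?\<psi>"
    unfolding top[symmetric] by (rule Lipschitz_continuous_imp_continuous_map)
  show ?thesis
    unfolding homeomorphic_space_def homeomorphic_maps_def
    using 1 2 inv by (intro exI[of _ \<phi>] exI[of _ ?\<psi>]) auto
qed

text \<open>The infimum over correspondences is below \<open>2 * \<epsilon>\<close>, so a single
  correspondence has its whole distortion below it, at all distances and hence for every
  \<open>R\<close>.\<close>

lemma gh_dist_less_imp_gh_close:
  assumes "gh_dist X S < ennreal \<epsilon>" "0 < \<epsilon>"
  shows "gh_close \<epsilon> R X S"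
proof -
  let ?dis = "\<lambda>C. SUP ((x1, y1), (x2, y2)) \<in> C \<times> C. ennreal \<bar>mdist X x1 x2 - mdist S y1 y2\<bar>"
  have "(INF C \<in> {C. correspondence X S C}. ?dis C) < ennreal (2 * \<epsilon>)"
  proof (rule ccontr)
    assume "\<not> ?thesis"
    then have "ennreal (2 * \<epsilon>) / ennreal 2 \<le> gh_dist X S"
      unfolding gh_dist_def using divide_right_mono_ennreal by fastforce
    also have "ennreal (2 * \<epsilon>) / ennreal 2 = ennreal \<epsilon>" using assms(2) by (simp add: divide_ennreal del: ennreal_numeral)
    finally show False using assms(1) by simp
  qed
  then obtain C where C: "correspondence X S C" "?dis C < ennreal (2 * \<epsilon>)"
    unfolding INF_less_iff by blast
  have "\<bar>mdist X x1 x2 - mdist S y1 y2\<bar> \<le> 2 * \<epsilon>" if "(x1, y1) \<in> C" "(x2, y2) \<in> C" for x1 y1 x2 y2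
  proof -
    have "ennreal \<bar>mdist X x1 x2 - mdist S y1 y2\<bar> \<le> ?dis C"
      using that by (intro SUP_upper2[of "((x1, y1), (x2, y2))"]) auto
    then have "ennreal \<bar>mdist X x1 x2 - mdist S y1 y2\<bar> < ennreal (2 * \<epsilon>)" using C(2) by order
    then show ?thesis using assms(2) by (simp add: ennreal_less_iff)
  qed
  then show ?thesis using C(1) unfolding gh_close_def by blast
qed

text \<open>Density yields a radius strictly between \<open>q * \<beta>\<close> and the convexity
  radius: balls of radius \<open>\<rho>\<close> are still convex, and closed balls of radius
  \<open>q * \<beta>\<close> lie inside them.\<close>

lemma less_Delta:
  assumes "0 < q" "0 \<le> \<beta>" "ennreal \<beta> < Delta \<kappa> X / ennreal q"
  obtains \<rho> where "q * \<beta> < \<rho>" "ennreal \<rho> < convexity_radius X"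
    "\<kappa> > 0 \<Longrightarrow> q * \<beta> < pi / (4 * sqrt \<kappa>)"
proof -
  have D: "ennreal (q * \<beta>) < Delta \<kappa> X"
  proof (rule ccontr)
    assume "\<not> ?thesis"
    then have "Delta \<kappa> X / ennreal q \<le> ennreal (q * \<beta>) / ennreal q"
      by (intro divide_right_mono_ennreal) simp
    also have "\<dots> = ennreal \<beta>" using assms by (simp add: divide_ennreal)
    finally show False using assms(3) by simp
  qed
  have "Delta \<kappa> X \<le> convexity_radius X" by (simp add: Delta_def)
  then have "ennreal (q * \<beta>) < convexity_radius X" using D by order
  then obtain z where z: "ennreal (q * \<beta>) < z" "z < convexity_radius X" using dense by blast
  then obtain \<rho> where \<rho>: "0 \<le> \<rho>" "z = ennreal \<rho>" by (cases z) auto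
  have "q * \<beta> < pi / (4 * sqrt \<kappa>)" if "\<kappa> > 0"
    using D that assms by (auto simp: Delta_def ennreal_less_iff)
  then show ?thesis using that[of \<rho>] z \<rho> assms by (auto simp: ennreal_less_iff)
qed

lemma rips_close_imp_homotopy_equivalent:
  fixes X :: "'a metric" and S :: "'b metric"
  assumes compact: "compact_space (mtopology_of X)"
    and geo: "geodesic_space X"
    and curv: "curvature_le \<kappa> X"
    and \<xi>: "0 < \<xi>" "\<xi> \<le> 1/14"
    and \<beta>: "0 < \<beta>" "ennreal \<beta> < Delta \<kappa> X / ennreal (1 + 2 * \<xi>)"
    and close: "gh_close (\<xi> * \<beta>) \<beta> X S"
  shows "geometric_realization (vietoris_rips \<beta> S) homotopy_equivalent_space mtopology_of X"
proof -
  obtain C where "correspondence X S C"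
    and cl: "\<forall>(x1, y1)\<in>C. \<forall>(x2, y2)\<in>C. min (mdist X x1 x2) (mdist S y1 y2) \<le> \<beta>
      \<longrightarrow> \<bar>mdist X x1 x2 - mdist S y1 y2\<bar> \<le> 2 * (\<xi> * \<beta>)"
    using close unfolding gh_close_def by auto
  then have C: "C \<subseteq> mspace X \<times> mspace S" "fst ` C = mspace X" "snd ` C = mspace S"
    by (auto simp only: correspondence_def)
  have C_close: "\<bar>mdist X x1 x2 - mdist S y1 y2\<bar> \<le> 2 * (\<xi> * \<beta>)"
    if "(x1, y1) \<in> C" "(x2, y2) \<in> C" "min (mdist X x1 x2) (mdist S y1 y2) \<le> \<beta>" for x1 y1 x2 y2
    using bspec[OF cl that(1)] that(2,3) by auto
  show ?thesis
  proof (cases "mspace X = {}")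
    case True
    then have "mspace S = {}" using C by auto
    then have "vietoris_rips \<beta> S = {}" by (auto simp: vietoris_rips_def)
    then have "topspace (geometric_realization (vietoris_rips \<beta> S)) = {}"
      by (simp add: topspace_geometric_realization)
    moreover have "topspace (mtopology_of X) = {}" using True by simp
    ultimately show ?thesis
      by (metis homeomorphic_empty_space_eq homeomorphic_imp_homotopy_equivalent_space null_topspace_iff_trivial)
  next
    case False
    then obtain b where b: "b \<in> mspace X" by blast
    define e where "e = 2 * (\<xi> * \<beta>)"
    have D: "(1 + 2 * \<xi>) * \<beta> = \<beta> + e" by (simp add: e_def algebra_simps)
    have e: "0 < e" "7 * e \<le> \<beta>" using \<xi> \<beta> by (auto simp: e_def)
    obtain \<rho> where \<rho>: "\<beta> + e < \<rho>" "ennreal \<rho> < convexity_radius X"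
      "\<kappa> > 0 \<Longrightarrow> \<beta> + e < pi / (4 * sqrt \<kappa>)"
      using less_Delta[of "1 + 2 * \<xi>" \<beta> \<kappa> X] \<xi> \<beta> D by auto
    have \<rho>0: "0 < \<rho>" using \<rho> e \<beta> by linarith
    define r where "r = 37/50 * (\<beta> + e)"
    \<comment> \<open>With \<open>7 * e \<le> \<beta>\<close>, which is
      \<open>\<xi> \<le> 1/14\<close>, the sum \<open>50 * (r + e) = 37 * \<beta> + 87 * e\<close>
      is at most \<open>(37 + 87/7) * \<beta>\<close>, hence below
      \<open>50 * \<beta>\<close>.\<close>
    have "50 * r = 37 * \<beta> + 37 * e" by (simp add: r_def)
    then have r: "0 < r" "r + e < \<beta>" using e \<beta>(1) by linarith+
    have conv: "geodesically_convex X (mball_of X c s)" if "c \<in> mspace X" "0 < s" "s \<le> \<rho>" for c s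
      using convexity_radius_gt[OF \<rho>(2)] that \<rho>0 by auto
    let ?\<phi> = "kuratowski X b"
    let ?Y = "?\<phi> ` mspace X"
    note iso = dist_kuratowski[OF b]
    have homeo: "mtopology_of X homeomorphic_space top_of_set ?Y"
      by (rule isometric_image_homeomorphic) (rule iso)
    have "rips_close ?Y \<rho> S (map_prod ?\<phi> id ` C) \<beta> e r"
    proof
      show "compact ?Y"
        using homeomorphic_compact_space[OF homeo] compact
        by (simp add: compactin_subspace flip: compactin_euclidean_iff)
    next
      fix x y t assume "x \<in> ?Y" "y \<in> ?Y" and t: "0 \<le> t" "t \<le> (1::real)"
      then obtain x' y' where "x' \<in> mspace X" "y' \<in> mspace X" "x = ?\<phi> x'" "y = ?\<phi> y'" by auto
      then show "\<exists>p\<in>?Y. dist x p = t * dist x y \<and> dist p y = (1 - t) * dist x y"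
        using geodesic_space_point[OF geo _ _ t, of x' y'] by (auto simp: iso)
    next
      fix c x y p s
      assume "c \<in> ?Y" "x \<in> ?Y" "y \<in> ?Y" "p \<in> ?Y" and s: "0 < s" "s \<le> \<rho>"
        and d: "dist c x < s" "dist c y < s" "dist x p + dist p y = dist x y"
      then obtain c' x' y' p' where in_X: "c' \<in> mspace X" "x' \<in> mspace X" "y' \<in> mspace X" "p' \<in> mspace X"
        and eq: "c = ?\<phi> c'" "x = ?\<phi> x'" "y = ?\<phi> y'" "p = ?\<phi> p'" by auto
      have "p' \<in> mball_of X c' s"
        using geodesically_convex_between[OF geo conv[OF in_X(1) s], of x' y' p'] d in_X
        by (auto simp: eq iso)
      then show "dist c p < s" using in_X by (simp add: eq iso)
    next
      fix x y p q
      assume "x \<in> ?Y" "y \<in> ?Y" "p \<in> ?Y" "q \<in> ?Y"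
        and d: "dist x y < \<rho>" "dist x p + dist p y = dist x y" "dist x q + dist q y = dist x y" "dist x p = dist x q"
      then obtain x' y' p' q' where in_X: "x' \<in> mspace X" "y' \<in> mspace X" "p' \<in> mspace X" "q' \<in> mspace X"
        and eq: "x = ?\<phi> x'" "y = ?\<phi> y'" "p = ?\<phi> p'" "q = ?\<phi> q'" by auto
      have d': "mdist X x' y' < \<rho>" "mdist X x' p' + mdist X p' y' = mdist X x' y'"
        "mdist X x' q' + mdist X q' y' = mdist X x' y'" "mdist X x' p' = mdist X x' q'"
        using d in_X by (auto simp: eq iso)
      have "mdist X x' x' = 0" using in_X by (simp add: mdist_eq_0_iff)
      then have "x' \<in> mball_of X x' \<rho>" "y' \<in> mball_of X x' \<rho>"
        using in_X \<rho>0 d'(1) unfolding in_mball_of by metis+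
      then have "p' = q'"
        using geodesically_convex_unique_between[OF geo conv[OF in_X(1) \<rho>0 order_refl]] in_X d' by blast
      then show "p = q" by (simp add: eq)
    next
      show "map_prod ?\<phi> id ` C \<subseteq> ?Y \<times> mspace S" using C(1) by auto
    next
      fix y assume "y \<in> ?Y"
      then obtain x where "x \<in> fst ` C" "y = ?\<phi> x" using C(2) by auto
      then show "\<exists>s. (y, s) \<in> map_prod ?\<phi> id ` C" by force
    next
      fix s assume "s \<in> mspace S"
      then have "s \<in> snd ` C" using C(3) by simp
      then show "\<exists>y. (y, s) \<in> map_prod ?\<phi> id ` C" by force
    next
      fix y s y' s'
      assume "(y, s) \<in> map_prod ?\<phi> id ` C" "(y', s') \<in> map_prod ?\<phi> id ` C" and d: "dist y y' \<le> \<beta> \<or> mdist S s s' \<le> \<beta>"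
      then obtain x x' where x: "(x, s) \<in> C" "(x', s') \<in> C" "y = ?\<phi> x" "y' = ?\<phi> x'" by auto
      then have "x \<in> mspace X" "x' \<in> mspace X" using C(1) by auto
      then have "dist y y' = mdist X x x'" using x by (simp add: iso)
      then show "\<bar>dist y y' - mdist S s s'\<bar> \<le> e"
        using C_close[OF x(1,2)] d by (auto simp: e_def min_le_iff_disj)
    next
      show "0 < e" "0 < r" "r + e < \<beta>" "\<beta> + e < \<rho>" using e r \<rho> by auto
      show "?Y \<noteq> {}" using False by simp
    next
      fix l assume l: "r < l" "l \<le> \<beta> + e"
      have "\<exists>s. 0 < s \<and> s < l \<and>
        (\<forall>c\<in>mspace X. \<forall>z\<in>mspace X. \<forall>w\<in>mspace X. \<forall>y\<in>mspace X.
          mdist X c z = l \<longrightarrow> mdist X c w \<le> l \<longrightarrow> mdist X z w \<le> \<beta> + e \<longrightarrow>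
          mdist X c y = s \<longrightarrow> mdist X y z = l - s \<longrightarrow> mdist X y w < l)"
      proof (rule jung_step[OF geo curv])
        show "geodesically_convex X (mball_of X c \<rho>)" if "c \<in> mspace X" for c
          using conv[OF that \<rho>0] by simp
      qed (use \<rho> l \<beta> e in \<open>auto simp: r_def\<close>)
      then show "\<exists>s. 0 < s \<and> s < l \<and>
        (\<forall>c\<in>?Y. \<forall>z\<in>?Y. \<forall>w\<in>?Y. \<forall>y\<in>?Y. dist c z = l \<longrightarrow> dist c w \<le> l \<longrightarrow> dist z w \<le> \<beta> + e \<longrightarrow>
          dist c y = s \<longrightarrow> dist y z = l - s \<longrightarrow> dist y w < l)"
        by (simp add: iso)
    qed
    then have "geometric_realization (vietoris_rips \<beta> S) homotopy_equivalent_space top_of_set ?Y"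
      by (rule rips_close.rips_homotopy_equivalent)
    moreover have "top_of_set ?Y homotopy_equivalent_space mtopology_of X"
      using homeo homeomorphic_space_sym homeomorphic_imp_homotopy_equivalent_space by blast
    ultimately show ?thesis by (rule homotopy_eqv_trans)
  qed
qed

theorem theorem2:
  fixes \<kappa> \<xi> \<beta> :: real and X :: "'a metric" and S :: "'b metric"
  assumes "compact_space (mtopology_of X)"
    and "geodesic_space X"
    and "curvature_le \<kappa> X"
    and "0 < \<xi>" and "\<xi> \<le> 1/14"
    and "0 < \<beta>" and "ennreal \<beta> < Delta \<kappa> X / ennreal (1 + 2 * \<xi>)"
    and "compact_space (mtopology_of S)"
  shows "(gh_close (\<xi> * \<beta>) \<beta> X S \<longrightarrow>
            geometric_realization (vietoris_rips \<beta> S) homotopy_equivalent_space mtopology_of X) \<and>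
         (gh_dist X S < ennreal (\<xi> * \<beta>) \<longrightarrow>
            geometric_realization (vietoris_rips \<beta> S) homotopy_equivalent_space mtopology_of X)"
proof (intro conjI impI)
  assume "gh_close (\<xi> * \<beta>) \<beta> X S"
  then show "geometric_realization (vietoris_rips \<beta> S) homotopy_equivalent_space mtopology_of X"
    by (rule rips_close_imp_homotopy_equivalent[OF assms(1-7)])
next
  assume "gh_dist X S < ennreal (\<xi> * \<beta>)"
  then have "gh_close (\<xi> * \<beta>) \<beta> X S"
    using assms(4,6) by (intro gh_dist_less_imp_gh_close) auto
  then show "geometric_realization (vietoris_rips \<beta> S) homotopy_equivalent_space mtopology_of X"
    by (rule rips_close_imp_homotopy_equivalent[OF assms(1-7)])
qed

end
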